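(* Let $\alpha>-1$, $p\ge1$, $i\in\mathbb S^2$, and let $f\in\mathcal{SR}(\mathbb B)$. Then $f\in\mathfrak B_p$ if and only if $f\in\mathbf K_{\alpha,i}L^p(\mathbb B_i,d\lambda_i,\mathbb H)$, i.e. if and only if there is $h\in L^p(\mathbb B_i,d\lambda_i,\mathbb H)$ with $f=\mathbf K_{\alpha,i}[h]$.
   Context: $\mathbb H$ denotes the quaternions with real part coordinate $x_0$, $\mathbb S^2$ the sphere of purely imaginary unit quaternions, $\mathbb C(i)=\{x+iy:x,y\in\mathbb R\}$ for $i\in\mathbb S^2$, $\mathbb B$ the open unit ball of $\mathbb H$, $\mathbb B_i=\mathbb B\cap\mathbb C(i)$. A real differentiable function $f:\mathbb B\to\mathbb H$ is (left) slice regular if for every $i\in\mathbb S^2$, $\left(\frac{\partial}{\partial x}+i\frac{\partial}{\partial y}\right)f(x+iy)=0$ on $\mathbb B_i$; $\mathcal{SR}(\mathbb B)$ is the set of these functions. $dA_i=\frac1\pi dx\,dy$ on $\mathbb B_i$, $dA_{\alpha,i}(z)=(\alpha+1)(1-|z|^2)^\alpha dA_i(z)$, and $d\lambda_i(z)=\frac{dA_i(z)}{(1-|z|^2)^2}$. For $p>0$ and $n\in\mathbb N$ with $pn>1$, the slice regular Besov space $\mathfrak B_p$ is the set of $f\in\mathcal{SR}(\mathbb B)$ with $\sup_{i\in\mathbb S^2}\int_{\mathbb B_i}|(1-|z|^2)^n\partial_{x_0}^nf(z)|^pd\lambda_i(z)<\infty$ (independent of the choice of $n$). $L^p(\mathbb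 B_i,d\lambda_i,\mathbb H)$ is the set of (measurable) $h:\mathbb B_i\to\mathbb H$ with $\int_{\mathbb B_i}|h|^pd\lambda_i<\infty$. For $g:\mathbb B_i\to\mathbb C(i)$ holomorphic, $P_i[g]\in\mathcal{SR}(\mathbb B)$ is the slice regular extension $P_i[g](x+I_qy)=\frac12[(1+I_qi)g(x-yi)+(1-I_qi)g(x+yi)]$. The $\alpha$-weighted slice regular Bergman kernel is, for $w\in\mathbb B_i$, $$K_\alpha(\cdot,w)=P_i\left[z\mapsto\frac1{(1-z\bar w)^{2+\alpha}}\right],$$ with the principal branch of the power. The Bergman type projection is $\mathbf K_{\alpha,i}[h](q)=\int_{\mathbb B_i}K_\alpha(q,w)h(w)\,dA_{\alpha,i}(w)$, $q\in\mathbb B$. *)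

theory Defs
  imports "HOL-Analysis.Analysis"
begin

section \<open>Quaternions\<close>

datatype quat = Quat (q0: real) (q1: real) (q2: real) (q3: real)

lemma quat_eq_iff: "p = q \<longleftrightarrow> q0 p = q0 q \<and> q1 p = q1 q \<and> q2 p = q2 q \<and> q3 p = q3 q"
  by (cases p; cases q) simp

instantiation quat :: real_algebra_1
begin

definition zero_quat where "zero_quat = Quat 0 0 0 0"
definition one_quat where "one_quat = Quat 1 0 0 0"
definition plus_quat where
  "plus_quat p q = Quat (q0 p + q0 q) (q1 p + q1 q) (q2 p + q2 q) (q3 p + q3 q)"
definition uminus_quat where
  "uminus_quat p = Quat (- q0 p) (- q1 p) (- q2 p) (- q3 p)"
definition minus_quat where
  "minus_quat p q = Quat (q0 p - q0 q) (q1 p - q1 q) (q2 p - q2 q) (q3 p - q3 q)"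
definition times_quat where
  "times_quat p q = Quat
     (q0 p * q0 q - q1 p * q1 q - q2 p * q2 q - q3 p * q3 q)
     (q0 p * q1 q + q1 p * q0 q + q2 p * q3 q - q3 p * q2 q)
     (q0 p * q2 q - q1 p * q3 q + q2 p * q0 q + q3 p * q1 q)
     (q0 p * q3 q + q1 p * q2 q - q2 p * q1 q + q3 p * q0 q)"
definition scaleR_quat where
  "scaleR_quat r p = Quat (r * q0 p) (r * q1 p) (r * q2 p) (r * q3 p)"

lemmas quat_defs = zero_quat_def one_quat_def plus_quat_def uminus_quat_def minus_quat_def
  times_quat_def scaleR_quat_def

instance
  by standard (simp_all add: quat_eq_iff quat_defs algebra_simps)

end

lemma quat_sel_simps [simp]:
  "q0 0 = 0" "q1 0 = 0" "q2 0 = 0" "q3 0 = 0"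
  "q0 1 = 1" "q1 1 = 0" "q2 1 = 0" "q3 1 = 0"
  "q0 (p + q) = q0 p + q0 q" "q1 (p + q) = q1 p + q1 q"
  "q2 (p + q) = q2 p + q2 q" "q3 (p + q) = q3 p + q3 q"
  "q0 (- p) = - q0 p" "q1 (- p) = - q1 p" "q2 (- p) = - q2 p" "q3 (- p) = - q3 p"
  "q0 (p - q) = q0 p - q0 q" "q1 (p - q) = q1 p - q1 q"
  "q2 (p - q) = q2 p - q2 q" "q3 (p - q) = q3 p - q3 q"
  "q0 (r *\<^sub>R p) = r * q0 p" "q1 (r *\<^sub>R p) = r * q1 p"
  "q2 (r *\<^sub>R p) = r * q2 p" "q3 (r *\<^sub>R p) = r * q3 p"
  by (simp_all add: quat_defs)

instantiation quat :: real_inner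
begin

definition inner_quat :: "quat \<Rightarrow> quat \<Rightarrow> real" where
  "inner_quat p q = q0 p * q0 q + q1 p * q1 q + q2 p * q2 q + q3 p * q3 q"
definition norm_quat :: "quat \<Rightarrow> real" where
  "norm_quat p = sqrt ((q0 p)\<^sup>2 + (q1 p)\<^sup>2 + (q2 p)\<^sup>2 + (q3 p)\<^sup>2)"
definition sgn_quat :: "quat \<Rightarrow> quat" where
  "sgn_quat p = inverse (norm p) *\<^sub>R p"
definition dist_quat :: "quat \<Rightarrow> quat \<Rightarrow> real" where
  "dist_quat p q = norm (p - q)"
definition uniformity_quat :: "(quat \<times> quat) filter" where
  "uniformity_quat = (INF e\<in>{0<..}. principal {(x, y). dist x y < e})"
definition open_quat :: "quat set \<Rightarrow> bool" where
  "open_quat U \<longleftrightarrow> (\<forall>x\<in>U. eventually (\<lambda>(x', y). x' = x \<longrightarrow> y \<in> U) uniformity)"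

instance
proof
  fix p q r :: quat and a :: real
  show "dist p q = norm (p - q)" by (fact dist_quat_def)
  show "sgn p = p /\<^sub>R norm p" by (fact sgn_quat_def)
  show "uniformity = (INF e\<in>{0<..}. principal {(x, y::quat). dist x y < e})"
    by (fact uniformity_quat_def)
  show "open U \<longleftrightarrow> (\<forall>x\<in>U. eventually (\<lambda>(x', y). x' = x \<longrightarrow> y \<in> U) uniformity)"
    for U :: "quat set"
    by (fact open_quat_def)
  show "inner p q = inner q p" "inner (p + q) r = inner p r + inner q r"
    "inner (a *\<^sub>R p) q = a * inner p q"
    by (simp_all add: inner_quat_def algebra_simps)
  show "inner p p \<ge> 0" by (simp add: inner_quat_def)
  have "w * w + x * x + y * y + z * z = 0 \<longleftrightarrow> w = 0 \<and> x = 0 \<and> y = 0 \<and> z = 0"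
    for w x y z :: real
    by (auto simp: add_nonneg_eq_0_iff)
  then show "inner p p = 0 \<longleftrightarrow> p = 0"
    by (simp add: inner_quat_def quat_eq_iff)
  show "norm p = sqrt (inner p p)"
    by (simp add: norm_quat_def inner_quat_def power2_eq_square)
qed

end

instantiation quat :: real_normed_div_algebra
begin

definition inverse_quat :: "quat \<Rightarrow> quat" where
  "inverse_quat p = inverse ((norm p)\<^sup>2) *\<^sub>R Quat (q0 p) (- q1 p) (- q2 p) (- q3 p)"
definition divide_quat :: "quat \<Rightarrow> quat \<Rightarrow> quat" where
  "divide_quat p q = p * inverse q"

instance
proof
  fix p q :: quat
  show "inverse p * p = 1" "p * inverse p = 1" if "p \<noteq> 0"
  proof -
    define N where "N = (norm p)\<^sup>2"
    have N: "N = q0 p * q0 p + q1 p * q1 p + q2 p * q2 p + q3 p * q3 p"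
      by (simp add: N_def norm_quat_def power2_eq_square)
    have "N \<noteq> 0" using that by (simp add: N_def)
    moreover have "Quat (q0 p) (- q1 p) (- q2 p) (- q3 p) * p = N *\<^sub>R 1"
      "p * Quat (q0 p) (- q1 p) (- q2 p) (- q3 p) = N *\<^sub>R 1"
      by (simp_all add: quat_eq_iff times_quat_def N)
    ultimately show "inverse p * p = 1" "p * inverse p = 1"
      by (simp_all add: inverse_quat_def N_def[symmetric])
  qed
  show "p div q = p * inverse q" by (fact divide_quat_def)
  show "inverse (0::quat) = 0"
    by (simp add: inverse_quat_def)
  have "inner (p * q) (p * q) = inner p p * inner q q"
    by (simp add: inner_quat_def times_quat_def algebra_simps)
  then show "norm (p * q) = norm p * norm q"
    by (simp add: norm_eq_sqrt_inner real_sqrt_mult)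
qed

end

instantiation quat :: euclidean_space
begin

definition Basis_quat :: "quat set" where
  "Basis_quat = {Quat 1 0 0 0, Quat 0 1 0 0, Quat 0 0 1 0, Quat 0 0 0 1}"

instance
proof
  fix p q :: quat
  show "p \<in> Basis \<Longrightarrow> q \<in> Basis \<Longrightarrow> inner p q = (if p = q then 1 else 0)"
    unfolding Basis_quat_def by (elim insertE emptyE) (simp_all add: inner_quat_def)
  show "(\<forall>u\<in>Basis. inner p u = 0) \<longleftrightarrow> p = 0"
    by (cases p) (simp add: Basis_quat_def inner_quat_def zero_quat_def)
qed (simp_all add: Basis_quat_def)

end

definition quat_cnj :: "quat \<Rightarrow> quat" where
  "quat_cnj q = Quat (q0 q) (- q1 q) (- q2 q) (- q3 q)"

definition quat_Im :: "quat \<Rightarrow> quat" where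
  "quat_Im q = Quat 0 (q1 q) (q2 q) (q3 q)"

definition imag_units :: "quat set" where
  "imag_units = {i. q0 i = 0 \<and> norm i = 1}"


section \<open>Slices\<close>

definition slice_point :: "quat \<Rightarrow> complex \<Rightarrow> quat" where
  "slice_point i z = of_real (Re z) + i * of_real (Im z)"

text \<open>Inverse of \<^term>\<open>slice_point i\<close> on the slice: if \<open>q = x + i y\<close> with \<open>i\<close> an imaginary unit,
  then \<open>i \<bullet> q = y\<close>.\<close>

definition slice_coord :: "quat \<Rightarrow> quat \<Rightarrow> complex" where
  "slice_coord i q = Complex (q0 q) (i \<bullet> q)"

definition slice_ball :: "quat \<Rightarrow> quat set" where
  "slice_ball i = ball 0 1 \<inter> range (slice_point i)"

lemma q_of_real [simp]:
  "q0 (of_real r) = r" "q1 (of_real r) = 0" "q2 (of_real r) = 0" "q3 (of_real r) = 0"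
  by (simp_all add: of_real_def)

lemma slice_point_eq:
  assumes "i \<in> imag_units"
  shows "slice_point i z = Quat (Re z) (q1 i * Im z) (q2 i * Im z) (q3 i * Im z)"
  using assms by (simp add: slice_point_def quat_eq_iff times_quat_def imag_units_def)

lemma imag_units_square_sum: "i \<in> imag_units \<Longrightarrow> (q1 i)\<^sup>2 + (q2 i)\<^sup>2 + (q3 i)\<^sup>2 = 1"
  by (auto simp add: imag_units_def norm_quat_def)

lemma norm_slice_point:
  assumes "i \<in> imag_units"
  shows "norm (slice_point i z) = cmod z"
proof -
  have "(Re z)\<^sup>2 + (q1 i * Im z)\<^sup>2 + (q2 i * Im z)\<^sup>2 + (q3 i * Im z)\<^sup>2
      = (Re z)\<^sup>2 + ((q1 i)\<^sup>2 + (q2 i)\<^sup>2 + (q3 i)\<^sup>2) * (Im z)\<^sup>2"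
    by (simp add: power_mult_distrib algebra_simps)
  then show ?thesis
    using assms by (simp add: norm_quat_def slice_point_eq imag_units_square_sum norm_complex_def)
qed

lemma slice_coord_slice_point:
  assumes "i \<in> imag_units"
  shows "slice_coord i (slice_point i z) = z"
proof -
  have "i \<bullet> slice_point i z = ((q1 i)\<^sup>2 + (q2 i)\<^sup>2 + (q3 i)\<^sup>2) * Im z"
    using assms
    by (simp add: inner_quat_def slice_point_eq imag_units_def power2_eq_square algebra_simps)
  then show ?thesis
    using assms by (simp add: slice_coord_def imag_units_square_sum) (simp add: slice_point_eq)
qed

lemma inj_slice_point: "i \<in> imag_units \<Longrightarrow> inj (slice_point i)"
  by (metis injI slice_coord_slice_point)

text \<open>Principal branch of \<open>q\<^sup>a\<close> inside the copy \<open>\<complex>(i)\<close> of the complex plane.\<close>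

definition slice_powr :: "quat \<Rightarrow> quat \<Rightarrow> real \<Rightarrow> quat" where
  "slice_powr i q a = slice_point i (slice_coord i q powr of_real a)"


section \<open>Slice regular functions\<close>

definition slice_regular :: "(quat \<Rightarrow> quat) set" where
  "slice_regular = {f. f differentiable_on ball 0 1 \<and>
     (\<forall>i\<in>imag_units. \<forall>x y. slice_point i (Complex x y) \<in> ball 0 1 \<longrightarrow>
        vector_derivative (\<lambda>t. f (slice_point i (Complex t y))) (at x)
        + i * vector_derivative (\<lambda>t. f (slice_point i (Complex x t))) (at y) = 0)}"

definition deriv_x0 :: "(quat \<Rightarrow> quat) \<Rightarrow> quat \<Rightarrow> quat" where
  "deriv_x0 f q = vector_derivative (\<lambda>t. f (q + of_real t)) (at 0)"

text \<open>Here \<open>q = x + I y\<close> with \<open>y = |Im q|\<close> and \<open>I = Im q / |Im q|\<close>; the pair \<open>(-I, -y)\<close> gives the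
  same value. For real \<open>q\<close> every \<open>I\<close> gives \<open>g q\<close>, and so does the value \<open>sgn 0 = 0\<close> used here.\<close>

definition slice_extension :: "quat \<Rightarrow> (quat \<Rightarrow> quat) \<Rightarrow> quat \<Rightarrow> quat" where
  "slice_extension i g q =
     (let x = q0 q; y = norm (quat_Im q); I = sgn (quat_Im q)
      in (1/2) *\<^sub>R ((1 + I * i) * g (slice_point i (Complex x (- y)))
                  + (1 - I * i) * g (slice_point i (Complex x y))))"


section \<open>Measures on a slice of the unit ball\<close>

text \<open>Planar Lebesgue measure \<open>dx dy\<close>, carried from the unit disc to \<open>B\<^sub>i\<close> by \<open>x + \<i> y \<mapsto> x + i y\<close>.\<close>

definition slice_lebesgue :: "quat \<Rightarrow> quat measure" where
  "slice_lebesgue i = embed_measure (lebesgue_on (ball 0 1)) (slice_point i)"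

lemma space_slice_lebesgue: "i \<in> imag_units \<Longrightarrow> space (slice_lebesgue i) = slice_ball i"
  by (auto simp: slice_lebesgue_def space_embed_measure space_restrict_space slice_ball_def
      norm_slice_point)

definition slice_area :: "quat \<Rightarrow> quat measure" where
  "slice_area i = density (slice_lebesgue i) (\<lambda>_. ennreal (1 / pi))"

definition weighted_slice_area :: "real \<Rightarrow> quat \<Rightarrow> quat measure" where
  "weighted_slice_area \<alpha> i =
     density (slice_area i) (\<lambda>z. ennreal ((\<alpha> + 1) * (1 - (norm z)\<^sup>2) powr \<alpha>))"

definition slice_invariant_measure :: "quat \<Rightarrow> quat measure" where
  "slice_invariant_measure i = density (slice_area i) (\<lambda>z. ennreal (1 / (1 - (norm z)\<^sup>2)\<^sup>2))"

definition slice_Lp :: "real \<Rightarrow> quat \<Rightarrow> (quat \<Rightarrow> quat) set" where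
  "slice_Lp p i = {h \<in> borel_measurable (slice_invariant_measure i).
     (\<integral>\<^sup>+ z. ennreal (norm (h z) powr p) \<partial>slice_invariant_measure i) < \<infinity>}"


section \<open>Besov spaces and Bergman type projections\<close>

text \<open>The parameter \<open>n\<close> is any order with \<open>p n > 1\<close>; the space does not depend on that choice.\<close>

definition slice_Besov :: "real \<Rightarrow> nat \<Rightarrow> (quat \<Rightarrow> quat) set" where
  "slice_Besov p n = {f \<in> slice_regular.
     (SUP i\<in>imag_units. \<integral>\<^sup>+ z. ennreal
        (norm ((1 - (norm z)\<^sup>2) ^ n *\<^sub>R (deriv_x0 ^^ n) f z) powr p)
        \<partial>slice_invariant_measure i) < \<infinity>}"

definition slice_Bergman_kernel :: "real \<Rightarrow> quat \<Rightarrow> quat \<Rightarrow> quat \<Rightarrow> quat" where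
  "slice_Bergman_kernel \<alpha> i q w =
     slice_extension i (\<lambda>z. 1 / slice_powr i (1 - z * quat_cnj w) (2 + \<alpha>)) q"

definition Bergman_projection :: "real \<Rightarrow> quat \<Rightarrow> (quat \<Rightarrow> quat) \<Rightarrow> quat \<Rightarrow> quat" where
  "Bergman_projection \<alpha> i h q =
     (\<integral>w. slice_Bergman_kernel \<alpha> i q w * h w \<partial>weighted_slice_area \<alpha> i)"

end

theory Submission
  imports Defs "HOL-Complex_Analysis.Complex_Analysis"
begin

text \<open>A slice regular function is determined by its restriction to one slice, which splits into two
  holomorphic functions \<open>F\<close>, \<open>G\<close> on the disc as \<open>f = F + G j\<close> with \<open>j \<bottom> i\<close>; the representation formula
  bounds \<open>\<partial>\<^sup>n f\<close> on every slice by its values on the slice of \<open>i\<close>. So everything reduces to the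
  complex disc. There, if \<open>F\<close> is the Bergman integral of \<open>h\<close>, then \<open>F\<^sup>(\<^sup>n\<^sup>)\<close> is an integral of \<open>h\<close>
  against \<open>(1 - z w\<^sup>*)\<^sup>-\<^sup>(\<^sup>2\<^sup>+\<^sup>\<alpha>\<^sup>+\<^sup>n\<^sup>)\<close>, and a Schur test with weights \<open>(1 - |w|\<^sup>2)\<^sup>\<epsilon>\<close> based on the
  Forelli-Rudin estimates gives the Besov bound. Conversely, \<open>F\<close> is recovered from
  \<open>(1 - |w|\<^sup>2)\<^sup>n F\<^sup>(\<^sup>n\<^sup>)(w) / w\<^sup>*\<^sup>n\<close>, corrected near the origin by Taylor polynomials, by comparing
  Taylor coefficients; these are computed from the orthogonality of the monomials \<open>w\<^sup>k\<close> for radial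
  weights and the Beta integral.\<close>

section \<open>Planar Lebesgue measure on the disc\<close>

text \<open>A kernel integral enters only through the moments of its density against
  \<open>cnj w ^ k\<close>: they fix its Taylor coefficients, so no reproducing formula and no
  integration by parts is involved. Dividing by \<open>cnj w ^ n\<close> is what makes the converse
  work: it shifts the index of the moments by \<open>n\<close>, just as the derivative of order
  \<open>n\<close> shifts the Taylor coefficients. Two things break at low order: the quotient is
  singular at 0, and the derivative does not see the first \<open>n\<close> coefficients. Both
  concern finitely many coefficients, hence the polynomial repair.

  In the Schur test the tangent-line form of Jensen's inequality replaces Hoelder's, so
  \<open>p = 1\<close> is no separate case. The condition \<open>p * real n > 1\<close> enters
  twice: it puts \<open>defect w ^ n\<close> into the L^p space of the invariant measure, and for
  \<open>n = 1\<close> it forces \<open>p > 1\<close>, which keeps a Forelli-Rudin exponent above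
  -1.

  Noncommutativity is harmless because the kernel stands to the left of the density and
  \<open>j\<close> to the right of the components: on a slice the kernel acts on both components by
  complex multiplication.\<close>

lemma lborel_complex_eq_distr:
  "lborel = distr (lborel :: (real \<times> real) measure) borel (\<lambda>(x, y). Complex x y)"
proof (rule lborel_eqI)
  have "continuous_on UNIV (\<lambda>q. Complex (fst q) (snd q))"
    unfolding Complex_eq by (intro continuous_intros)
  then have meas: "(\<lambda>(x, y). Complex x y) \<in> borel_measurable (lborel :: (real \<times> real) measure)"
    unfolding split_beta' by (simp add: borel_measurable_continuous_onI)
  fix l u :: complex assume lu: "\<And>b. b \<in> Basis \<Longrightarrow> l \<bullet> b \<le> u \<bullet> b"
  have vim: "(\<lambda>(x, y). Complex x y) -` box l u = box (Re l, Im l) (Re u, Im u)"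
    by (auto simp: box_def Basis_complex_def Basis_prod_def)
  have "emeasure (distr lborel borel (\<lambda>(x, y). Complex x y)) (box l u)
      = emeasure lborel (box (Re l, Im l) (Re u, Im u))"
    using meas by (subst emeasure_distr) (simp_all add: vim)
  also have "\<dots> = ennreal (\<Prod>b\<in>Basis. ((Re u, Im u) - (Re l, Im l)) \<bullet> b)"
    using lu[of 1] lu[of \<i>]
    by (intro emeasure_lborel_box) (auto simp: Basis_complex_def Basis_prod_def)
  also have "(\<Prod>b\<in>Basis. ((Re u, Im u) - (Re l, Im l)) \<bullet> b) = (\<Prod>b\<in>Basis. (u - l) \<bullet> b)"
    by (simp add: Basis_prod_def Basis_complex_def prod.union_disjoint complex_eq_iff)
  finally show "emeasure (distr lborel borel (\<lambda>(x, y). Complex x y)) (box l u)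
      = (\<Prod>b\<in>Basis. (u - l) \<bullet> b)" .
qed simp

text \<open>Tonelli in both orders: a horizontal shear translates the inner variable only when
  \<open>x\<close> is integrated first, a vertical one only when \<open>y\<close> is.\<close>

lemma nn_integral_lborel_complex:
  assumes [measurable]: "f \<in> borel_measurable borel"
  shows "(\<integral>\<^sup>+z. f z \<partial>lborel) = (\<integral>\<^sup>+x. \<integral>\<^sup>+y. f (Complex x y) \<partial>lborel \<partial>lborel)"
    and "(\<integral>\<^sup>+z. f z \<partial>lborel) = (\<integral>\<^sup>+y. \<integral>\<^sup>+x. f (Complex x y) \<partial>lborel \<partial>lborel)"
proof -
  have [measurable]: "(\<lambda>(x, y). Complex x y) \<in> borel_measurable (lborel \<Otimes>\<^sub>M lborel)"
    unfolding split_beta' Complex_eq by measurable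
  have "(\<integral>\<^sup>+z. f z \<partial>lborel) = (\<integral>\<^sup>+q. f (case q of (x, y) \<Rightarrow> Complex x y) \<partial>(lborel \<Otimes>\<^sub>M lborel))"
    by (subst lborel_complex_eq_distr, subst nn_integral_distr)
      (auto simp: lborel_prod[symmetric])
  also have "\<dots> = (\<integral>\<^sup>+q. (case q of (x, y) \<Rightarrow> f (Complex x y)) \<partial>(lborel \<Otimes>\<^sub>M lborel))"
    by (simp add: split_beta')
  finally have *: "(\<integral>\<^sup>+z. f z \<partial>lborel)
      = (\<integral>\<^sup>+q. (case q of (x, y) \<Rightarrow> f (Complex x y)) \<partial>(lborel \<Otimes>\<^sub>M lborel))" .
  have [measurable]: "(\<lambda>(x, y). f (Complex x y)) \<in> borel_measurable (lborel \<Otimes>\<^sub>M lborel)"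
    unfolding split_beta' Complex_eq by measurable
  show "(\<integral>\<^sup>+z. f z \<partial>lborel) = (\<integral>\<^sup>+x. \<integral>\<^sup>+y. f (Complex x y) \<partial>lborel \<partial>lborel)"
    unfolding * by (subst lborel.nn_integral_fst[symmetric]) auto
  show "(\<integral>\<^sup>+z. f z \<partial>lborel) = (\<integral>\<^sup>+y. \<integral>\<^sup>+x. f (Complex x y) \<partial>lborel \<partial>lborel)"
    unfolding * by (subst lborel_pair.nn_integral_snd[symmetric]) auto
qed

lemma nn_integral_lborel_shift:
  fixes f :: "real \<Rightarrow> ennreal"
  assumes "f \<in> borel_measurable borel"
  shows "(\<integral>\<^sup>+x. f (x + c) \<partial>lborel) = (\<integral>\<^sup>+x. f x \<partial>lborel)"
  using assms by (subst lborel_distr_plus[of c, symmetric], subst nn_integral_distr) (auto simp: add.commute)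

lemma nn_integral_lborel_minus:
  fixes f :: "real \<Rightarrow> ennreal"
  assumes "f \<in> borel_measurable borel"
  shows "(\<integral>\<^sup>+x. f (- x) \<partial>lborel) = (\<integral>\<^sup>+x. f x \<partial>lborel)"
  using assms by (subst lborel_distr_uminus[symmetric], subst nn_integral_distr) auto

lemma distr_lborel_eqI:
  fixes T :: "complex \<Rightarrow> complex"
  assumes [measurable]: "T \<in> borel_measurable borel"
    and "\<And>f. f \<in> borel_measurable borel \<Longrightarrow> (\<integral>\<^sup>+z. f (T z) \<partial>lborel) = (\<integral>\<^sup>+z. f z \<partial>lborel)"
  shows "distr lborel borel T = lborel"
proof (rule measure_eqI)
  fix A assume "A \<in> sets (distr lborel borel T)"
  then have A[measurable]: "A \<in> sets borel" by simp
  have "emeasure (distr lborel borel T) A = (\<integral>\<^sup>+z. indicator A z \<partial>distr lborel borel T)"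
    by simp
  also have "\<dots> = (\<integral>\<^sup>+z. indicator A (T z) \<partial>lborel)"
    by (subst nn_integral_distr) auto
  also have "\<dots> = emeasure lborel A" by (subst assms(2)) auto
  finally show "emeasure (distr lborel borel T) A = emeasure lborel A" .
qed simp

text \<open>Along each horizontal line the map is a translation, by the constant
  \<open>a * Im z\<close>.\<close>

lemma nn_integral_shear_Re:
  assumes [measurable]: "f \<in> borel_measurable borel"
  shows "(\<integral>\<^sup>+z. f (Complex (Re z + a * Im z) (Im z)) \<partial>lborel) = (\<integral>\<^sup>+z. f z \<partial>lborel)"
proof -
  have "continuous_on UNIV (\<lambda>z. Complex (Re z + a * Im z) (Im z))"
    unfolding Complex_eq by (intro continuous_intros)
  then have [measurable]: "(\<lambda>z. Complex (Re z + a * Im z) (Im z)) \<in> borel_measurable borel"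
    by (rule borel_measurable_continuous_onI)
  have [measurable]: "(\<lambda>x. f (Complex x y)) \<in> borel_measurable borel" for y
    unfolding Complex_eq by measurable
  show ?thesis
    by (simp add: nn_integral_lborel_complex(2) nn_integral_lborel_shift[of "\<lambda>x. f (Complex x y)" for y])
qed

lemma nn_integral_shear_Im:
  assumes [measurable]: "f \<in> borel_measurable borel"
  shows "(\<integral>\<^sup>+z. f (Complex (Re z) (Im z + a * Re z)) \<partial>lborel) = (\<integral>\<^sup>+z. f z \<partial>lborel)"
proof -
  have "continuous_on UNIV (\<lambda>z. Complex (Re z) (Im z + a * Re z))"
    unfolding Complex_eq by (intro continuous_intros)
  then have [measurable]: "(\<lambda>z. Complex (Re z) (Im z + a * Re z)) \<in> borel_measurable borel"
    by (rule borel_measurable_continuous_onI)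
  have [measurable]: "(\<lambda>y. f (Complex x y)) \<in> borel_measurable borel" for x
    unfolding Complex_eq by measurable
  show ?thesis
    by (simp add: nn_integral_lborel_complex(1) nn_integral_lborel_shift[of "\<lambda>y. f (Complex x y)" for x])
qed

lemma distr_lborel_cnj: "distr lborel borel cnj = lborel"
proof (rule distr_lborel_eqI)
  fix f :: "complex \<Rightarrow> ennreal" assume f[measurable]: "f \<in> borel_measurable borel"
  have [measurable]: "cnj \<in> borel_measurable borel"
    by (intro borel_measurable_continuous_onI continuous_intros)
  have [measurable]: "(\<lambda>y. f (Complex x y)) \<in> borel_measurable borel" for x
    unfolding Complex_eq by measurable
  have eq: "cnj (Complex x y) = Complex x (- y)" for x y by (simp add: complex_eq_iff)
  show "(\<integral>\<^sup>+z. f (cnj z) \<partial>lborel) = (\<integral>\<^sup>+z. f z \<partial>lborel)"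
    apply (subst nn_integral_lborel_complex(1))
     apply measurable
    apply (subst nn_integral_lborel_complex(1))
     apply measurable
    apply (simp add: eq)
    apply (subst nn_integral_lborel_minus[of "\<lambda>y. f (Complex x y)" for x])
     apply auto
    done
qed (intro borel_measurable_continuous_onI continuous_intros)

text \<open>A rotation is a product of three shears.\<close>

lemma distr_lborel_cis:
  assumes "cos t \<noteq> -1"
  shows "distr lborel borel (\<lambda>z. cis t * z) = lborel"
proof (rule distr_lborel_eqI)
  fix f :: "complex \<Rightarrow> ennreal" assume [measurable]: "f \<in> borel_measurable borel"
  \<comment> \<open>\<open>a\<close> is - tan (t / 2), the factor of the two horizontal shears; the
    denominator is the reason for excluding \<open>cos t = -1\<close>.\<close>
  define c s a where "c = cos t" and "s = sin t" and "a = - s / (1 + c)"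
  have c: "1 + c \<noteq> 0" using assms by (simp add: c_def)
  have cs: "s * s = (1 - c) * (1 + c)"
    using sin_cos_squared_add[of t] by (simp add: c_def s_def power2_eq_square algebra_simps)
  have as: "a * s = c - 1" using c cs by (simp add: a_def field_simps)
  have ac: "a * (1 + c) = - s" using c by (simp add: a_def)
  define S1 where "S1 z = Complex (Re z + a * Im z) (Im z)" for z
  define S2 where "S2 z = Complex (Re z) (Im z + s * Re z)" for z
  have [measurable]: "S1 \<in> borel_measurable borel" "S2 \<in> borel_measurable borel"
    unfolding S1_def[abs_def] S2_def[abs_def] Complex_eq by measurable
  have rot: "cis t * z = S1 (S2 (S1 z))" for z
  proof (rule complex_eqI)
    have "Re (S1 (S2 (S1 z))) = Re z * (1 + a * s) + Im z * (a * (2 + a * s))"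
      by (simp add: S1_def S2_def algebra_simps)
    also have "\<dots> = Re z * c + Im z * (a * (1 + c))" by (simp add: as algebra_simps)
    finally show "Re (cis t * z) = Re (S1 (S2 (S1 z)))"
      unfolding ac by (simp add: c_def s_def)
    have "Im (S1 (S2 (S1 z))) = Im z * (1 + a * s) + s * Re z"
      by (simp add: S1_def S2_def algebra_simps)
    then show "Im (cis t * z) = Im (S1 (S2 (S1 z)))"
      unfolding as by (simp add: c_def s_def)
  qed
  have "(\<integral>\<^sup>+z. f (S1 (S2 (S1 z))) \<partial>lborel) = (\<integral>\<^sup>+z. f (S1 (S2 z)) \<partial>lborel)"
    using nn_integral_shear_Re[of "\<lambda>z. f (S1 (S2 z))" a] by (simp add: S1_def[symmetric])
  also have "\<dots> = (\<integral>\<^sup>+z. f (S1 z) \<partial>lborel)"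
    using nn_integral_shear_Im[of "\<lambda>z. f (S1 z)" s] by (simp add: S2_def[symmetric])
  also have "\<dots> = (\<integral>\<^sup>+z. f z \<partial>lborel)"
    using nn_integral_shear_Re[of f a] by (simp add: S1_def[symmetric])
  finally show "(\<integral>\<^sup>+z. f (cis t * z) \<partial>lborel) = (\<integral>\<^sup>+z. f z \<partial>lborel)"
    by (simp add: rot)
qed (intro borel_measurable_continuous_onI continuous_intros)

text \<open>A disc of radius sqrt t has area pi * t, so the image of the area under the squared
  modulus is pi times Lebesgue measure on [0, 1). This replaces polar coordinates.\<close>

lemma nn_integral_radial:
  fixes \<phi> :: "real \<Rightarrow> ennreal"
  assumes [measurable]: "\<phi> \<in> borel_measurable borel"
  shows "(\<integral>\<^sup>+w. \<phi> ((cmod w)\<^sup>2) \<partial>lebesgue_on (ball 0 1))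
    = ennreal pi * (\<integral>\<^sup>+t. \<phi> t * indicator {0..<1} t \<partial>lborel)"
proof -
  let ?M = "lebesgue_on (ball (0::complex) 1)"
  have [measurable]: "(\<lambda>w. (cmod w)\<^sup>2) \<in> borel_measurable ?M"
    by (intro measurable_restrict_space1) (simp add: measurable_completion)
  have "distr ?M borel (\<lambda>w. (cmod w)\<^sup>2) = density lborel (\<lambda>t. ennreal pi * indicator {0..<1} t)"
  \<comment> \<open>It suffices to compare the two measures on the half-lines \<open>{x<..}\<close>,
    which pull back to the whole disc, an annulus or the empty set.\<close>
  proof (rule measure_eqI_lessThan)
    fix x :: real
    have R: "emeasure (density lborel (\<lambda>t. ennreal pi * indicator {0..<1} t)) {x<..}
        = ennreal pi * emeasure lborel ({0..<1} \<inter> {x<..})"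
      by (simp add: emeasure_density mult.assoc nn_integral_cmult flip: indicator_inter_arith)
    have L: "emeasure (distr ?M borel (\<lambda>w. (cmod w)\<^sup>2)) {x<..}
        = emeasure lborel ({w. x < (cmod w)\<^sup>2} \<inter> ball (0::complex) 1)"
      by (subst emeasure_distr)
        (auto simp: emeasure_restrict_space space_restrict_space vimage_def
          intro!: arg_cong[where f="emeasure lebesgue"])
    have "emeasure lborel ({w. x < (cmod w)\<^sup>2} \<inter> ball (0::complex) 1)
      = ennreal pi * emeasure lborel ({0..<1} \<inter> {x<..})"
    proof -
      consider "x < 0" | "0 \<le> x" "x < 1" | "1 \<le> x" by linarith
      then show ?thesis
      proof cases
        case 1
        then have "{w. x < (cmod w)\<^sup>2} \<inter> ball (0::complex) 1 = ball 0 1" "{0..<1} \<inter> {x<..} = {0..<1}"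
          by (auto intro: less_le_trans)
        then show ?thesis by (simp add: emeasure_ball unit_ball_vol_2)
      next
        case 2
        have "x < (cmod w)\<^sup>2 \<longleftrightarrow> sqrt x < cmod w" for w
          using real_sqrt_less_iff[of x "(cmod w)\<^sup>2"] by simp
        then have "w \<in> {w. x < (cmod w)\<^sup>2} \<inter> ball 0 1 \<longleftrightarrow> w \<in> ball 0 1 - cball 0 (sqrt x)" for w :: complex
          by (simp add: not_le conj_commute)
        then have e1: "{w. x < (cmod w)\<^sup>2} \<inter> ball (0::complex) 1 = ball 0 1 - cball 0 (sqrt x)"
          by (rule set_eqI)
        have e2: "{0..<1} \<inter> {x<..} = {x<..<1}" using 2 by auto
        have "sqrt x < 1" using 2 by simp
        then have "cball 0 (sqrt x) \<subseteq> ball (0::complex) 1"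
          by (meson cball_subset_ball_iff disjI1 le_less_trans norm_ge_zero subsetI mem_ball_0 mem_cball_0)
        then have "emeasure lborel (ball (0::complex) 1 - cball 0 (sqrt x)) = pi - pi * x"
          using 2 by (subst emeasure_Diff)
            (simp_all add: emeasure_ball emeasure_cball unit_ball_vol_2 ennreal_minus)
        then show ?thesis using 2 by (simp add: e1 e2 right_diff_distrib flip: ennreal_mult')
      next
        case 3
        have "\<not> x < (cmod w)\<^sup>2" if "cmod w < 1" for w
          using that 3 abs_square_less_1[of "cmod w"] by simp
        then have e1: "{w. x < (cmod w)\<^sup>2} \<inter> ball (0::complex) 1 = {}"
          by auto
        have e2: "{0..<1} \<inter> {x<..} = {}" using 3 by auto
        show ?thesis by (simp only: e1 e2) simp
      qed
    qed
    with L R show "emeasure (distr ?M borel (\<lambda>w. (cmod w)\<^sup>2)) {x<..}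
      = emeasure (density lborel (\<lambda>t. ennreal pi * indicator {0..<1} t)) {x<..}" by simp
    have "emeasure lborel ({w. x < (cmod w)\<^sup>2} \<inter> ball (0::complex) 1) \<le> emeasure lborel (ball (0::complex) 1)"
      by (intro emeasure_mono) auto
    also have "\<dots> < \<infinity>" by (simp add: emeasure_ball)
    finally show "emeasure (distr ?M borel (\<lambda>w. (cmod w)\<^sup>2)) {x<..} < \<infinity>" using L by simp
  qed simp_all
  then have "(\<integral>\<^sup>+t. \<phi> t \<partial>distr ?M borel (\<lambda>w. (cmod w)\<^sup>2))
      = (\<integral>\<^sup>+t. ennreal pi * (\<phi> t * indicator {0..<1} t) \<partial>lborel)"
    by (simp add: nn_integral_density mult_ac)
  then show ?thesis
    by (simp add: nn_integral_distr nn_integral_cmult)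
qed

section \<open>Moments of the radial weights\<close>

abbreviation disc :: "complex measure" where
  "disc \<equiv> lebesgue_on (ball 0 1)"

text \<open>Negative outside the closed disc; hence the absolute values in later integrands that
  must be nonnegative on the whole plane.\<close>

definition defect :: "complex \<Rightarrow> real" where
  "defect w = 1 - (cmod w)\<^sup>2"

lemma defect_measurable [measurable (raw)]:
  "f \<in> borel_measurable M \<Longrightarrow> (\<lambda>x. defect (f x)) \<in> borel_measurable M"
  unfolding defect_def by measurable

lemma cnj_measurable [measurable (raw)]:
  "f \<in> borel_measurable M \<Longrightarrow> (\<lambda>x. cnj (f x)) \<in> borel_measurable M"
  by (erule measurable_compose)
    (intro borel_measurable_continuous_onI continuous_intros)

lemma borel_measurable_disc: "f \<in> borel_measurable borel \<Longrightarrow> f \<in> borel_measurable disc"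
  by (intro measurable_restrict_space1 measurable_completion) simp

lemma defect_pos: "cmod w < 1 \<Longrightarrow> 0 < defect w"
  by (simp add: defect_def power_less_one_iff abs_square_less_1)

lemma defect_le_1: "defect w \<le> 1"
  by (simp add: defect_def)

text \<open>The substitution t = |w|^2 turns the moment into Euler's Beta integral.\<close>

lemma nn_integral_moment:
  assumes "\<beta> > -1"
  shows "(\<integral>\<^sup>+w. ennreal (cmod w ^ (2 * k) * defect w powr \<beta>) \<partial>disc)
    = ennreal (pi * Beta (real k + 1) (\<beta> + 1))"
proof -
  let ?g = "\<lambda>t. t powr real k * (1 - t) powr \<beta>"
  have "(\<integral>\<^sup>+w. ennreal (cmod w ^ (2 * k) * defect w powr \<beta>) \<partial>disc)
      = (\<integral>\<^sup>+w. ennreal (((cmod w)\<^sup>2) ^ k * (1 - (cmod w)\<^sup>2) powr \<beta>) \<partial>disc)"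
    by (simp add: defect_def power_mult)
  also have "\<dots> = ennreal pi * (\<integral>\<^sup>+t. ennreal (t ^ k * (1 - t) powr \<beta>) * indicator {0..<1} t \<partial>lborel)"
    by (rule nn_integral_radial) measurable
  also have "(\<integral>\<^sup>+t. ennreal (t ^ k * (1 - t) powr \<beta>) * indicator {0..<1} t \<partial>lborel)
      = (\<integral>\<^sup>+t. ennreal (indicator {0..1} t * ?g t) \<partial>lborel)"
  proof (rule nn_integral_cong_AE)
    \<comment> \<open>At \<open>t = 0\<close> with \<open>k = 0\<close> the integrands differ, since
      \<open>0 ^ 0 = 1\<close> but \<open>0 powr 0 = 0\<close>; the endpoints form a null
      set.\<close>
    have "AE t in lborel. t \<noteq> (0::real)" "AE t in lborel. t \<noteq> (1::real)"
      by (rule AE_lborel_singleton)+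
    then show "AE t in lborel. ennreal (t ^ k * (1 - t) powr \<beta>) * indicator {0..<1} t
        = ennreal (indicator {0..1} t * ?g t)"
      by eventually_elim (auto simp: indicator_def powr_realpow)
  qed
  also have "\<dots> = ennreal (Beta (real k + 1) (\<beta> + 1))"
  proof (rule nn_integral_has_integral_lborel)
    have "(?g has_integral Beta (real k + 1) (\<beta> + 1)) {0..1}"
      using has_integral_Beta_real[of "real k + 1" "\<beta> + 1"] assms by simp
    moreover have "(\<lambda>t. indicator {0..1} t * ?g t) = (\<lambda>t. if t \<in> {0..1} then ?g t else 0)"
      by (auto simp: indicator_def)
    ultimately show "((\<lambda>t. indicator {0..1} t * ?g t) has_integral Beta (real k + 1) (\<beta> + 1)) UNIV"
      by (simp only: has_integral_restrict_UNIV)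
  qed (auto simp: indicator_def)
  finally show ?thesis by (simp add: ennreal_mult')
qed

lemma Beta_pos: "0 < x \<Longrightarrow> 0 < y \<Longrightarrow> 0 < Beta x (y :: real)"
  by (simp add: Beta_def Gamma_real_pos)

lemma
  assumes "\<beta> > -1"
  shows integrable_moment: "integrable disc (\<lambda>w. cmod w ^ (2 * k) * defect w powr \<beta>)"
    and integral_moment: "(\<integral>w. cmod w ^ (2 * k) * defect w powr \<beta> \<partial>disc)
      = pi * Beta (real k + 1) (\<beta> + 1)"
proof -
  have "0 < Beta (real k + 1) (\<beta> + 1)" using assms by (intro Beta_pos) auto
  then have "integrable disc (\<lambda>w. cmod w ^ (2 * k) * defect w powr \<beta>) \<and>
      (\<integral>w. cmod w ^ (2 * k) * defect w powr \<beta> \<partial>disc) = pi * Beta (real k + 1) (\<beta> + 1)"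
    using nn_integral_moment[OF assms, of k] by (subst (asm) nn_integral_eq_integrable) (auto intro: borel_measurable_disc)
  then show "integrable disc (\<lambda>w. cmod w ^ (2 * k) * defect w powr \<beta>)"
    "(\<integral>w. cmod w ^ (2 * k) * defect w powr \<beta> \<partial>disc) = pi * Beta (real k + 1) (\<beta> + 1)"
    by auto
qed

lemma integrable_defect_powr: "\<beta> > -1 \<Longrightarrow> integrable disc (\<lambda>w. defect w powr \<beta>)"
  using integrable_moment[of \<beta> 0] by simp

text \<open>\<open>disc\<close> carries the completed measure, whereas the rotation invariance was
  shown for \<open>lborel\<close>; a Borel integrand allows passing between them.\<close>

lemma integral_disc_borel:
  fixes f :: "complex \<Rightarrow> complex"
  assumes "f \<in> borel_measurable borel"
  shows "(\<integral>w. f w \<partial>disc) = (\<integral>w. indicator (ball 0 1) w *\<^sub>R f w \<partial>lborel)"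
proof -
  have "(\<lambda>w. indicator (ball 0 1) w *\<^sub>R f w) \<in> borel_measurable borel"
    by (intro borel_measurable_scaleR borel_measurable_indicator borel_open open_ball assms)
  then show ?thesis
    by (subst integral_restrict_space, simp, subst integral_completion) auto
qed

lemma integral_disc_cis:
  fixes f :: "complex \<Rightarrow> complex"
  assumes f: "f \<in> borel_measurable borel" and t: "cos t \<noteq> -1"
  shows "(\<integral>w. f (cis t * w) \<partial>disc) = (\<integral>w. f w \<partial>disc)"
proof -
  have m: "(\<lambda>w. cis t * w) \<in> borel_measurable borel" by measurable
  have "(\<lambda>w. indicator (ball 0 1) w *\<^sub>R f w) \<in> borel_measurable borel"
    by (intro borel_measurable_scaleR borel_measurable_indicator borel_open open_ball f)
  then have "(\<integral>w. indicator (ball 0 1) w *\<^sub>R f w \<partial>distr lborel borel (\<lambda>w. cis t * w))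
      = (\<integral>w. indicator (ball 0 1) (cis t * w) *\<^sub>R f (cis t * w) \<partial>lborel)"
    using m by (subst integral_distr) auto
  moreover have "indicat_real (ball 0 1) (cis t * w) = indicator (ball 0 1) w" for w
    by (simp add: indicator_def norm_mult)
  ultimately show ?thesis
    by (simp only: integral_disc_borel[OF f] integral_disc_borel[OF measurable_compose[OF m f]]
        distr_lborel_cis[OF t])
qed

text \<open>One rotation is enough: it is chosen to multiply the integrand by \<i>, so the integral
  equals \<i> times itself.\<close>

lemma monomial_orthogonal:
  fixes g :: "real \<Rightarrow> real"
  assumes [measurable]: "g \<in> borel_measurable borel" and "j \<noteq> k"
  shows "(\<integral>w. w ^ j * cnj w ^ k * of_real (g (cmod w)) \<partial>disc) = 0"
proof -
  \<comment> \<open>Makes \<open>t * (real j - real k)\<close> equal to pi / 2. As the exponents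
    differ by at least 1, \<open>t\<close> has modulus at most pi / 2, so \<open>cos t\<close> is
    nonnegative and the rotation lemma applies.\<close>
  define t where "t = pi / (2 * (real j - real k))"
  have jk: "real j - real k \<noteq> 0" using assms by simp
  have "\<bar>real j - real k\<bar> \<ge> 1" using assms by linarith
  then have "\<bar>t\<bar> \<le> pi / 2" by (simp add: t_def abs_mult field_simps)
  then have "cos t \<ge> 0" by (intro cos_ge_zero) linarith+
  then have ct: "cos t \<noteq> -1" by linarith
  have "cis t ^ j * cnj (cis t) ^ k = cis (t * (real j - real k))"
    by (simp add: Complex.DeMoivre cis_cnj cis_mult algebra_simps)
  also have "t * (real j - real k) = pi / 2" using jk unfolding t_def by (simp only: divide_divide_eq_left[symmetric] times_divide_eq_left mult.commute[of 2]) simp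
  finally have u: "cis t ^ j * cnj (cis t) ^ k = \<i>" by simp
  let ?f = "\<lambda>w. w ^ j * cnj w ^ k * of_real (g (cmod w))"
  have "?f (cis t * w) = (cis t ^ j * cnj (cis t) ^ k) * ?f w" for w
    by (simp add: power_mult_distrib norm_mult mult_ac del: cis_cnj)
  then have "?f (cis t * w) = \<i> * ?f w" for w unfolding u .
  then have "(\<integral>w. ?f w \<partial>disc) = \<i> * (\<integral>w. ?f w \<partial>disc)"
    using integral_disc_cis[of ?f t] ct by (simp only: Bochner_Integration.integral_mult_right_zero) measurable
  then have "(1 - \<i>) * (\<integral>w. ?f w \<partial>disc) = 0" by (simp add: algebra_simps)
  moreover have "1 - \<i> \<noteq> 0" by (simp add: complex_eq_iff)
  ultimately show ?thesis by (simp only: mult_eq_0_iff simp_thms)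
qed

text \<open>Orthogonality leaves only the term of order \<open>k\<close> of the series. Termwise
  integration is justified on |w| < R, where the series is dominated geometrically; then R tends to
  1, dominated by the integrable function itself.\<close>

lemma integral_disc_cnj_power:
  fixes a :: "nat \<Rightarrow> complex"
  assumes \<beta>: "\<beta> > -1"
    and H: "\<And>w. cmod w < 1 \<Longrightarrow> (\<lambda>k. a k * w ^ k) sums H w"
    and int: "integrable disc (\<lambda>w. H w * of_real (defect w powr \<beta>))"
  shows "(\<integral>w. cnj w ^ k * H w * of_real (defect w powr \<beta>) \<partial>disc)
    = a k * of_real (pi * Beta (real k + 1) (\<beta> + 1))"
proof -
  define G where "G w = cnj w ^ k * H w * complex_of_real (defect w powr \<beta>)" for w
  \<comment> \<open>The cut-off is radial, so \<open>monomial_orthogonal\<close> applies to the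
    truncated weight too.\<close>
  define ind where "ind R w = (if cmod w < R then 1 else 0 :: real)" for R w
  have ind0: "ind R \<in> borel_measurable borel" for R
    unfolding ind_def[abs_def] by measurable
  have [measurable]: "ind R \<in> borel_measurable disc" for R
    by (rule borel_measurable_disc[OF ind0])
  have Gm[measurable]: "G \<in> borel_measurable disc"
    unfolding G_def[abs_def] mult.assoc
    by (intro borel_measurable_times[OF _ borel_measurable_integrable[OF int]] borel_measurable_disc) measurable
  have G_le: "cmod (G w) \<le> cmod (H w * complex_of_real (defect w powr \<beta>))" if "cmod w < 1" for w
    using that by (simp add: G_def norm_mult norm_power mult.assoc mult_left_le_one_le power_le_one)
  have wsp: "cmod w < 1" if "w \<in> space disc" for w using that by (simp add: space_restrict_space)
  define B where "B w = complex_of_real (cmod w ^ (2 * k) * defect w powr \<beta>)" for w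
  have Bint: "integrable disc B"
    unfolding B_def[abs_def] by (intro integrable_of_real integrable_moment \<beta>)
  have R: "(\<integral>w. ind R w *\<^sub>R G w \<partial>disc) = a k * (\<integral>w. ind R w *\<^sub>R B w \<partial>disc)" if "0 < R" "R < 1" for R
  proof -
    define f where "f j w = ind R w *\<^sub>R (a j * w ^ j * cnj w ^ k * complex_of_real (defect w powr \<beta>))" for j w
    have f_le: "cmod (f j w) \<le> cmod (a j) * R ^ j * defect w powr \<beta>" if "cmod w < 1" for j w
    proof (cases "cmod w < R")
      case True
      have "cmod w ^ j * cmod w ^ k \<le> R ^ j * 1"
        using True that \<open>0 < R\<close> by (intro mult_mono power_mono power_le_one) auto
      then have "cmod (a j) * (cmod w ^ j * cmod w ^ k) * defect w powr \<beta> \<le> cmod (a j) * (R ^ j * 1) * defect w powr \<beta>"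
        by (intro mult_right_mono mult_left_mono) auto
      with True show ?thesis by (simp add: f_def ind_def norm_mult norm_power mult_ac)
    qed (use \<open>0 < R\<close> in \<open>simp add: f_def ind_def\<close>)
    have sR: "summable (\<lambda>j. cmod (a j) * R ^ j)"
    proof -
      \<comment> \<open>Absolute convergence at \<open>R\<close> follows from convergence at a
        larger radius still below 1.\<close>
      obtain r where r: "R < r" "r < 1" using \<open>R < 1\<close> dense by blast
      have "summable (\<lambda>j. a j * complex_of_real r ^ j)"
        using H[of "of_real r"] r \<open>0 < R\<close> by (intro sums_summable) auto
      from powser_insidea[OF this, of "of_real R"] r \<open>0 < R\<close> show ?thesis
        by (simp add: norm_mult norm_power)
    qed
    have fm: "f j \<in> borel_measurable disc" for j
      unfolding f_def[abs_def] by (intro borel_measurable_disc borel_measurable_scaleR ind0) measurable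
    have fint: "integrable disc (f j)" for j
    proof (rule Bochner_Integration.integrable_bound)
      show "integrable disc (\<lambda>w. cmod (a j) * R ^ j * defect w powr \<beta>)"
        by (intro integrable_mult_right integrable_defect_powr \<beta>)
      show "AE w in disc. cmod (f j w) \<le> norm (cmod (a j) * R ^ j * defect w powr \<beta>)"
        using f_le wsp \<open>0 < R\<close> by (intro AE_I2) (auto simp: abs_mult)
    qed (rule fm)
    have "(\<lambda>j. \<integral>w. f j w \<partial>disc) sums (\<integral>w. (\<Sum>j. f j w) \<partial>disc)"
    proof (rule sums_integral[OF fint])
      show "AE w in disc. summable (\<lambda>j. norm (f j w))"
      proof (rule AE_I2)
        fix w assume w: "w \<in> space disc"
        show "summable (\<lambda>j. norm (f j w))"
        proof (rule summable_comparison_test')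
          show "summable (\<lambda>j. cmod (a j) * R ^ j * defect w powr \<beta>)"
            by (rule summable_mult2[OF sR])
          show "norm (norm (f j w)) \<le> cmod (a j) * R ^ j * defect w powr \<beta>" for j
            by (simp only: real_norm_def abs_norm_cancel f_le[OF wsp[OF w]])
        qed
      qed
      have "(\<integral>w. norm (f j w) \<partial>disc) \<le> cmod (a j) * R ^ j * (\<integral>w. defect w powr \<beta> \<partial>disc)" for j
      proof -
        have "(\<integral>w. norm (f j w) \<partial>disc) \<le> (\<integral>w. cmod (a j) * R ^ j * defect w powr \<beta> \<partial>disc)"
          by (intro integral_mono integrable_norm fint integrable_mult_right integrable_defect_powr \<beta> f_le wsp)
        then show ?thesis by simp
      qed
      moreover have "0 \<le> (\<integral>w. norm (f j w) \<partial>disc)" for j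
        by (intro Bochner_Integration.integral_nonneg) simp
      ultimately show "summable (\<lambda>j. \<integral>w. norm (f j w) \<partial>disc)"
        by (intro summable_comparison_test'[OF summable_mult2[OF sR, of "\<integral>w. defect w powr \<beta> \<partial>disc"]])
          (simp only: real_norm_def abs_of_nonneg)
    qed
    moreover have "(\<integral>w. (\<Sum>j. f j w) \<partial>disc) = (\<integral>w. ind R w *\<^sub>R G w \<partial>disc)"
    proof (rule Bochner_Integration.integral_cong)
      fix w assume "w \<in> space disc"
      then have "(\<lambda>j. a j * w ^ j) sums H w" by (intro H wsp)
      from sums_scaleR_right[OF sums_mult2[OF this, of "cnj w ^ k * complex_of_real (defect w powr \<beta>)"], of "ind R w"]
      have "(\<lambda>j. f j w) sums (ind R w *\<^sub>R G w)"
        by (simp add: f_def G_def mult_ac)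
      then show "(\<Sum>j. f j w) = ind R w *\<^sub>R G w" by (rule sums_unique[symmetric])
    qed simp
    moreover have "(\<integral>w. f j w \<partial>disc) = 0" if "j \<noteq> k" for j
    proof -
      have "f j w = a j * (w ^ j * cnj w ^ k * of_real ((if cmod w < R then 1 else 0) * (1 - (cmod w)\<^sup>2) powr \<beta>))" for w
        by (simp add: f_def ind_def defect_def scaleR_conv_of_real)
      moreover have "(\<lambda>s. (if s < R then 1 else 0) * (1 - s\<^sup>2) powr \<beta>) \<in> borel_measurable borel"
        by measurable
      note monomial_orthogonal[OF this that]
      ultimately show ?thesis
        by (simp only: Bochner_Integration.integral_mult_right_zero mult_zero_right)
    qed
    then have "(\<lambda>j. \<integral>w. f j w \<partial>disc) = (\<lambda>j. if j = k then \<integral>w. f j w \<partial>disc else 0)"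
      by (intro ext) (simp only: if_cancel if_split, blast)
    then have "(\<lambda>j. \<integral>w. f j w \<partial>disc) sums (\<integral>w. f k w \<partial>disc)"
      using sums_single[of k "\<lambda>j. \<integral>w. f j w \<partial>disc"] by (simp only:)
    ultimately have "(\<integral>w. ind R w *\<^sub>R G w \<partial>disc) = (\<integral>w. f k w \<partial>disc)"
      using sums_unique2 by metis
    moreover have "f k w = a k * (ind R w *\<^sub>R B w)" for w
    proof -
      have "w ^ k * cnj w ^ k = complex_of_real (cmod w ^ (2 * k))"
        by (simp add: power_mult flip: power_mult_distrib complex_norm_square)
      then show ?thesis by (simp add: f_def B_def mult_ac)
    qed
    ultimately show ?thesis by (simp only: Bochner_Integration.integral_mult_right_zero)
  qed
  \<comment> \<open>The shift by 2 makes \<open>r 0\<close> positive, as \<open>R\<close>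
    requires.\<close>
  define r where "r m = 1 - 1 / (real m + 2)" for m
  have r: "0 < r m" "r m < 1" for m by (simp_all add: r_def field_simps)
  have r_lim: "r \<longlonglongrightarrow> 1"
    using LIMSEQ_Suc[OF LIMSEQ_inverse_real_of_nat_add_minus[of 1]]
    by (simp add: r_def[abs_def] inverse_eq_divide add.commute)
  have lim: "(\<lambda>m. \<integral>w. ind (r m) w *\<^sub>R g w \<partial>disc) \<longlonglongrightarrow> (\<integral>w. g w \<partial>disc)"
    if g: "integrable disc g" for g :: "complex \<Rightarrow> complex"
  proof (rule integral_dominated_convergence)
    show "integrable disc (\<lambda>w. norm (g w))" using g by (rule integrable_norm)
    note [measurable] = borel_measurable_integrable[OF g]
    show "g \<in> borel_measurable disc" "(\<lambda>w. ind (r m) w *\<^sub>R g w) \<in> borel_measurable disc" for m by measurable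
    show "AE w in disc. norm (ind (r m) w *\<^sub>R g w) \<le> norm (g w)" for m
      by (simp add: ind_def)
    show "AE w in disc. (\<lambda>m. ind (r m) w *\<^sub>R g w) \<longlonglongrightarrow> g w"
    proof (rule AE_I2)
      fix w assume "w \<in> space disc"
      then have "eventually (\<lambda>m. cmod w < r m) sequentially"
        by (intro order_tendstoD(1)[OF r_lim] wsp)
      then have "eventually (\<lambda>m. ind (r m) w *\<^sub>R g w = g w) sequentially"
        by eventually_elim (simp add: ind_def)
      then show "(\<lambda>m. ind (r m) w *\<^sub>R g w) \<longlonglongrightarrow> g w"
        by (rule tendsto_eventually)
    qed
  qed
  have "integrable disc G"
    by (rule Bochner_Integration.integrable_bound[OF int Gm]) (intro AE_I2 G_le wsp)
  from lim[OF this] have "(\<lambda>m. a k * (\<integral>w. ind (r m) w *\<^sub>R B w \<partial>disc)) \<longlonglongrightarrow> (\<integral>w. G w \<partial>disc)"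
    using r by (simp add: R)
  moreover have "(\<lambda>m. a k * (\<integral>w. ind (r m) w *\<^sub>R B w \<partial>disc)) \<longlonglongrightarrow> a k * (\<integral>w. B w \<partial>disc)"
    by (intro tendsto_mult_left lim Bint)
  ultimately have "(\<integral>w. G w \<partial>disc) = a k * (\<integral>w. B w \<partial>disc)"
    by (rule LIMSEQ_unique)
  also have "(\<integral>w. B w \<partial>disc) = of_real (pi * Beta (real k + 1) (\<beta> + 1))"
    unfolding B_def[abs_def] integral_moment[OF \<beta>, symmetric] by (intro integral_of_real integrable_moment \<beta>)
  finally show ?thesis by (simp add: G_def)
qed

section \<open>Integrals against the Bergman kernel\<close>

text \<open>The sign of the generalized binomial coefficient cancels that of
  \<open>(- x) ^ k\<close>. In this form the coefficients are positive for positive \<open>b\<close>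
  and can be compared term by term.\<close>

lemma binomial_series_minus:
  fixes x :: complex and b :: real
  assumes "cmod x < 1"
  shows "(\<lambda>k. of_real (pochhammer b k / fact k) * x ^ k) sums ((1 - x) powr (- of_real b))"
proof -
  have "(\<lambda>k. (- of_real b gchoose k) * (- x) ^ k) sums ((1 + - x) powr (- of_real b))"
    using assms by (intro gen_binomial_complex) simp
  moreover have "(- of_real b gchoose k) * (- x) ^ k = of_real (pochhammer b k / fact k) * x ^ k" for k
  proof -
    have "(- x) ^ k = (- 1) ^ k * x ^ k" by (rule power_minus)
    moreover have "(- 1) ^ k * (- 1) ^ k = (1 :: complex)" by (simp flip: power_mult_distrib)
    ultimately show ?thesis
      by (simp add: gbinomial_pochhammer pochhammer_of_real mult_ac)
  qed
  ultimately show ?thesis by simp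
qed

lemma norm_mult_cnj_less_1:
  assumes "cmod z < 1" "cmod w < 1"
  shows "cmod (z * cnj w) < 1"
proof -
  have "cmod z * cmod w \<le> cmod z * 1" using assms by (intro mult_left_mono) auto
  with assms show ?thesis by (simp add: norm_mult)
qed

text \<open>Keeps the base of the kernel away from the branch cut of the principal power.\<close>

lemma Re_one_minus_pos:
  assumes "cmod z < 1" "cmod w < 1"
  shows "0 < Re (1 - z * cnj w)"
  using complex_Re_le_cmod[of "z * cnj w"] norm_mult_cnj_less_1[OF assms] by simp

lemma norm_one_minus_ge:
  assumes "cmod w < 1"
  shows "1 - cmod z \<le> cmod (1 - z * cnj w)"
proof -
  have "1 - cmod (z * cnj w) \<le> cmod (1 - z * cnj w)"
    by (metis norm_one norm_triangle_ineq2)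
  moreover have "cmod z * cmod w \<le> cmod z * 1" using assms by (intro mult_left_mono) auto
  ultimately show ?thesis by (simp add: norm_mult)
qed

lemma integrable_cnj_power_mult:
  assumes \<phi>: "integrable disc \<phi>"
  shows "integrable disc (\<lambda>w. cnj w ^ k * \<phi> w)"
proof (rule Bochner_Integration.integrable_bound[OF \<phi>])
  show "(\<lambda>w. cnj w ^ k * \<phi> w) \<in> borel_measurable disc"
    by (intro borel_measurable_times[OF _ borel_measurable_integrable[OF \<phi>]] borel_measurable_disc) measurable
  show "AE w in disc. cmod (cnj w ^ k * \<phi> w) \<le> cmod (\<phi> w)"
    by (intro AE_I2) (simp add: norm_mult norm_power space_restrict_space mult_left_le_one_le power_le_one)
qed

text \<open>The binomial series of the kernel is dominated by a geometric series in |z|, uniformly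
  in \<open>w\<close>, so it can be integrated term by term. Hence the moments of \<phi> determine
  the kernel integral.\<close>

lemma kernel_sums:
  fixes \<phi> :: "complex \<Rightarrow> complex" and b :: real
  assumes \<phi>: "integrable disc \<phi>" and z: "cmod z < 1"
  shows "(\<lambda>k. of_real (pochhammer b k / fact k) * (\<integral>w. cnj w ^ k * \<phi> w \<partial>disc) * z ^ k)
    sums (\<integral>w. \<phi> w * (1 - z * cnj w) powr (- of_real b) \<partial>disc)"
proof -
  have wsp: "cmod w < 1" if "w \<in> space disc" for w using that by (simp add: space_restrict_space)
  define c where "c k = complex_of_real (pochhammer b k / fact k)" for k
  define f where "f k w = c k * z ^ k * (cnj w ^ k * \<phi> w)" for k w
  note m = integrable_cnj_power_mult[OF \<phi>]
  have fint: "integrable disc (f k)" for k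
    unfolding f_def[abs_def] by (intro integrable_mult_right m)
  have f_le: "cmod (f k w) \<le> cmod (c k) * cmod z ^ k * cmod (\<phi> w)" if "cmod w < 1" for k w
  proof -
    have "cmod w ^ k * cmod (\<phi> w) \<le> 1 * cmod (\<phi> w)"
      using that by (intro mult_right_mono power_le_one) auto
    then have "cmod (c k) * cmod z ^ k * (cmod w ^ k * cmod (\<phi> w)) \<le> cmod (c k) * cmod z ^ k * (1 * cmod (\<phi> w))"
      by (intro mult_left_mono) auto
    then show ?thesis by (simp add: f_def norm_mult norm_power)
  qed
  have sz: "summable (\<lambda>k. cmod (c k) * cmod z ^ k)"
  proof -
    obtain r where r: "cmod z < r" "r < 1" using z dense by blast
    moreover have "0 \<le> r" using r(1) norm_ge_zero[of z] by linarith
    ultimately have "summable (\<lambda>k. c k * complex_of_real r ^ k)"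
      unfolding c_def by (intro sums_summable[OF binomial_series_minus]) simp
    from powser_insidea[OF this, of z] r \<open>0 \<le> r\<close> show ?thesis
      by (simp add: norm_mult norm_power)
  qed
  have "(\<lambda>k. \<integral>w. f k w \<partial>disc) sums (\<integral>w. (\<Sum>k. f k w) \<partial>disc)"
  proof (rule sums_integral[OF fint])
    show "AE w in disc. summable (\<lambda>k. norm (f k w))"
    proof (rule AE_I2)
      fix w assume w: "w \<in> space disc"
      show "summable (\<lambda>k. norm (f k w))"
      proof (rule summable_comparison_test')
        show "summable (\<lambda>k. cmod (c k) * cmod z ^ k * cmod (\<phi> w))"
          by (rule summable_mult2[OF sz])
        show "norm (norm (f k w)) \<le> cmod (c k) * cmod z ^ k * cmod (\<phi> w)" for k
          by (simp only: real_norm_def abs_norm_cancel f_le[OF wsp[OF w]])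
      qed
    qed
    have "(\<integral>w. norm (f k w) \<partial>disc) \<le> cmod (c k) * cmod z ^ k * (\<integral>w. cmod (\<phi> w) \<partial>disc)" for k
    proof -
      have "(\<integral>w. norm (f k w) \<partial>disc) \<le> (\<integral>w. cmod (c k) * cmod z ^ k * cmod (\<phi> w) \<partial>disc)"
        by (intro integral_mono integrable_norm fint integrable_mult_right \<phi> f_le wsp)
      then show ?thesis by simp
    qed
    moreover have "0 \<le> (\<integral>w. norm (f k w) \<partial>disc)" for k
      by (intro Bochner_Integration.integral_nonneg) simp
    ultimately show "summable (\<lambda>k. \<integral>w. norm (f k w) \<partial>disc)"
      by (intro summable_comparison_test'[OF summable_mult2[OF sz, of "\<integral>w. cmod (\<phi> w) \<partial>disc"]])
        (simp only: real_norm_def abs_of_nonneg)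
  qed
  moreover have "(\<integral>w. (\<Sum>k. f k w) \<partial>disc) = (\<integral>w. \<phi> w * (1 - z * cnj w) powr (- of_real b) \<partial>disc)"
  proof (rule Bochner_Integration.integral_cong)
    fix w assume "w \<in> space disc"
    then have "cmod w < 1" by (rule wsp)
    then have "cmod (z * cnj w) < 1" by (rule norm_mult_cnj_less_1[OF z])
    from sums_mult2[OF binomial_series_minus[OF this, of b], of "\<phi> w"]
    have "(\<lambda>k. f k w) sums (\<phi> w * (1 - z * cnj w) powr (- of_real b))"
      by (simp add: f_def c_def power_mult_distrib mult_ac)
    then show "(\<Sum>k. f k w) = \<phi> w * (1 - z * cnj w) powr (- of_real b)" by (rule sums_unique[symmetric])
  qed simp
  moreover have "(\<integral>w. f k w \<partial>disc) = of_real (pochhammer b k / fact k) * (\<integral>w. cnj w ^ k * \<phi> w \<partial>disc) * z ^ k" for k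
    unfolding f_def Bochner_Integration.integral_mult_right_zero c_def by (simp add: mult_ac)
  ultimately show ?thesis by simp
qed

text \<open>The power series of \<open>kernel_sums\<close> is differentiated, not the integrand. The
  new coefficients again form a kernel series, of exponent \<open>b + 1\<close> and for the density
  \<open>cnj w * \<phi> w\<close>, because (k + 1) (b)_(k+1) / (k + 1)! = b (b + 1)_k / k!.\<close>

lemma has_field_derivative_kernel_integral:
  fixes \<phi> :: "complex \<Rightarrow> complex" and b :: real
  assumes \<phi>: "integrable disc \<phi>" and z: "cmod z < 1"
  shows "((\<lambda>z. \<integral>w. \<phi> w * (1 - z * cnj w) powr (- of_real b) \<partial>disc) has_field_derivative
    of_real b * (\<integral>w. cnj w * \<phi> w * (1 - z * cnj w) powr (- of_real (b + 1)) \<partial>disc)) (at z)"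
proof -
  define c where "c k = of_real (pochhammer b k / fact k) * (\<integral>w. cnj w ^ k * \<phi> w \<partial>disc)" for k
  define F where "F z = (\<integral>w. \<phi> w * (1 - z * cnj w) powr (- of_real b) \<partial>disc)" for z
  have F: "(\<lambda>k. c k * z ^ k) sums F z" if "cmod z < 1" for z
    unfolding c_def F_def by (rule kernel_sums[OF \<phi> that])
  have "(F has_field_derivative (\<Sum>k. diffs c k * z ^ k)) (at z)"
  proof (rule has_field_derivative_transform_within_open)
    show "((\<lambda>z. \<Sum>k. c k * z ^ k) has_field_derivative (\<Sum>k. diffs c k * z ^ k)) (at z)"
      by (rule termdiffs_strong'[OF sums_summable[OF F] z])
    show "open (ball 0 1 :: complex set)" "z \<in> ball 0 1" using z by auto
    show "(\<Sum>k. c k * x ^ k) = F x" if "x \<in> ball 0 1" for x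
      using that by (intro sums_unique[symmetric] F) simp
  qed
  moreover have "(\<Sum>k. diffs c k * z ^ k)
      = of_real b * (\<integral>w. cnj w * \<phi> w * (1 - z * cnj w) powr (- of_real (b + 1)) \<partial>disc)"
  proof (rule sums_unique[symmetric])
    have \<phi>': "integrable disc (\<lambda>w. cnj w * \<phi> w)"
      using integrable_cnj_power_mult[OF \<phi>, of 1] by simp
    have "diffs c k * z ^ k = of_real b * (of_real (pochhammer (b + 1) k / fact k) *
        (\<integral>w. cnj w ^ k * (cnj w * \<phi> w) \<partial>disc) * z ^ k)" for k
    proof -
      have "diffs c k * z ^ k = complex_of_real (real (Suc k) * (pochhammer b (Suc k) / fact (Suc k))) *
          (\<integral>w. cnj w ^ k * (cnj w * \<phi> w) \<partial>disc) * z ^ k"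
        by (simp add: diffs_def c_def mult_ac del: of_nat_Suc fact_Suc)
      also have "real (Suc k) * (pochhammer b (Suc k) / fact (Suc k)) = b * (pochhammer (b + 1) k / fact k)"
        by (simp add: pochhammer_rec field_simps del: of_nat_Suc)
      finally show ?thesis by (simp add: mult_ac)
    qed
    then show "(\<lambda>k. diffs c k * z ^ k) sums (of_real b *
        (\<integral>w. cnj w * \<phi> w * (1 - z * cnj w) powr (- of_real (b + 1)) \<partial>disc))"
      using sums_mult[OF kernel_sums[OF \<phi>' z, of "b + 1"], of "of_real b"] by (simp only:)
  qed
  ultimately show ?thesis by (simp add: F_def[abs_def])
qed

lemma higher_deriv_kernel_integral:
  fixes \<phi> :: "complex \<Rightarrow> complex" and b :: real
  assumes "integrable disc \<phi>" and "cmod z < 1"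
    and "\<And>z. cmod z < 1 \<Longrightarrow> F z = (\<integral>w. \<phi> w * (1 - z * cnj w) powr (- of_real b) \<partial>disc)"
  shows "(deriv ^^ n) F z = of_real (pochhammer b n) *
    (\<integral>w. cnj w ^ n * \<phi> w * (1 - z * cnj w) powr (- of_real (b + real n)) \<partial>disc)"
  using assms(2)
proof (induction n arbitrary: z)
  case 0
  then show ?case by (simp add: assms(3))
next
  case (Suc n)
  note m = integrable_cnj_power_mult[OF assms(1)]
  have "((deriv ^^ n) F has_field_derivative of_real (pochhammer b n) * (of_real (b + real n) *
      (\<integral>w. cnj w * (cnj w ^ n * \<phi> w) * (1 - z * cnj w) powr (- of_real (b + real n + 1)) \<partial>disc))) (at z)"
  proof (rule has_field_derivative_transform_within_open)
    show "((\<lambda>z. of_real (pochhammer b n) *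
        (\<integral>w. cnj w ^ n * \<phi> w * (1 - z * cnj w) powr (- of_real (b + real n)) \<partial>disc)) has_field_derivative
      of_real (pochhammer b n) * (of_real (b + real n) *
      (\<integral>w. cnj w * (cnj w ^ n * \<phi> w) * (1 - z * cnj w) powr (- of_real (b + real n + 1)) \<partial>disc))) (at z)"
      by (intro DERIV_cmult has_field_derivative_kernel_integral m Suc.prems)
    show "open (ball 0 1 :: complex set)" "z \<in> ball 0 1" using Suc.prems by auto
  qed (use Suc.IH in simp)
  then have "deriv ((deriv ^^ n) F) z = of_real (pochhammer b n) * (of_real (b + real n) *
      (\<integral>w. cnj w * (cnj w ^ n * \<phi> w) * (1 - z * cnj w) powr (- of_real (b + real n + 1)) \<partial>disc))"
    by (rule DERIV_imp_deriv)
  then show ?case by (simp add: pochhammer_Suc mult_ac add_ac)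
qed

section \<open>The Forelli-Rudin estimate\<close>

lemma borel_measurable_disc_continuous:
  "continuous_on (ball 0 1) f \<Longrightarrow> f \<in> borel_measurable disc"
  by (rule continuous_imp_measurable_on_sets_lebesgue) auto

lemma continuous_on_powr_Re_pos:
  fixes f :: "complex \<Rightarrow> complex"
  assumes "continuous_on A f" and "\<And>w. w \<in> A \<Longrightarrow> 0 < Re (f w)"
  shows "continuous_on A (\<lambda>w. f w powr b)"
proof (rule continuous_on_powr_complex[OF _ _ assms(1) continuous_on_const])
  show "A \<subseteq> {w. 0 \<le> Re (f w) \<or> Im (f w) \<noteq> 0}" using assms(2) by (auto intro: less_imp_le)
  show "0 < Re b" if "w \<in> A" "f w = 0" for w using assms(2)[OF that(1)] that(2) by simp
qed

lemma norm_kernel: "cmod (u powr (- of_real b)) = cmod u powr (- b)"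
  using norm_powr_real_powr'[of "- of_real b" u] by simp

text \<open>A substitute for Gamma function asymptotics. As \<gamma> is the mean of \<open>a\<close>
  and \<open>c\<close>, the product (a + k) (c + k) falls short of (\<gamma> + k)^2 by the fixed
  amount \<delta>^2; so the quotient of the two sides grows by factors \<open>1 + e k\<close> with
  \<open>e\<close> summable, and stays below the exponential of the sum of \<open>e\<close>.\<close>

lemma pochhammer_square_le:
  fixes a c \<gamma> :: real
  assumes "0 < a" "0 < c" "2 * \<gamma> = a + c"
  shows "\<exists>C>0. \<forall>k. (pochhammer \<gamma> k)\<^sup>2 \<le> C * (pochhammer a k * pochhammer c k)"
proof -
  define \<delta> where "\<delta> = (a - c) / 2"
  define e where "e j = \<delta>\<^sup>2 / ((a + real j) * (c + real j))" for j
  have e0: "0 \<le> e j" for j using assms by (simp add: e_def)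
  have "summable e"
  proof (rule summable_comparison_test')
    show "summable (\<lambda>j. \<delta>\<^sup>2 * inverse (real j ^ 2))"
      by (intro summable_mult inverse_power_summable) simp
    show "norm (e j) \<le> \<delta>\<^sup>2 * inverse (real j ^ 2)" if "1 \<le> j" for j
    proof -
      have "real j * real j \<le> (a + real j) * (c + real j)" using assms by (intro mult_mono) auto
      then have "e j \<le> \<delta>\<^sup>2 / (real j)\<^sup>2"
        using that assms unfolding e_def power2_eq_square[of "real j"]
        by (intro divide_left_mono mult_pos_pos add_pos_nonneg) auto
      then show ?thesis using e0 by (simp add: divide_inverse)
    qed
  qed
  have bound: "(pochhammer \<gamma> k)\<^sup>2 \<le> exp (\<Sum>j<k. e j) * (pochhammer a k * pochhammer c k)" for k
  proof (induction k)
    case (Suc k)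
    have pos: "0 < a + real k" "0 < c + real k" using assms by auto
    have \<gamma>: "\<gamma> = (a + c) / 2" using assms by simp
    have "(\<gamma> + real k)\<^sup>2 = (a + real k) * (c + real k) + \<delta>\<^sup>2"
      unfolding \<gamma> \<delta>_def by (simp add: power2_eq_square field_simps)
    also have "\<dots> = (1 + e k) * ((a + real k) * (c + real k))"
    proof -
      have "x + \<delta>\<^sup>2 = (1 + \<delta>\<^sup>2 / x) * x" if "x \<noteq> 0" for x using that by (simp add: field_simps)
      then show ?thesis using pos unfolding e_def by simp
    qed
    also have "\<dots> \<le> exp (e k) * ((a + real k) * (c + real k))"
      using pos by (intro mult_right_mono exp_ge_add_one_self) auto
    finally have "(pochhammer \<gamma> k)\<^sup>2 * (\<gamma> + real k)\<^sup>2
        \<le> (exp (\<Sum>j<k. e j) * (pochhammer a k * pochhammer c k)) * (exp (e k) * ((a + real k) * (c + real k)))"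
      using Suc assms by (intro mult_mono) (auto simp: pochhammer_nonneg)
    then show ?case by (simp add: pochhammer_Suc power_mult_distrib exp_add mult_ac)
  qed simp
  have "(pochhammer \<gamma> k)\<^sup>2 \<le> exp (suminf e) * (pochhammer a k * pochhammer c k)" for k
  proof -
    have "(\<Sum>j<k. e j) \<le> suminf e" by (intro sum_le_suminf \<open>summable e\<close>) (auto simp: e0)
    then have "exp (\<Sum>j<k. e j) * (pochhammer a k * pochhammer c k) \<le> exp (suminf e) * (pochhammer a k * pochhammer c k)"
      using assms by (intro mult_right_mono) (auto simp: pochhammer_nonneg)
    with bound[of k] show ?thesis by linarith
  qed
  then show ?thesis by (intro exI[of _ "exp (suminf e)"]) auto
qed

text \<open>Puts the moments into Pochhammer form, where they cancel against binomial
  coefficients.\<close>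

lemma Beta_Suc_eq:
  fixes t :: real
  assumes "t > -1"
  shows "Beta (real k + 1) (t + 1) = fact k / ((t + 1) * pochhammer (t + 2) k)"
proof -
  have "t + 2 \<notin> \<int>\<^sub>\<le>\<^sub>0" using assms by (auto elim!: nonpos_Ints_cases)
  then have "pochhammer (t + 2) k = Gamma (t + 2 + real k) / Gamma (t + 2)"
    by (rule pochhammer_Gamma)
  moreover have "Gamma (t + 2) = (t + 1) * Gamma (t + 1)"
  proof -
    have "t + 1 \<notin> \<int>\<^sub>\<le>\<^sub>0" using assms by (auto elim!: nonpos_Ints_cases)
    from Gamma_plus1[OF this] show ?thesis by (simp add: add_ac)
  qed
  moreover have "0 < Gamma (t + 1)" "0 < Gamma (t + 2 + real k)"
    using assms by (auto intro!: Gamma_real_pos)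
  moreover have "Beta (real k + 1) (t + 1) = fact k * Gamma (t + 1) / Gamma (t + 2 + real k)"
    using Gamma_fact[of k, where 'a=real] by (simp add: Beta_def add_ac)
  ultimately show ?thesis
    using assms by simp
qed

text \<open>The kernel is the product of the conjugate functions \<open>(1 - z w\<^sup>*)\<^sup>-\<^sup>\<gamma>\<close> and
  \<open>(1 - z\<^sup>* w)\<^sup>-\<^sup>\<gamma>\<close>; expanding one of them turns the integral into a power series in
  \<open>\<bar>z\<bar>\<^sup>2\<close>, whose coefficients are compared with those of \<open>(1 - \<bar>z\<bar>\<^sup>2)\<^sup>-\<^sup>c\<close>.\<close>

lemma Forelli_Rudin:
  assumes "t > -1" and "c > 0"
  shows "\<exists>C>0. \<forall>z. cmod z < 1 \<longrightarrow>
    (\<integral>\<^sup>+w. ennreal (defect w powr t * cmod (1 - z * cnj w) powr (- (2 + t + c))) \<partial>disc)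
      \<le> ennreal (C * defect z powr (- c))"
proof -
  \<comment> \<open>Half the exponent, so that the kernel is \<open>H w * cnj (H w)\<close> below;
    it is also the mean of \<open>t + 2\<close> and \<open>c\<close>, as
    \<open>pochhammer_square_le\<close> demands.\<close>
  define \<gamma> where "\<gamma> = (2 + t + c) / 2"
  have "2 * \<gamma> = (t + 2) + c" by (simp add: \<gamma>_def)
  then obtain C where C: "C > 0"
    "\<And>k. (pochhammer \<gamma> k)\<^sup>2 \<le> C * (pochhammer (t + 2) k * pochhammer c k)"
    using pochhammer_square_le[of "t + 2" c \<gamma>] assms by auto
  \<comment> \<open>\<open>C\<close> comes from the comparison of coefficients, \<open>pi\<close>
    and \<open>t + 1\<close> from the value of the moments.\<close>
  define C' where "C' = pi * C / (t + 1)"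
  have C': "C' > 0" using C assms by (simp add: C'_def)
  have "(\<integral>\<^sup>+w. ennreal (defect w powr t * cmod (1 - z * cnj w) powr (- (2 + t + c))) \<partial>disc)
      \<le> ennreal (C' * defect z powr (- c))" if z: "cmod z < 1" for z
  proof -
    define H where "H w = (1 - cnj z * w) powr (- of_real \<gamma>)" for w
    define \<phi> where "\<phi> w = H w * of_real (defect w powr t)" for w
    have wsp: "cmod w < 1" if "w \<in> space disc" for w using that by (simp add: space_restrict_space)
    have cz: "cmod (cnj z) < 1" using z by simp
    have cnj_H: "cnj (H w) = (1 - z * cnj w) powr (- of_real \<gamma>)" if "cmod w < 1" for w
    proof -
      have "0 < Re (1 - cnj z * cnj (cnj w))" using that z by (intro Re_one_minus_pos) auto
      then have "cnj ((1 - cnj z * w) powr (- of_real \<gamma>)) = cnj (1 - cnj z * w) powr cnj (- of_real \<gamma>)"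
        by (intro cnj_powr) auto
      then show ?thesis by (simp add: H_def)
    qed
    have H_sums: "(\<lambda>k. (of_real (pochhammer \<gamma> k / fact k) * cnj z ^ k) * w ^ k) sums H w" if "cmod w < 1" for w
    proof -
      have "cmod (cnj z * cnj (cnj w)) < 1" using that z by (intro norm_mult_cnj_less_1) auto
      then have "cmod (cnj z * w) < 1" by simp
      from binomial_series_minus[OF this, of \<gamma>] show ?thesis
        by (simp add: H_def power_mult_distrib mult_ac)
    qed
    have H_norm: "cmod (H w) \<le> (1 - cmod z) powr (- \<gamma>)" if "cmod w < 1" for w
    proof -
      have "1 - cmod (cnj z) \<le> cmod (1 - cnj z * cnj (cnj w))" using that by (intro norm_one_minus_ge) auto
      then show ?thesis using z assms
        unfolding H_def norm_kernel by (intro powr_mono2') (auto simp: \<gamma>_def)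
    qed
    have \<phi>m: "\<phi> \<in> borel_measurable disc"
      unfolding \<phi>_def[abs_def] H_def
    proof (intro borel_measurable_times)
      show "(\<lambda>w. (1 - cnj z * w) powr (- of_real \<gamma>)) \<in> borel_measurable disc"
      proof (intro borel_measurable_disc_continuous continuous_on_powr_Re_pos)
        fix w :: complex assume "w \<in> ball 0 1"
        then show "0 < Re (1 - cnj z * w)"
          using Re_one_minus_pos[OF cz, of "cnj w"] by simp
      qed (intro continuous_intros)
    qed (intro borel_measurable_disc, measurable)
    have \<phi>: "integrable disc \<phi>"
    proof (rule Bochner_Integration.integrable_bound[OF _ \<phi>m])
      show "integrable disc (\<lambda>w. (1 - cmod z) powr (- \<gamma>) * defect w powr t)"
        using assms by (intro integrable_mult_right integrable_defect_powr)
      show "AE w in disc. cmod (\<phi> w) \<le> norm ((1 - cmod z) powr (- \<gamma>) * defect w powr t)"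
        using H_norm[OF wsp] by (intro AE_I2) (auto simp: \<phi>_def norm_mult intro!: mult_right_mono)
    qed
    \<comment> \<open>Coefficient of |z|^(2k) in the integral: one Pochhammer factor from expanding
      the kernel, the other from the Taylor coefficient of \<open>H\<close> picked out by the
      moment.\<close>
    define A where "A k = (pochhammer \<gamma> k / fact k)\<^sup>2 * (pi * Beta (real k + 1) (t + 1))" for k
    define J where "J = (\<integral>w. \<phi> w * (1 - z * cnj w) powr (- of_real \<gamma>) \<partial>disc)"
    have moments: "(\<integral>w. cnj w ^ k * \<phi> w \<partial>disc) =
        of_real (pochhammer \<gamma> k / fact k) * cnj z ^ k * of_real (pi * Beta (real k + 1) (t + 1))" for k
      using integral_disc_cnj_power[OF assms(1) H_sums \<phi>[unfolded \<phi>_def[abs_def]], of k]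
      by (simp add: \<phi>_def mult.assoc)
    have "(\<lambda>k. of_real (pochhammer \<gamma> k / fact k) * (\<integral>w. cnj w ^ k * \<phi> w \<partial>disc) * z ^ k) sums J"
      unfolding J_def by (rule kernel_sums[OF \<phi> z])
    moreover have "of_real (pochhammer \<gamma> k / fact k) * (\<integral>w. cnj w ^ k * \<phi> w \<partial>disc) * z ^ k
        = complex_of_real (A k * ((cmod z)\<^sup>2) ^ k)" for k
    proof -
      have "cnj z ^ k * z ^ k = complex_of_real (((cmod z)\<^sup>2) ^ k)"
        by (simp add: mult.commute[of "cnj z"] flip: power_mult_distrib complex_norm_square)
      moreover have "of_real (pochhammer \<gamma> k / fact k) * (\<integral>w. cnj w ^ k * \<phi> w \<partial>disc) * z ^ k
        = complex_of_real (A k) * (cnj z ^ k * z ^ k)"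
        unfolding moments A_def power2_eq_square by (simp add: mult_ac)
      ultimately show ?thesis by simp
    qed
    ultimately have J: "(\<lambda>k. complex_of_real (A k * ((cmod z)\<^sup>2) ^ k)) sums J" by (simp only:)
    have K: "\<phi> w * (1 - z * cnj w) powr (- of_real \<gamma>)
        = complex_of_real (defect w powr t * cmod (1 - z * cnj w) powr (- (2 + t + c)))" if "cmod w < 1" for w
    proof -
      have "\<phi> w * (1 - z * cnj w) powr (- of_real \<gamma>) = (H w * cnj (H w)) * of_real (defect w powr t)"
        by (simp add: \<phi>_def cnj_H[OF that] mult_ac)
      also have "H w * cnj (H w) = of_real ((cmod (cnj (H w)))\<^sup>2)"
        using complex_norm_square[of "H w"] by simp
      also have "(cmod (cnj (H w)))\<^sup>2 = cmod (1 - z * cnj w) powr (- (2 + t + c))"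
        unfolding cnj_H[OF that] norm_kernel power2_eq_square powr_add[symmetric]
        by (rule arg_cong[where f="\<lambda>e. _ powr e"]) (simp add: \<gamma>_def field_simps)
      finally show ?thesis by (simp add: mult_ac)
    qed
    define g where "g w = defect w powr t * cmod (1 - z * cnj w) powr (- (2 + t + c))" for w
    have "integrable disc (\<lambda>w. complex_of_real (g w))"
    proof (rule Bochner_Integration.integrable_bound)
      show "integrable disc (\<lambda>w. (1 - cmod z) powr (- (2 + t + c)) * defect w powr t)"
        using assms by (intro integrable_mult_right integrable_defect_powr)
      show "(\<lambda>w. complex_of_real (g w)) \<in> borel_measurable disc"
        unfolding g_def by (intro borel_measurable_disc) measurable
      show "AE w in disc. norm (complex_of_real (g w)) \<le> norm ((1 - cmod z) powr (- (2 + t + c)) * defect w powr t)"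
      proof (rule AE_I2)
        fix w assume "w \<in> space disc"
        then have "cmod (1 - z * cnj w) powr (- (2 + t + c)) \<le> (1 - cmod z) powr (- (2 + t + c))"
          using z assms by (intro powr_mono2' norm_one_minus_ge wsp) auto
        then show "norm (complex_of_real (g w)) \<le> norm ((1 - cmod z) powr (- (2 + t + c)) * defect w powr t)"
          unfolding g_def norm_of_real real_norm_def abs_mult by (simp add: mult.commute mult_left_mono)
      qed
    qed
    then have g: "integrable disc g" by (simp add: complex_of_real_integrable_eq)
    have "J = (\<integral>w. complex_of_real (g w) \<partial>disc)"
      unfolding J_def by (intro Bochner_Integration.integral_cong) (simp_all add: K wsp g_def del: of_real_mult)
    also have "\<dots> = of_real (\<integral>w. g w \<partial>disc)" using g by (rule integral_of_real)
    finally have s1: "(\<lambda>k. A k * ((cmod z)\<^sup>2) ^ k) sums (\<integral>w. g w \<partial>disc)"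
      using J by (simp only: sums_of_real_iff)
    have s2: "(\<lambda>k. C' * (pochhammer c k / fact k * ((cmod z)\<^sup>2) ^ k)) sums (C' * defect z powr (- c))"
    proof (rule sums_mult)
      have "(cmod z)\<^sup>2 < 1" using z by (simp add: abs_square_less_1)
      then have "(\<lambda>k. complex_of_real (pochhammer c k / fact k) * of_real ((cmod z)\<^sup>2) ^ k)
          sums ((1 - of_real ((cmod z)\<^sup>2)) powr (- of_real c))"
        by (intro binomial_series_minus) (simp del: of_real_power)
      also have "(1 - of_real ((cmod z)\<^sup>2)) powr (- of_real c) = complex_of_real (defect z powr (- c))"
        using defect_pos[OF z] powr_of_real[of "defect z" "- c"] by (simp add: defect_def)
      finally show "(\<lambda>k. pochhammer c k / fact k * ((cmod z)\<^sup>2) ^ k) sums (defect z powr (- c))"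
        by (simp only: flip: of_real_power of_real_mult sums_of_real_iff[where 'a=complex])
    qed
    have le: "A k * ((cmod z)\<^sup>2) ^ k \<le> C' * (pochhammer c k / fact k * ((cmod z)\<^sup>2) ^ k)" for k
    proof -
      have P: "0 < pochhammer (t + 2) k" using assms by (intro pochhammer_pos) auto
      have "A k = (pochhammer \<gamma> k)\<^sup>2 * (pi / ((t + 1) * pochhammer (t + 2) k * fact k))"
        unfolding A_def Beta_Suc_eq[OF assms(1)] by (simp add: power2_eq_square mult_ac)
      also have "\<dots> \<le> C * (pochhammer (t + 2) k * pochhammer c k) * (pi / ((t + 1) * pochhammer (t + 2) k * fact k))"
        using C(2)[of k] P assms by (intro mult_right_mono) auto
      also have "\<dots> = C' * (pochhammer c k / fact k)"
      proof -
        have "C * (P * x) * (pi / (T * P * y)) = pi * C / T * (x / y)" if "P \<noteq> 0" for P T x y :: real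
          using that by simp
        from this[of "pochhammer (t + 2) k"] show ?thesis using P unfolding C'_def by simp
      qed
      finally have "A k \<le> C' * (pochhammer c k / fact k)" .
      then have "A k * ((cmod z)\<^sup>2) ^ k \<le> C' * (pochhammer c k / fact k) * ((cmod z)\<^sup>2) ^ k"
        by (rule mult_right_mono) simp
      then show ?thesis by (simp only: mult.assoc)
    qed
    have "(\<integral>w. g w \<partial>disc) \<le> C' * defect z powr (- c)"
      by (rule sums_le[OF le s1 s2])
    then show ?thesis
      using nn_integral_eq_integral[OF g] by (simp add: g_def[abs_def] ennreal_leI)
  qed
  with C' show ?thesis by blast
qed

section \<open>The weighted Schur test\<close>

lemma norm_powr_measurable:
  fixes h :: "'a \<Rightarrow> 'b :: real_normed_vector"
  shows "h \<in> borel_measurable M \<Longrightarrow> (\<lambda>w. norm (h w) powr p) \<in> borel_measurable M"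
  by measurable

text \<open>Where |h| is at most 1 the weight itself dominates, and it is integrable as \<alpha> >
  -1. Elsewhere |h| is at most its p-th power, and the weight is at most
  \<open>defect w powr (-2)\<close> since \<open>defect w\<close> lies in (0, 1] and \<alpha> >
  -2.\<close>

lemma integrable_disc_of_Lp:
  fixes h :: "complex \<Rightarrow> complex"
  assumes h: "h \<in> borel_measurable disc" and "p \<ge> 1" and "\<alpha> > -1"
    and fin: "(\<integral>\<^sup>+w. ennreal (cmod (h w) powr p * defect w powr (-2)) \<partial>disc) < \<infinity>"
  shows "integrable disc (\<lambda>w. h w * of_real (defect w powr \<alpha>))"
proof (rule integrableI_bounded)
  show "(\<lambda>w. h w * of_real (defect w powr \<alpha>)) \<in> borel_measurable disc"
    by (intro borel_measurable_times h borel_measurable_disc) measurable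
  have norm_eq: "cmod (h w * of_real (defect w powr \<alpha>)) = cmod (h w) * defect w powr \<alpha>" for w
    by (simp add: norm_mult)
  have le: "cmod (h w * of_real (defect w powr \<alpha>)) \<le> defect w powr \<alpha> + cmod (h w) powr p * defect w powr (-2)"
    if "w \<in> space disc" for w
  proof (cases "cmod (h w) \<le> 1")
    case True
    then have "cmod (h w) * defect w powr \<alpha> \<le> 1 * defect w powr \<alpha>" by (intro mult_right_mono) auto
    moreover have "0 \<le> cmod (h w) powr p * defect w powr (-2)" by simp
    ultimately show ?thesis unfolding norm_eq by linarith
  next
    case False
    have "0 < defect w" using that by (intro defect_pos) (simp add: space_restrict_space)
    then have "defect w powr \<alpha> \<le> defect w powr (-2)"
      using defect_le_1[of w] assms by (intro powr_mono') auto
    moreover have "cmod (h w) \<le> cmod (h w) powr p"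
      using False assms powr_mono[of 1 p "cmod (h w)"] by simp
    ultimately have "cmod (h w) * defect w powr \<alpha> \<le> cmod (h w) powr p * defect w powr (-2)"
      by (intro mult_mono) auto
    moreover have "0 \<le> defect w powr \<alpha>" by simp
    ultimately show ?thesis unfolding norm_eq by linarith
  qed
  have dm: "(\<lambda>w. defect w powr \<beta>) \<in> borel_measurable disc" for \<beta>
    by (intro borel_measurable_disc) measurable
  have hm: "(\<lambda>w. cmod (h w) powr p * defect w powr (-2)) \<in> borel_measurable disc"
    by (intro borel_measurable_times norm_powr_measurable dm h)
  have "(\<integral>\<^sup>+w. ennreal (cmod (h w * of_real (defect w powr \<alpha>))) \<partial>disc)
      \<le> (\<integral>\<^sup>+w. ennreal (defect w powr \<alpha>) + ennreal (cmod (h w) powr p * defect w powr (-2)) \<partial>disc)"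
    using le by (intro nn_integral_mono) (simp flip: ennreal_plus)
  also have "\<dots> = (\<integral>\<^sup>+w. ennreal (defect w powr \<alpha>) \<partial>disc)
      + (\<integral>\<^sup>+w. ennreal (cmod (h w) powr p * defect w powr (-2)) \<partial>disc)"
    by (intro nn_integral_add measurable_compose[OF _ measurable_ennreal] dm hm)
  also have "\<dots> < \<infinity>"
    using fin integrable_defect_powr[OF \<open>\<alpha> > -1\<close>]
    by (simp add: nn_integral_eq_integral)
  finally show "(\<integral>\<^sup>+w. ennreal (cmod (h w * of_real (defect w powr \<alpha>))) \<partial>disc) < \<infinity>" .
qed

text \<open>This is the tangent line at \<open>s\<close> of the convex function x^p, solved for
  \<open>x\<close>; at \<open>p = 1\<close> it is an equality. The right-hand side is linear in x^p
  and can be integrated for each \<open>s\<close> separately.\<close>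

lemma Young_scaled:
  fixes x s p :: real
  assumes "0 \<le> x" "0 < s" "1 \<le> p"
  shows "x \<le> s powr (1 - p) / p * x powr p + (1 - 1 / p) * s"
proof (cases "x = 0")
  case False
  define y where "y = x / s"
  have y: "0 < y" using False assms by (simp add: y_def)
  have "(y powr p) powr (1 / p) * 1 powr (1 - 1 / p) \<le> (1 / p) * y powr p + (1 - 1 / p) * 1"
    using y assms by (intro Youngs_inequality_0) auto
  then have "y \<le> (1 / p) * y powr p + (1 - 1 / p)"
    using y assms by (simp add: powr_powr)
  then have "s * y \<le> s * ((1 / p) * y powr p + (1 - 1 / p))"
    using assms by (intro mult_left_mono) auto
  also have "s * ((1 / p) * y powr p + (1 - 1 / p)) = (s powr 1 * s powr (- p)) / p * x powr p + (1 - 1 / p) * s"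
    using assms False by (simp add: y_def powr_divide powr_minus field_simps)
  also have "s powr 1 * s powr (- p) = s powr (1 - p)"
    by (simp only: powr_add[symmetric] add_uminus_conv_diff)
  finally show ?thesis using assms by (simp add: y_def)
qed (use assms in auto)

text \<open>Jensen's inequality, from its tangent lines: take \<open>s = J / m\<close>.\<close>

lemma powr_le_of_Young:
  fixes J m p :: real and B :: ennreal
  assumes "0 \<le> J" "0 < m" "1 \<le> p"
    and le: "\<And>s. 0 < s \<Longrightarrow> ennreal J \<le> ennreal (s powr (1 - p) / p) * B + ennreal ((1 - 1 / p) * (s * m))"
  shows "ennreal (J powr p) \<le> ennreal (m powr (p - 1)) * B"
proof (cases "J = 0 \<or> B = \<infinity>")
  case True
  then show ?thesis using assms by (auto simp: ennreal_mult_top)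
next
  case False
  then obtain b where b: "B = ennreal b" "0 \<le> b" by (cases B) auto
  have J: "0 < J" using False assms by auto
  define s where "s = J / m"
  have s: "0 < s" "s * m = J" using J assms by (auto simp: s_def)
  have "ennreal J \<le> ennreal (s powr (1 - p) / p * b + (1 - 1 / p) * J)"
    using le[OF s(1)] b assms J s(2) by (simp flip: ennreal_mult ennreal_plus)
  moreover have "0 \<le> s powr (1 - p) / p * b + (1 - 1 / p) * J" using b assms J by simp
  ultimately have "J \<le> s powr (1 - p) / p * b + (1 - 1 / p) * J" by (simp add: ennreal_le_iff)
  then have "J \<le> s powr (1 - p) * b" using assms by (simp add: field_simps)
  also have "s powr (1 - p) = J powr (1 - p) * m powr (p - 1)"
  proof -
    have "s powr (1 - p) = J powr (1 - p) / m powr (1 - p)"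
      unfolding s_def using J assms by (simp add: powr_divide)
    then show ?thesis using powr_minus[of m "1 - p"] by (simp add: divide_inverse)
  qed
  finally have "J powr (p - 1) * J \<le> J powr (p - 1) * (J powr (1 - p) * m powr (p - 1) * b)"
    by (intro mult_left_mono) auto
  also have "\<dots> = m powr (p - 1) * b" using J by (simp add: mult.assoc[symmetric] flip: powr_add)
  also have "J powr (p - 1) * J = J powr p" using J powr_add[of J "p - 1" 1] by simp
  finally show ?thesis using b by (simp flip: ennreal_mult)
qed

lemma sigma_finite_disc: "sigma_finite_measure disc"
  by (intro finite_measure.axioms(1) finite_measure_lebesgue_on) auto

text \<open>Jensen's inequality is applied to the measure with density
  \<open>defect w powr (\<alpha> + \<epsilon>) * k z w\<close>, whose mass the first Forelli-Rudin
  estimate bounds. Tonelli then leaves an integral in \<open>z\<close>, to which the second one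
  applies.\<close>

lemma Bergman_type_bound:
  fixes h :: "complex \<Rightarrow> complex" and n :: nat and p \<alpha> :: real
  assumes h: "h \<in> borel_measurable disc" and p: "p \<ge> 1" "p * real n > 1" and \<alpha>: "\<alpha> > -1"
    and fin: "(\<integral>\<^sup>+w. ennreal (cmod (h w) powr p * defect w powr (-2)) \<partial>disc) < \<infinity>"
  defines "J \<equiv> \<lambda>z. \<integral>w. cmod (h w) * defect w powr \<alpha> * cmod (1 - z * cnj w) powr (- (2 + \<alpha> + real n)) \<partial>disc"
  shows "(\<integral>\<^sup>+z. ennreal ((defect z ^ n * J z) powr p * defect z powr (-2)) \<partial>disc) < \<infinity>"
proof -
  have n: "1 \<le> real n" using p by (cases n) auto
  \<comment> \<open>Any value in (0, 1) with \<open>\<epsilon> * (p - 1) < 1\<close> serves: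
    \<epsilon> < 1 keeps \<open>real n - \<epsilon>\<close> positive, the other bound keeps
    \<open>c2\<close> positive.\<close>
  define \<epsilon> where "\<epsilon> = 1 / (p + 1)"
  have \<epsilon>: "0 < \<epsilon>" "\<epsilon> < 1" "\<epsilon> * (p - 1) < 1" using p by (auto simp: \<epsilon>_def field_simps)
  have \<epsilon>p: "0 \<le> \<epsilon> * (p - 1)" using p \<epsilon> by simp
  \<comment> \<open>\<open>t2\<close> is what remains of the exponent \<open>real n * p - 2\<close>
    of \<open>defect z\<close> after the mass bound raised to \<open>p - 1\<close> has contributed
    \<open>- (real n - \<epsilon>) * (p - 1)\<close>. \<open>c2\<close> completes
    \<open>2 + t2 + c2\<close> to the exponent of the kernel, and
    \<open>- c2 + (\<alpha> - \<epsilon> * (p - 1)) = -2\<close> restores the invariant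
    weight.\<close>
  define t2 where "t2 = real n - 2 + \<epsilon> * (p - 1)"
  define c2 where "c2 = \<alpha> + 2 - \<epsilon> * (p - 1)"
  \<comment> \<open>For \<open>n = 1\<close> the margin is just \<open>\<epsilon> * (p - 1)\<close>,
    which is positive because \<open>p * real n > 1\<close> then means \<open>p > 1\<close>.\<close>
  have t2: "t2 > -1"
  proof (cases "n = 1")
    case True
    then have "0 < p - 1" using p by simp
    then have "0 < \<epsilon> * (p - 1)" using \<epsilon> by simp
    then show ?thesis using True by (simp add: t2_def)
  next
    case False
    then have "2 \<le> real n" using n by linarith
    then show ?thesis using \<epsilon>p by (simp add: t2_def)
  qed
  have c2: "c2 > 0" using \<alpha> \<epsilon> by (simp add: c2_def)
  define k where "k z w = cmod (1 - z * cnj w) powr (- (2 + \<alpha> + real n))" for z w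
  \<comment> \<open>Lets the second estimate be used with \<open>z\<close> as the variable of
    integration.\<close>
  have k_sym: "k z w = k w z" for z w
    unfolding k_def by (metis complex_cnj_cnj complex_cnj_diff complex_cnj_mult complex_cnj_one complex_mod_cnj mult.commute)
  obtain C1 where C1: "C1 > 0" "\<And>z. cmod z < 1 \<Longrightarrow>
      (\<integral>\<^sup>+w. ennreal (defect w powr (\<alpha> + \<epsilon>) * k z w) \<partial>disc) \<le> ennreal (C1 * defect z powr (- (real n - \<epsilon>)))"
    using Forelli_Rudin[of "\<alpha> + \<epsilon>" "real n - \<epsilon>"] \<alpha> \<epsilon> n by (auto simp: k_def add_ac)
  obtain C2 where C2: "C2 > 0" "\<And>z. cmod z < 1 \<Longrightarrow>
      (\<integral>\<^sup>+w. ennreal (defect w powr t2 * k z w) \<partial>disc) \<le> ennreal (C2 * defect z powr (- c2))"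
  proof -
    have e: "2 + t2 + c2 = 2 + \<alpha> + real n" by (simp add: t2_def c2_def)
    show ?thesis using Forelli_Rudin[OF t2 c2, unfolded e] that unfolding k_def by blast
  qed
  have wsp: "cmod w < 1" if "w \<in> space disc" for w using that by (simp add: space_restrict_space)
  have dm: "(\<lambda>w. defect w powr \<beta>) \<in> borel_measurable disc" for \<beta>
    by (intro borel_measurable_disc) measurable
  have km: "k z \<in> borel_measurable disc" for z
    unfolding k_def[abs_def] by (intro borel_measurable_disc) measurable
  define B where "B z = (\<integral>\<^sup>+w. ennreal (defect w powr (\<alpha> - \<epsilon> * (p - 1)) * k z w * cmod (h w) powr p) \<partial>disc)" for z
  have hp: "(\<lambda>w. cmod (h w) powr p) \<in> borel_measurable disc"
    by (rule norm_powr_measurable[OF h])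
  have Jensen: "ennreal (J z powr p) \<le> ennreal ((C1 * defect z powr (- (real n - \<epsilon>))) powr (p - 1)) * B z"
    if z: "cmod z < 1" for z
  proof (rule powr_le_of_Young)
    define m where "m = C1 * defect z powr (- (real n - \<epsilon>))"
    show "0 < C1 * defect z powr (- (real n - \<epsilon>))" using C1 defect_pos[OF z] by simp
    show "0 \<le> J z" unfolding J_def by (intro Bochner_Integration.integral_nonneg) simp
    fix s :: real assume s: "0 < s"
    \<comment> \<open>True without integrability as well, since the Bochner integral is then
      0.\<close>
    have J: "ennreal (J z) \<le> (\<integral>\<^sup>+w. ennreal (cmod (h w) * defect w powr \<alpha> * k z w) \<partial>disc)"
      unfolding J_def k_def
      by (cases "integrable disc (\<lambda>w. cmod (h w) * defect w powr \<alpha> * cmod (1 - z * cnj w) powr (- (2 + \<alpha> + real n)))")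
        (auto simp: nn_integral_eq_integral not_integrable_integral_eq)
    also have "\<dots> \<le> (\<integral>\<^sup>+w. ennreal (s powr (1 - p) / p) * ennreal (defect w powr (\<alpha> - \<epsilon> * (p - 1)) * k z w * cmod (h w) powr p)
        + ennreal ((1 - 1 / p) * s) * ennreal (defect w powr (\<alpha> + \<epsilon>) * k z w) \<partial>disc)"
    proof (rule nn_integral_mono)
      fix w assume "w \<in> space disc"
      then have d: "0 < defect w" by (intro defect_pos wsp)
      \<comment> \<open>The factor \<open>defect w powr (- \<epsilon>)\<close> undoes the \<epsilon>
        added to the weight of the measure.\<close>
      define x where "x = cmod (h w) * defect w powr (- \<epsilon>)"
      have "x \<le> s powr (1 - p) / p * x powr p + (1 - 1 / p) * s"
        using s p by (intro Young_scaled) (auto simp: x_def)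
      then have "defect w powr (\<alpha> + \<epsilon>) * k z w * x
          \<le> defect w powr (\<alpha> + \<epsilon>) * k z w * (s powr (1 - p) / p * x powr p + (1 - 1 / p) * s)"
        by (rule mult_left_mono) (simp add: k_def)
      also have "defect w powr (\<alpha> + \<epsilon>) * k z w * x = cmod (h w) * defect w powr \<alpha> * k z w"
      proof -
        have e: "defect w powr (\<alpha> + \<epsilon>) * defect w powr (- \<epsilon>) = defect w powr \<alpha>" by (simp flip: powr_add)
        have "defect w powr (\<alpha> + \<epsilon>) * k z w * x
            = cmod (h w) * (defect w powr (\<alpha> + \<epsilon>) * defect w powr (- \<epsilon>)) * k z w"
          unfolding x_def by (simp only: mult_ac)
        then show ?thesis unfolding e .
      qed
      also have "defect w powr (\<alpha> + \<epsilon>) * k z w * (s powr (1 - p) / p * x powr p + (1 - 1 / p) * s)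
          = s powr (1 - p) / p * ((defect w powr (\<alpha> + \<epsilon>) * (defect w powr (- \<epsilon>)) powr p) * k z w * cmod (h w) powr p)
            + (1 - 1 / p) * s * (defect w powr (\<alpha> + \<epsilon>) * k z w)"
      proof -
        have "x powr p = cmod (h w) powr p * (defect w powr (- \<epsilon>)) powr p"
          unfolding x_def by (simp only: powr_mult norm_ge_zero powr_ge_zero)
        then show ?thesis by (simp only: distrib_left mult_ac)
      qed
      also have "defect w powr (\<alpha> + \<epsilon>) * (defect w powr (- \<epsilon>)) powr p = defect w powr (\<alpha> - \<epsilon> * (p - 1))"
        unfolding powr_powr powr_add[symmetric]
        by (rule arg_cong[where f="\<lambda>e. _ powr e"]) (simp add: algebra_simps)
      finally show "ennreal (cmod (h w) * defect w powr \<alpha> * k z w)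
        \<le> ennreal (s powr (1 - p) / p) * ennreal (defect w powr (\<alpha> - \<epsilon> * (p - 1)) * k z w * cmod (h w) powr p)
          + ennreal ((1 - 1 / p) * s) * ennreal (defect w powr (\<alpha> + \<epsilon>) * k z w)"
        using s p by (simp add: k_def flip: ennreal_mult ennreal_plus)
    qed
    also have "\<dots> = ennreal (s powr (1 - p) / p) * B z
        + ennreal ((1 - 1 / p) * s) * (\<integral>\<^sup>+w. ennreal (defect w powr (\<alpha> + \<epsilon>) * k z w) \<partial>disc)"
    proof -
      have m1: "(\<lambda>w. ennreal (defect w powr (\<alpha> - \<epsilon> * (p - 1)) * k z w * cmod (h w) powr p)) \<in> borel_measurable disc"
        by (intro borel_measurable_times measurable_compose[OF _ measurable_ennreal] dm km hp)
      have m2: "(\<lambda>w. ennreal (defect w powr (\<alpha> + \<epsilon>) * k z w)) \<in> borel_measurable disc"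
        by (intro borel_measurable_times measurable_compose[OF _ measurable_ennreal] dm km)
      show ?thesis
        unfolding B_def nn_integral_cmult[OF m1, symmetric] nn_integral_cmult[OF m2, symmetric]
        by (intro nn_integral_add borel_measurable_times_ennreal borel_measurable_const m1 m2)
    qed
    also have "\<dots> \<le> ennreal (s powr (1 - p) / p) * B z + ennreal ((1 - 1 / p) * s) * ennreal m"
      unfolding m_def by (rule add_left_mono[OF mult_left_mono[OF C1(2)[OF z]]]) simp
    also have "ennreal ((1 - 1 / p) * s) * ennreal m = ennreal ((1 - 1 / p) * (s * m))"
      using s p C1 by (simp add: mult.assoc m_def flip: ennreal_mult)
    finally show "ennreal (J z) \<le> ennreal (s powr (1 - p) / p) * B z
        + ennreal ((1 - 1 / p) * (s * (C1 * defect z powr (- (real n - \<epsilon>)))))"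
      by (simp add: m_def)
  qed (use p in auto)
  define K where "K = C1 powr (p - 1)"
  define g where "g z w = ennreal (defect z powr t2 * k z w) * ennreal (defect w powr (\<alpha> - \<epsilon> * (p - 1)) * cmod (h w) powr p)" for z w
  have gm: "case_prod g \<in> borel_measurable (disc \<Otimes>\<^sub>M disc)"
  proof -
    \<comment> \<open>The kernel is jointly measurable for the Borel sets of the plane; the identity
      carries this over to the product of the completed measures.\<close>
    have id: "(\<lambda>q. q) \<in> disc \<Otimes>\<^sub>M disc \<rightarrow>\<^sub>M borel \<Otimes>\<^sub>M borel"
      by (intro measurable_pair) (auto simp: comp_def intro!: measurable_compose[OF measurable_fst]
          measurable_compose[OF measurable_snd] borel_measurable_disc)
    have "(\<lambda>q. defect (fst q) powr t2 * k (fst q) (snd q)) \<in> borel_measurable (borel \<Otimes>\<^sub>M borel)"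
      unfolding k_def by measurable
    from measurable_compose[OF id this]
    have "(\<lambda>q. defect (fst q) powr t2 * k (fst q) (snd q)) \<in> borel_measurable (disc \<Otimes>\<^sub>M disc)" .
    moreover have "(\<lambda>q. defect (snd q) powr (\<alpha> - \<epsilon> * (p - 1)) * cmod (h (snd q)) powr p)
        \<in> borel_measurable (disc \<Otimes>\<^sub>M disc)"
      by (intro measurable_compose[OF measurable_snd] borel_measurable_times dm hp)
    ultimately show ?thesis
      unfolding g_def split_beta' by (intro borel_measurable_times_ennreal measurable_compose[OF _ measurable_ennreal])
  qed
  have "(\<integral>\<^sup>+z. ennreal ((defect z ^ n * J z) powr p * defect z powr (-2)) \<partial>disc)
      \<le> (\<integral>\<^sup>+z. ennreal K * (\<integral>\<^sup>+w. g z w \<partial>disc) \<partial>disc)"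
  proof (rule nn_integral_mono)
    fix z assume "z \<in> space disc"
    then have z: "cmod z < 1" by (rule wsp)
    then have d: "0 < defect z" by (rule defect_pos)
    have J0: "0 \<le> J z" unfolding J_def by (intro Bochner_Integration.integral_nonneg) simp
    have "(defect z ^ n * J z) powr p * defect z powr (-2) = (defect z powr (real n * p) * defect z powr (-2)) * J z powr p"
    proof -
      have "(defect z ^ n * J z) powr p = (defect z powr real n * J z) powr p"
        by (simp only: powr_realpow[OF d])
      also have "\<dots> = defect z powr (real n * p) * J z powr p"
        using J0 by (simp only: powr_mult powr_ge_zero powr_powr)
      finally show ?thesis by (simp only: mult_ac)
    qed
    also have "defect z powr (real n * p) * defect z powr (-2) = defect z powr (real n * p - 2)"
      by (simp flip: powr_add)
    finally have "ennreal ((defect z ^ n * J z) powr p * defect z powr (-2))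
        = ennreal (defect z powr (real n * p - 2)) * ennreal (J z powr p)"
      by (simp add: ennreal_mult)
    also have "\<dots> \<le> ennreal (defect z powr (real n * p - 2)) * (ennreal ((C1 * defect z powr (- (real n - \<epsilon>))) powr (p - 1)) * B z)"
      by (rule mult_left_mono[OF Jensen[OF z]]) simp
    also have "\<dots> = ennreal (defect z powr (real n * p - 2) * (C1 * defect z powr (- (real n - \<epsilon>))) powr (p - 1)) * B z"
      by (simp add: ennreal_mult mult.assoc)
    also have "defect z powr (real n * p - 2) * (C1 * defect z powr (- (real n - \<epsilon>))) powr (p - 1)
        = K * (defect z powr (real n * p - 2) * defect z powr (- (real n - \<epsilon>) * (p - 1)))"
    proof -
      have "(C1 * defect z powr (- (real n - \<epsilon>))) powr (p - 1) = K * defect z powr (- (real n - \<epsilon>) * (p - 1))"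
        using C1 by (simp only: K_def powr_mult less_imp_le powr_ge_zero powr_powr)
      then show ?thesis by (simp only: mult_ac)
    qed
    also have "defect z powr (real n * p - 2) * defect z powr (- (real n - \<epsilon>) * (p - 1)) = defect z powr t2"
      unfolding powr_add[symmetric] by (rule arg_cong[where f="\<lambda>e. _ powr e"]) (simp add: t2_def algebra_simps)
    also have "ennreal (K * defect z powr t2) * B z = ennreal K * (ennreal (defect z powr t2) * B z)"
      by (simp add: ennreal_mult K_def mult.assoc)
    also have "ennreal (defect z powr t2) * B z = (\<integral>\<^sup>+w. g z w \<partial>disc)"
      unfolding B_def
      by (subst nn_integral_cmult[symmetric], intro borel_measurable_times measurable_compose[OF _ measurable_ennreal] dm km hp)
        (intro nn_integral_cong, simp add: g_def k_def mult_ac flip: ennreal_mult)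
    finally show "ennreal ((defect z ^ n * J z) powr p * defect z powr (-2)) \<le> ennreal K * (\<integral>\<^sup>+w. g z w \<partial>disc)" .
  qed
  also have "\<dots> = ennreal K * (\<integral>\<^sup>+z. \<integral>\<^sup>+w. g z w \<partial>disc \<partial>disc)"
    by (intro nn_integral_cmult sigma_finite_measure.borel_measurable_nn_integral[OF sigma_finite_disc] gm)
  finally have A: "(\<integral>\<^sup>+z. ennreal ((defect z ^ n * J z) powr p * defect z powr (-2)) \<partial>disc)
      \<le> ennreal K * (\<integral>\<^sup>+z. \<integral>\<^sup>+w. g z w \<partial>disc \<partial>disc)" .
  have "(\<integral>\<^sup>+z. \<integral>\<^sup>+w. g z w \<partial>disc \<partial>disc) = (\<integral>\<^sup>+w. \<integral>\<^sup>+z. g z w \<partial>disc \<partial>disc)"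
    by (intro pair_sigma_finite.Fubini'[symmetric] gm pair_sigma_finite.intro sigma_finite_disc)
  also have "\<dots> \<le> (\<integral>\<^sup>+w. ennreal C2 * ennreal (cmod (h w) powr p * defect w powr (-2)) \<partial>disc)"
  proof (rule nn_integral_mono)
    fix w assume "w \<in> space disc"
    then have w: "cmod w < 1" by (rule wsp)
    let ?a = "ennreal (defect w powr (\<alpha> - \<epsilon> * (p - 1)) * cmod (h w) powr p)"
    have "(\<integral>\<^sup>+z. g z w \<partial>disc) = (\<integral>\<^sup>+z. ennreal (defect z powr t2 * k w z) \<partial>disc) * ?a"
      unfolding g_def k_sym[of _ w]
      by (intro nn_integral_multc borel_measurable_times measurable_compose[OF _ measurable_ennreal] dm km)
    also have "\<dots> \<le> ennreal (C2 * defect w powr (- c2)) * ?a"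
      by (rule mult_right_mono[OF C2(2)[OF w]]) simp
    also have "\<dots> = ennreal (C2 * (cmod (h w) powr p * (defect w powr (- c2) * defect w powr (\<alpha> - \<epsilon> * (p - 1)))))"
      using C2 by (simp add: mult_ac flip: ennreal_mult)
    also have "defect w powr (- c2) * defect w powr (\<alpha> - \<epsilon> * (p - 1)) = defect w powr (-2)"
      unfolding powr_add[symmetric] by (rule arg_cong[where f="\<lambda>e. _ powr e"]) (simp add: c2_def)
    also have "ennreal (C2 * (cmod (h w) powr p * defect w powr (-2)))
        = ennreal C2 * ennreal (cmod (h w) powr p * defect w powr (-2))"
      using C2 by (simp add: ennreal_mult)
    finally show "(\<integral>\<^sup>+z. g z w \<partial>disc) \<le> ennreal C2 * ennreal (cmod (h w) powr p * defect w powr (-2))" .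
  qed
  also have "\<dots> = ennreal C2 * (\<integral>\<^sup>+w. ennreal (cmod (h w) powr p * defect w powr (-2)) \<partial>disc)"
    by (intro nn_integral_cmult borel_measurable_times measurable_compose[OF _ measurable_ennreal] dm hp)
  finally have S: "(\<integral>\<^sup>+z. \<integral>\<^sup>+w. g z w \<partial>disc \<partial>disc)
      \<le> ennreal C2 * (\<integral>\<^sup>+w. ennreal (cmod (h w) powr p * defect w powr (-2)) \<partial>disc)" .
  have "(\<integral>\<^sup>+z. ennreal ((defect z ^ n * J z) powr p * defect z powr (-2)) \<partial>disc)
      \<le> ennreal K * (ennreal C2 * (\<integral>\<^sup>+w. ennreal (cmod (h w) powr p * defect w powr (-2)) \<partial>disc))"
  proof -
    note A
    also have "ennreal K * (\<integral>\<^sup>+z. \<integral>\<^sup>+w. g z w \<partial>disc \<partial>disc)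
        \<le> ennreal K * (ennreal C2 * (\<integral>\<^sup>+w. ennreal (cmod (h w) powr p * defect w powr (-2)) \<partial>disc))"
      using S by (rule mult_left_mono) simp
    finally show ?thesis .
  qed
  also have "\<dots> < \<infinity>" using fin by (simp add: ennreal_mult_less_top)
  finally show ?thesis .
qed

section \<open>Holomorphic Besov functions as Bergman integrals\<close>

lemma powr_add_le:
  fixes x y p :: real
  assumes "0 \<le> x" "0 \<le> y" "0 \<le> p"
  shows "(x + y) powr p \<le> 2 powr p * (x powr p + y powr p)"
proof -
  have "(x + y) powr p \<le> (2 * max x y) powr p" using assms by (intro powr_mono2) auto
  also have "\<dots> = 2 powr p * max x y powr p" using assms by (simp add: powr_mult)
  also have "max x y powr p \<le> x powr p + y powr p" by (auto simp: max_def)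
  finally show ?thesis by (simp add: mult_left_mono)
qed

text \<open>The p-th power is subadditive up to the factor \<open>2 powr p\<close>; with
  \<open>B = 0\<close> this is plain domination. It moves finiteness between a quaternionic function
  and its two complex components.\<close>

lemma nn_integral_powr_finite:
  fixes f u v \<rho> :: "'a \<Rightarrow> real"
  assumes "0 \<le> p" "0 \<le> A" "0 \<le> B"
    and nonneg: "\<And>x. 0 \<le> f x" "\<And>x. 0 \<le> u x" "\<And>x. 0 \<le> v x" "\<And>x. 0 \<le> \<rho> x"
    and m: "(\<lambda>x. u x powr p * \<rho> x) \<in> borel_measurable M" "(\<lambda>x. v x powr p * \<rho> x) \<in> borel_measurable M"
    and le: "\<And>x. x \<in> space M \<Longrightarrow> f x \<le> A * u x + B * v x"
    and fin: "(\<integral>\<^sup>+x. ennreal (u x powr p * \<rho> x) \<partial>M) < \<infinity>" "(\<integral>\<^sup>+x. ennreal (v x powr p * \<rho> x) \<partial>M) < \<infinity>"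
  shows "(\<integral>\<^sup>+x. ennreal (f x powr p * \<rho> x) \<partial>M) < \<infinity>"
proof -
  define CA CB where "CA = 2 powr p * A powr p" and "CB = 2 powr p * B powr p"
  have C0: "0 \<le> CA" "0 \<le> CB" by (simp_all add: CA_def CB_def)
  have m': "(\<lambda>x. ennreal (u x powr p * \<rho> x)) \<in> borel_measurable M" "(\<lambda>x. ennreal (v x powr p * \<rho> x)) \<in> borel_measurable M"
    using m by (auto intro: measurable_compose[OF _ measurable_ennreal])
  have "(\<integral>\<^sup>+x. ennreal (f x powr p * \<rho> x) \<partial>M)
      \<le> (\<integral>\<^sup>+x. ennreal CA * ennreal (u x powr p * \<rho> x) + ennreal CB * ennreal (v x powr p * \<rho> x) \<partial>M)"
  proof (rule nn_integral_mono)
    fix x assume "x \<in> space M"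
    then have "f x powr p \<le> (A * u x + B * v x) powr p"
      using assms by (intro powr_mono2 le) auto
    also have "\<dots> \<le> 2 powr p * ((A * u x) powr p + (B * v x) powr p)"
      using assms by (intro powr_add_le) auto
    also have "\<dots> = CA * u x powr p + CB * v x powr p"
      using assms by (simp add: CA_def CB_def powr_mult distrib_left mult_ac)
    finally have "f x powr p * \<rho> x \<le> (CA * u x powr p + CB * v x powr p) * \<rho> x"
      using nonneg by (intro mult_right_mono) auto
    also have "\<dots> = CA * (u x powr p * \<rho> x) + CB * (v x powr p * \<rho> x)"
      by (simp only: distrib_right mult.assoc)
    finally show "ennreal (f x powr p * \<rho> x)
        \<le> ennreal CA * ennreal (u x powr p * \<rho> x) + ennreal CB * ennreal (v x powr p * \<rho> x)"
      using C0 nonneg by (simp flip: ennreal_mult ennreal_plus)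
  qed
  also have "\<dots> = ennreal CA * (\<integral>\<^sup>+x. ennreal (u x powr p * \<rho> x) \<partial>M)
      + ennreal CB * (\<integral>\<^sup>+x. ennreal (v x powr p * \<rho> x) \<partial>M)"
    unfolding nn_integral_cmult[OF m'(1), symmetric] nn_integral_cmult[OF m'(2), symmetric]
    by (intro nn_integral_add borel_measurable_times_ennreal borel_measurable_const m')
  also have "\<dots> < \<infinity>" using fin by (simp add: ennreal_mult_less_top)
  finally show ?thesis .
qed

lemma continuous_bounded_cball:
  fixes g :: "complex \<Rightarrow> complex"
  assumes "continuous_on (cball 0 r) g"
  obtains B where "0 \<le> B" "\<And>w. cmod w \<le> r \<Longrightarrow> cmod (g w) \<le> B"
proof -
  have "bounded (g ` cball 0 r)"
    by (intro compact_imp_bounded compact_continuous_image assms compact_cball)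
  then obtain B where "\<forall>x\<in>g ` cball 0 r. cmod x \<le> B" unfolding bounded_iff by blast
  then have "cmod (g w) \<le> max 0 B" if "cmod w \<le> r" for w using that by force
  then show ?thesis using that[of "max 0 B"] by auto
qed

text \<open>The tail, divided by \<open>w ^ n\<close>, is again a convergent power series; its
  continuity will bound the density near the origin.\<close>

lemma power_series_shift_sums:
  fixes c :: "nat \<Rightarrow> complex"
  assumes "\<And>w. cmod w < 1 \<Longrightarrow> (\<lambda>k. c k * w ^ k) sums G w"
  obtains g where "\<And>w. cmod w < 1 \<Longrightarrow> G w - (\<Sum>k<n. c k * w ^ k) = w ^ n * g w"
    and "continuous_on (ball 0 1) g"
proof -
  define g where "g w = (\<Sum>k. c (k + n) * w ^ k)" for w
  have tail: "(\<lambda>k. c (k + n) * w ^ (k + n)) sums (G w - (\<Sum>k<n. c k * w ^ k))" if "cmod w < 1" for w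
    using assms[OF that] by (simp only: sums_iff_shift[of "\<lambda>k. c k * w ^ k" n] diff_add_cancel)
  have g: "(\<lambda>k. c (k + n) * w ^ k) sums g w" if "cmod w < 1" for w
  proof (cases "w = 0")
    case True
    \<comment> \<open>At 0 no division is possible, but there only the constant term of the shifted
      series survives.\<close>
    then show ?thesis unfolding g_def
      by (intro summable_sums summable_finite[of "{0}"]) auto
  next
    case False
    have "(\<lambda>k. c (k + n) * w ^ (k + n) * inverse (w ^ n)) sums ((G w - (\<Sum>k<n. c k * w ^ k)) * inverse (w ^ n))"
      by (intro sums_mult2 tail that)
    moreover have "c (k + n) * w ^ (k + n) * inverse (w ^ n) = c (k + n) * w ^ k" for k
      using False by (simp add: power_add)
    ultimately show ?thesis unfolding g_def by (simp add: sums_iff)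
  qed
  have "G w - (\<Sum>k<n. c k * w ^ k) = w ^ n * g w" if "cmod w < 1" for w
  proof -
    have "(\<lambda>k. w ^ n * (c (k + n) * w ^ k)) sums (w ^ n * g w)" by (intro sums_mult g that)
    moreover have "w ^ n * (c (k + n) * w ^ k) = c (k + n) * w ^ (k + n)" for k
      by (simp add: power_add mult_ac)
    ultimately show ?thesis using tail[OF that] by (simp add: sums_unique2)
  qed
  moreover have "g holomorphic_on ball 0 1"
    by (rule power_series_holomorphic[where a="\<lambda>k. c (k + n)"]) (simp add: g)
  ultimately show ?thesis using that holomorphic_on_imp_continuous_on by blast
qed

lemma integrable_mult_bounded_disc:
  fixes f :: "complex \<Rightarrow> complex"
  assumes "f \<in> borel_measurable disc" "\<beta> > -1" "\<And>w. cmod w < 1 \<Longrightarrow> cmod (f w) \<le> B"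
  shows "integrable disc (\<lambda>w. f w * of_real (defect w powr \<beta>))"
proof (rule Bochner_Integration.integrable_bound)
  show "integrable disc (\<lambda>w. B * defect w powr \<beta>)"
    by (intro integrable_mult_right integrable_defect_powr assms)
  show "(\<lambda>w. f w * of_real (defect w powr \<beta>)) \<in> borel_measurable disc"
    by (intro borel_measurable_times assms borel_measurable_disc) measurable
  have "cmod (f w) * defect w powr \<beta> \<le> \<bar>B\<bar> * defect w powr \<beta>" if "w \<in> space disc" for w
    using assms(3)[of w] that by (intro mult_right_mono) (auto simp: space_restrict_space)
  then show "AE w in disc. cmod (f w * of_real (defect w powr \<beta>)) \<le> norm (B * defect w powr \<beta>)"
    by (intro AE_I2) (simp add: norm_mult abs_mult)
qed

text \<open>Away from the origin the density is \<open>\<kappa> (1 - |w|\<^sup>2)\<^sup>n F\<^sup>(\<^sup>n\<^sup>)(w) / w\<^sup>*\<^sup>n\<close>, whose kernel integral has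
  the Taylor coefficients of \<open>F\<close> from order \<open>n\<close> on. Removing the first \<open>n\<close> Taylor terms of
  \<open>F\<^sup>(\<^sup>n\<^sup>)\<close> makes it bounded at the origin and only spoils the coefficients of order below \<open>2 n\<close>,
  which are repaired by a polynomial times \<open>(1 - |w|\<^sup>2)\<^sup>n\<close>.\<close>

lemma Bergman_representation:
  fixes F :: "complex \<Rightarrow> complex" and n :: nat and p \<alpha> :: real
  assumes F: "F holomorphic_on ball 0 1" and p: "p \<ge> 1" "p * real n > 1" and \<alpha>: "\<alpha> > -1"
    and fin: "(\<integral>\<^sup>+w. ennreal ((defect w ^ n * cmod ((deriv ^^ n) F w)) powr p * defect w powr (-2)) \<partial>disc) < \<infinity>"
  obtains h where "h \<in> borel_measurable disc"
    and "(\<integral>\<^sup>+w. ennreal (cmod (h w) powr p * defect w powr (-2)) \<partial>disc) < \<infinity>"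
    and "\<And>z. cmod z < 1 \<Longrightarrow> F z = (\<integral>w. h w * of_real ((\<alpha> + 1) / pi * defect w powr \<alpha>)
      * (1 - z * cnj w) powr (- of_real (2 + \<alpha>)) \<partial>disc)"
proof -
  have wsp: "cmod w < 1" if "w \<in> space disc" for w using that by (simp add: space_restrict_space)
  define a where "a k = (deriv ^^ k) F 0 / fact k" for k
  define G where "G = (deriv ^^ n) F"
  define c where "c k = a (k + n) * (fact (k + n) / fact k)" for k
  have F_sums: "(\<lambda>k. a k * w ^ k) sums F w" if "cmod w < 1" for w
    using holomorphic_power_series[OF F, of w] that by (simp add: a_def)
  have G_hol: "G holomorphic_on ball 0 1"
    unfolding G_def by (intro holomorphic_higher_deriv F) auto
  have G_sums: "(\<lambda>k. c k * w ^ k) sums G w" if "cmod w < 1" for w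
    using holomorphic_power_series[OF G_hol, of w] that
    by (simp add: a_def c_def G_def flip: funpow_add[THEN fun_cong, unfolded o_apply])
  obtain g where g: "\<And>w. cmod w < 1 \<Longrightarrow> G w - (\<Sum>k<n. c k * w ^ k) = w ^ n * g w"
    and g_cont: "continuous_on (ball 0 1) g"
    using power_series_shift_sums[of c G n] G_sums by blast
  define T where "T w = (\<Sum>k<n. c k * w ^ k)" for w
  define H where "H w = G w - T w" for w
  have H_sums: "(\<lambda>k. (if k < n then 0 else c k) * w ^ k) sums H w" if "cmod w < 1" for w
  proof -
    have "(\<lambda>k. if k \<in> {..<n} then c k * w ^ k else 0) sums T w"
      unfolding T_def by (rule sums_If_finite_set) simp
    from sums_diff[OF G_sums[OF that] this] show ?thesis
      by (auto simp: H_def if_distrib cong: if_cong elim!: back_subst[where P="\<lambda>f. f sums _"])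
  qed
  define Q where "Q w = H w / cnj w ^ n" for w
  obtain BT where BT: "0 \<le> BT" "\<And>w. cmod w \<le> 1 \<Longrightarrow> cmod (T w) \<le> BT"
    by (rule continuous_bounded_cball[of 1 T]) (auto simp: T_def intro!: continuous_intros)
  obtain Bg where Bg: "0 \<le> Bg" "\<And>w. cmod w \<le> 1 / 2 \<Longrightarrow> cmod (g w) \<le> Bg"
    by (rule continuous_bounded_cball[of "1 / 2" g]) (auto intro: continuous_on_subset[OF g_cont])
  \<comment> \<open>For |w| at most 1/2, \<open>g\<close> bounds \<open>Q\<close>, because
    \<open>w ^ n / cnj w ^ n\<close> has modulus at most 1, also at the origin, where division by
    zero gives 0. For larger |w| the division costs at most a factor \<open>2 ^ n\<close>.\<close>
  have Q_le: "cmod (Q w) \<le> 2 ^ n * cmod (G w) + (2 ^ n * BT + Bg)" if "cmod w < 1" for w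
  proof (cases "cmod w \<le> 1 / 2")
    case True
    have "cmod (Q w) \<le> cmod (g w)"
      using g[OF that] by (simp add: Q_def H_def T_def norm_mult norm_divide norm_power divide_le_eq_1)
    moreover have "0 \<le> 2 ^ n * cmod (G w)" "0 \<le> 2 ^ n * BT" using BT by auto
    ultimately show ?thesis using Bg(2)[OF True] by linarith
  next
    case False
    then have "(1 / 2) ^ n \<le> cmod w ^ n" by (intro power_mono) auto
    then have "cmod (H w) / cmod w ^ n \<le> cmod (H w) / (1 / 2) ^ n"
      using False by (intro divide_left_mono mult_pos_pos zero_less_power) auto
    also have "\<dots> = 2 ^ n * cmod (H w)" by (simp add: power_one_over)
    also have "\<dots> \<le> 2 ^ n * (cmod (G w) + BT)"
      using BT(2)[of w] that norm_triangle_ineq4[of "G w" "T w"] by (intro mult_left_mono) (auto simp: H_def)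
    finally show ?thesis using Bg by (simp add: Q_def norm_divide norm_power distrib_left)
  qed
  have G_meas: "G \<in> borel_measurable disc"
    by (intro borel_measurable_disc_continuous holomorphic_on_imp_continuous_on G_hol)
  have T_meas: "T \<in> borel_measurable disc"
    unfolding T_def by (intro borel_measurable_disc) measurable
  have H_meas: "H \<in> borel_measurable disc"
    unfolding H_def by (intro borel_measurable_diff G_meas T_meas)
  have Q_meas: "Q \<in> borel_measurable disc"
    unfolding Q_def by (intro borel_measurable_divide H_meas borel_measurable_disc) measurable
  have \<alpha>n: "\<alpha> + real n > -1" using \<alpha> by simp
  have G_int: "integrable disc (\<lambda>w. G w * of_real (defect w powr (\<alpha> + real n)))"
  proof -
    \<comment> \<open>The Besov bound says that \<open>defect w ^ n * G w\<close> lies in the L^p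
      space of the invariant measure, which is contained in the weighted L^1 space.\<close>
    have "integrable disc (\<lambda>w. (of_real (defect w ^ n) * G w) * of_real (defect w powr \<alpha>))"
    proof (rule integrable_disc_of_Lp[OF _ p(1) \<alpha>])
      show "(\<lambda>w. of_real (defect w ^ n) * G w) \<in> borel_measurable disc"
        by (intro borel_measurable_times G_meas borel_measurable_disc) measurable
      have "(\<integral>\<^sup>+w. ennreal (cmod (of_real (defect w ^ n) * G w) powr p * defect w powr (-2)) \<partial>disc)
          = (\<integral>\<^sup>+w. ennreal ((defect w ^ n * cmod ((deriv ^^ n) F w)) powr p * defect w powr (-2)) \<partial>disc)"
      proof (rule nn_integral_cong)
        fix w assume "w \<in> space disc"
        then have "0 < defect w" by (intro defect_pos wsp)
        then have "cmod (of_real (defect w ^ n) * G w) = defect w ^ n * cmod ((deriv ^^ n) F w)"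
          unfolding norm_mult norm_of_real G_def by simp
        then show "ennreal (cmod (of_real (defect w ^ n) * G w) powr p * defect w powr (-2))
            = ennreal ((defect w ^ n * cmod ((deriv ^^ n) F w)) powr p * defect w powr (-2))" by simp
      qed
      with fin show "(\<integral>\<^sup>+w. ennreal (cmod (of_real (defect w ^ n) * G w) powr p * defect w powr (-2)) \<partial>disc) < \<infinity>"
        by simp
    qed
    moreover have "(of_real (defect w ^ n) * G w) * of_real (defect w powr \<alpha>)
        = G w * of_real (defect w powr (\<alpha> + real n))" if "w \<in> space disc" for w
      using powr_realpow[of "defect w" n] defect_pos[OF wsp[OF that]] by (simp add: powr_add)
    ultimately show ?thesis
      by (subst Bochner_Integration.integrable_cong[OF refl, symmetric])
  qed
  have H_int: "integrable disc (\<lambda>w. H w * of_real (defect w powr (\<alpha> + real n)))"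
    unfolding H_def left_diff_distrib
    by (intro Bochner_Integration.integrable_diff G_int integrable_mult_bounded_disc[where B=BT] T_meas \<alpha>n BT)
      simp
  have Q_int: "integrable disc (\<lambda>w. Q w * of_real (defect w powr (\<alpha> + real n)))"
  proof (rule Bochner_Integration.integrable_bound)
    show "integrable disc (\<lambda>w. 2 ^ n * cmod (G w * of_real (defect w powr (\<alpha> + real n)))
        + (2 ^ n * BT + Bg) * defect w powr (\<alpha> + real n))"
      by (intro Bochner_Integration.integrable_add integrable_mult_right integrable_norm G_int integrable_defect_powr \<alpha>n)
    show "(\<lambda>w. Q w * of_real (defect w powr (\<alpha> + real n))) \<in> borel_measurable disc"
      by (intro borel_measurable_times Q_meas borel_measurable_disc) measurable
    show "AE w in disc. cmod (Q w * of_real (defect w powr (\<alpha> + real n)))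
        \<le> norm (2 ^ n * cmod (G w * of_real (defect w powr (\<alpha> + real n))) + (2 ^ n * BT + Bg) * defect w powr (\<alpha> + real n))"
    proof (rule AE_I2)
      fix w assume w: "w \<in> space disc"
      have "cmod (Q w) * defect w powr (\<alpha> + real n)
          \<le> (2 ^ n * cmod (G w) + (2 ^ n * BT + Bg)) * defect w powr (\<alpha> + real n)"
        by (intro mult_right_mono Q_le wsp w) simp
      then show "cmod (Q w * of_real (defect w powr (\<alpha> + real n)))
        \<le> norm (2 ^ n * cmod (G w * of_real (defect w powr (\<alpha> + real n))) + (2 ^ n * BT + Bg) * defect w powr (\<alpha> + real n))"
        using BT(1) Bg(1) by (simp add: norm_mult distrib_right mult.assoc)
    qed
  qed
  define I where "I k = (\<integral>w. cnj w ^ k * (Q w * of_real (defect w powr (\<alpha> + real n))) \<partial>disc)" for k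
  define b where "b k = complex_of_real (pi * Beta (real k + 1) (\<alpha> + real n + 1))" for k
  have b0: "b k \<noteq> 0" for k
    using Beta_pos[of "real k + 1" "\<alpha> + real n + 1"] \<alpha> by (simp add: b_def)
  \<comment> \<open>\<open>cnj w ^ n\<close> cancels the denominator of \<open>Q\<close> off the
    null set {0}; what is left is the moment of \<open>H\<close> of order \<open>k - n\<close>,
    hence a single Taylor coefficient of \<open>H\<close>.\<close>
  have I_ge: "I k = (if k - n < n then 0 else c (k - n)) * b (k - n)" if "n \<le> k" for k
  proof -
    have "I k = (\<integral>w. cnj w ^ (k - n) * H w * of_real (defect w powr (\<alpha> + real n)) \<partial>disc)"
      unfolding I_def
    proof (rule integral_cong_AE)
      have "AE w in lebesgue. w \<noteq> (0 :: complex)"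
        by (intro AE_I'[of "{0}"]) auto
      then have "AE w in disc. w \<noteq> 0"
        by (subst AE_restrict_space_iff) auto
      then show "AE w in disc. cnj w ^ k * (Q w * of_real (defect w powr (\<alpha> + real n)))
          = cnj w ^ (k - n) * H w * of_real (defect w powr (\<alpha> + real n))"
      proof eventually_elim
        case (elim w)
        have "cnj w ^ k = cnj w ^ (k - n) * cnj w ^ n" using that by (simp flip: power_add)
        then show ?case using elim by (simp add: Q_def)
      qed
    qed (intro borel_measurable_times Q_meas H_meas borel_measurable_disc, measurable)+
    also have "\<dots> = (if k - n < n then 0 else c (k - n)) * b (k - n)"
      using integral_disc_cnj_power[OF \<alpha>n H_sums H_int, of "k - n"] by (simp add: b_def add_ac)
    finally show ?thesis .
  qed
  define P where "P k = pochhammer (2 + \<alpha>) k" for k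
  have P0: "0 < P k" for k using \<alpha> by (simp add: P_def pochhammer_pos)
  \<comment> \<open>Fixed by the orders \<open>k \<ge> 2 * n\<close>, which \<open>D\<close> does
    not touch: there \<open>P k = P n * pochhammer (\<alpha> + real n + 2) (k - n)\<close>, and the
    Beta value in \<open>b (k - n)\<close> cancels everything except the factor
    \<open>1 / \<kappa>\<close>.\<close>
  define \<kappa> where "\<kappa> = (\<alpha> + real n + 1) / ((\<alpha> + 1) * P n)"
  define C0 where "C0 = (\<alpha> + 1) / pi"
  have C0: "C0 > 0" using \<alpha> by (simp add: C0_def)
  \<comment> \<open>For \<open>k < 2 * n\<close> this solves the equation that the coefficient of
    order \<open>k\<close> be \<open>a k\<close>, whatever the moment \<open>I k\<close> happens to
    be; \<open>b k\<close> is nonzero.\<close>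
  define d where "d k = (a k * of_real (fact k / (P k * C0)) - of_real \<kappa> * I k) / b k" for k
  define D where "D w = (\<Sum>k<2 * n. d k * w ^ k)" for w
  have D_sums: "(\<lambda>k. (if k < 2 * n then d k else 0) * w ^ k) sums D w" for w
  proof -
    have "(\<lambda>k. if k \<in> {..<2 * n} then d k * w ^ k else 0) sums D w"
      unfolding D_def by (rule sums_If_finite_set) simp
    then show ?thesis
      by (auto simp: if_distrib cong: if_cong elim!: back_subst[where P="\<lambda>f. f sums _"])
  qed
  have D_meas: "D \<in> borel_measurable disc"
    unfolding D_def by (intro borel_measurable_disc) measurable
  obtain BD where BD: "0 \<le> BD" "\<And>w. cmod w \<le> 1 \<Longrightarrow> cmod (D w) \<le> BD"
    by (rule continuous_bounded_cball[of 1 D]) (auto simp: D_def intro!: continuous_intros)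
  have D_int: "integrable disc (\<lambda>w. D w * of_real (defect w powr (\<alpha> + real n)))"
    by (intro integrable_mult_bounded_disc[where B=BD] D_meas \<alpha>n BD) simp
  define h where "h w = of_real (defect w ^ n) * (of_real \<kappa> * Q w + D w)" for w
  define \<phi> where "\<phi> w = h w * of_real (C0 * defect w powr \<alpha>)" for w
  have \<phi>_eq: "\<phi> w = of_real (C0 * \<kappa>) * (Q w * of_real (defect w powr (\<alpha> + real n)))
      + of_real C0 * (D w * of_real (defect w powr (\<alpha> + real n)))" if "w \<in> space disc" for w
    using powr_realpow[of "defect w" n] defect_pos[OF wsp[OF that]]
    by (simp add: \<phi>_def h_def powr_add algebra_simps)
  have \<phi>_int: "integrable disc \<phi>"
  proof -
    have "integrable disc (\<lambda>w. of_real (C0 * \<kappa>) * (Q w * of_real (defect w powr (\<alpha> + real n)))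
      + of_real C0 * (D w * of_real (defect w powr (\<alpha> + real n))))"
      by (intro Bochner_Integration.integrable_add integrable_mult_right Q_int D_int)
    then show ?thesis by (subst Bochner_Integration.integrable_cong[OF refl \<phi>_eq])
  qed
  have moments: "(\<integral>w. cnj w ^ k * \<phi> w \<partial>disc)
      = of_real (C0 * \<kappa>) * I k + of_real C0 * ((if k < 2 * n then d k else 0) * b k)" for k
  proof -
    have "(\<integral>w. cnj w ^ k * \<phi> w \<partial>disc)
        = (\<integral>w. of_real (C0 * \<kappa>) * (cnj w ^ k * (Q w * of_real (defect w powr (\<alpha> + real n))))
            + of_real C0 * (cnj w ^ k * (D w * of_real (defect w powr (\<alpha> + real n)))) \<partial>disc)"
      by (intro Bochner_Integration.integral_cong) (simp_all only: \<phi>_eq distrib_left mult_ac)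
    also have "\<dots> = of_real (C0 * \<kappa>) * I k
        + of_real C0 * (\<integral>w. cnj w ^ k * (D w * of_real (defect w powr (\<alpha> + real n))) \<partial>disc)"
      unfolding I_def Bochner_Integration.integral_mult_right_zero[symmetric]
      by (intro Bochner_Integration.integral_add integrable_mult_right integrable_cnj_power_mult Q_int D_int)
    also have "(\<integral>w. cnj w ^ k * (D w * of_real (defect w powr (\<alpha> + real n))) \<partial>disc)
        = (if k < 2 * n then d k else 0) * b k"
      using integral_disc_cnj_power[OF \<alpha>n D_sums D_int, of k] by (simp add: b_def mult.assoc)
    finally show ?thesis .
  qed
  have coeff: "of_real (P k / fact k) * (\<integral>w. cnj w ^ k * \<phi> w \<partial>disc) = a k" for k
  proof (cases "k < 2 * n")
    case True
    have "of_real (C0 * \<kappa>) * I k + of_real C0 * (d k * b k) = of_real C0 * (a k * of_real (fact k / (P k * C0)))"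
    proof -
      have e: "d k * b k = a k * of_real (fact k / (P k * C0)) - of_real \<kappa> * I k"
        using b0[of k] by (simp add: d_def)
      show ?thesis unfolding e right_diff_distrib by simp
    qed
    then show ?thesis
      using True P0[of k] C0 by (simp add: moments)
  next
    case False
    define m where "m = k - n"
    \<comment> \<open>From \<open>n \<le> m\<close> on, the Taylor coefficients of \<open>H\<close>
      are those of \<open>G\<close>.\<close>
    have k: "k = m + n" "n \<le> m" using False by (auto simp: m_def)
    have I: "I k = c m * b m"
      using I_ge[of k] k by simp
    have b: "b m = of_real (pi * (fact m / ((\<alpha> + real n + 1) * pochhammer (\<alpha> + real n + 2) m)))"
      unfolding b_def by (subst Beta_Suc_eq[OF \<alpha>n]) simp
    have Pk: "P k = P n * pochhammer (\<alpha> + real n + 2) m"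
      unfolding P_def using pochhammer_product[of n k "2 + \<alpha>"] k by (simp add: add_ac)
    have pos: "0 < pochhammer (\<alpha> + real n + 2) m" using \<alpha> by (intro pochhammer_pos) simp
    have e: "P k / fact k * (C0 * \<kappa>) * ((fact k / fact m) * (pi * (fact m / ((\<alpha> + real n + 1) * pochhammer (\<alpha> + real n + 2) m)))) = 1"
      using pos P0[of n] \<alpha> unfolding Pk C0_def \<kappa>_def by (simp add: divide_simps)
    have "of_real (P k / fact k) * (\<integral>w. cnj w ^ k * \<phi> w \<partial>disc)
        = complex_of_real (P k / fact k * (C0 * \<kappa>) * ((fact k / fact m) * (pi * (fact m / ((\<alpha> + real n + 1) * pochhammer (\<alpha> + real n + 2) m))))) * a k"
      using False unfolding moments I b c_def k(1)[symmetric] by simp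
    then show ?thesis unfolding e by simp
  qed
  have rep: "F z = (\<integral>w. h w * of_real ((\<alpha> + 1) / pi * defect w powr \<alpha>)
      * (1 - z * cnj w) powr (- of_real (2 + \<alpha>)) \<partial>disc)" if "cmod z < 1" for z
  proof -
    have "(\<lambda>k. a k * z ^ k) sums (\<integral>w. \<phi> w * (1 - z * cnj w) powr (- of_real (2 + \<alpha>)) \<partial>disc)"
      using kernel_sums[OF \<phi>_int that, of "2 + \<alpha>"] by (simp only: coeff[unfolded P_def])
    with F_sums[OF that] show ?thesis
      by (simp add: sums_unique2 \<phi>_def C0_def)
  qed
  have h_meas: "h \<in> borel_measurable disc"
    unfolding h_def
    by (intro borel_measurable_times borel_measurable_add borel_measurable_const Q_meas D_meas borel_measurable_disc) measurable
  have "(\<integral>\<^sup>+w. ennreal (cmod (h w) powr p * defect w powr (-2)) \<partial>disc) < \<infinity>"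
  proof (rule nn_integral_powr_finite)
    show "(\<integral>\<^sup>+w. ennreal ((\<bar>defect w\<bar> ^ n * cmod (G w)) powr p * defect w powr (-2)) \<partial>disc) < \<infinity>"
      using fin by (rule back_subst[where P="\<lambda>x. x < \<infinity>"], intro nn_integral_cong)
        (simp add: G_def abs_of_pos defect_pos space_restrict_space)
    \<comment> \<open>The bounded part of the density contributes a multiple of
      \<open>defect w ^ n\<close>; its p-th power is integrable for the invariant measure because
      \<open>real n * p - 2 > -1\<close>.\<close>
    have "integrable disc (\<lambda>w. defect w powr (real n * p - 2))"
      using p by (intro integrable_defect_powr) (simp add: mult.commute)
    then have "(\<integral>\<^sup>+w. ennreal (defect w powr (real n * p - 2)) \<partial>disc) < \<infinity>"
      by (simp add: nn_integral_eq_integral)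
    moreover have "(\<integral>\<^sup>+w. ennreal ((\<bar>defect w\<bar> ^ n) powr p * defect w powr (-2)) \<partial>disc)
        = (\<integral>\<^sup>+w. ennreal (defect w powr (real n * p - 2)) \<partial>disc)"
    proof (rule nn_integral_cong)
      fix w assume "w \<in> space disc"
      then have d: "0 < defect w" by (intro defect_pos wsp)
      have "(\<bar>defect w\<bar> ^ n) powr p = (defect w powr real n) powr p"
        using d by (simp add: powr_realpow)
      also have "\<dots> * defect w powr (-2) = defect w powr (real n * p - 2)"
        unfolding powr_powr powr_add[symmetric] by simp
      finally show "ennreal ((\<bar>defect w\<bar> ^ n) powr p * defect w powr (-2)) = ennreal (defect w powr (real n * p - 2))"
        by simp
    qed
    ultimately show "(\<integral>\<^sup>+w. ennreal ((\<bar>defect w\<bar> ^ n) powr p * defect w powr (-2)) \<partial>disc) < \<infinity>" by simp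
    show "cmod (h w) \<le> (\<bar>\<kappa>\<bar> * 2 ^ n) * (\<bar>defect w\<bar> ^ n * cmod (G w))
        + (\<bar>\<kappa>\<bar> * (2 ^ n * BT + Bg) + BD) * \<bar>defect w\<bar> ^ n" if "w \<in> space disc" for w
    proof -
      have "cmod (of_real \<kappa> * Q w + D w) \<le> cmod (of_real \<kappa> * Q w) + cmod (D w)"
        by (rule norm_triangle_ineq)
      also have "\<dots> \<le> \<bar>\<kappa>\<bar> * (2 ^ n * cmod (G w) + (2 ^ n * BT + Bg)) + BD"
        unfolding norm_mult norm_of_real
        by (intro add_mono mult_left_mono Q_le BD wsp that) (use wsp[OF that] in auto)
      finally have "\<bar>defect w\<bar> ^ n * cmod (of_real \<kappa> * Q w + D w)
          \<le> \<bar>defect w\<bar> ^ n * (\<bar>\<kappa>\<bar> * (2 ^ n * cmod (G w) + (2 ^ n * BT + Bg)) + BD)"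
        by (intro mult_left_mono) auto
      then show ?thesis
        unfolding h_def norm_mult norm_of_real power_abs by (simp only: distrib_left distrib_right mult_ac add_ac)
    qed
    show "(\<lambda>w. (\<bar>defect w\<bar> ^ n * cmod (G w)) powr p * defect w powr (-2)) \<in> borel_measurable disc"
    proof -
      have "(\<lambda>w. \<bar>defect w\<bar> ^ n * cmod (G w)) \<in> borel_measurable disc"
        by (intro borel_measurable_times[OF borel_measurable_disc measurable_compose[OF G_meas borel_measurable_norm]]) measurable
      moreover have "(\<lambda>x. x powr p) \<in> borel_measurable borel" for p :: real by measurable
      ultimately have "(\<lambda>w. (\<bar>defect w\<bar> ^ n * cmod (G w)) powr p) \<in> borel_measurable disc"
        by (rule measurable_compose)
      moreover have "(\<lambda>w. defect w powr (-2)) \<in> borel_measurable disc"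
        by (intro borel_measurable_disc) measurable
      ultimately show ?thesis by (rule borel_measurable_times)
    qed
    show "(\<lambda>w. (\<bar>defect w\<bar> ^ n) powr p * defect w powr (-2)) \<in> borel_measurable disc"
      by (intro borel_measurable_disc) measurable
  qed (use p BT Bg BD in auto)
  then show ?thesis by (rule that[OF h_meas _ rep])
qed

section \<open>Derivatives of Bergman integrals\<close>

lemma kernel_measurable:
  assumes "cmod z < 1"
  shows "(\<lambda>w. (1 - z * cnj w) powr b) \<in> borel_measurable disc"
proof (intro borel_measurable_disc_continuous continuous_on_powr_Re_pos)
  show "continuous_on (ball 0 1) (\<lambda>w. 1 - z * cnj w)" by (intro continuous_intros)
  show "0 < Re (1 - z * cnj w)" if "w \<in> ball 0 1" for w
    using that by (intro Re_one_minus_pos assms) simp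
qed

lemma integrable_kernel_mult:
  fixes \<phi> :: "complex \<Rightarrow> complex"
  assumes \<phi>: "integrable disc \<phi>" and z: "cmod z < 1" and "0 \<le> b"
  shows "integrable disc (\<lambda>w. \<phi> w * (1 - z * cnj w) powr (- of_real b))"
proof (rule Bochner_Integration.integrable_bound)
  show "integrable disc (\<lambda>w. (1 - cmod z) powr (- b) * cmod (\<phi> w))"
    by (intro integrable_mult_right integrable_norm \<phi>)
  show "(\<lambda>w. \<phi> w * (1 - z * cnj w) powr (- of_real b)) \<in> borel_measurable disc"
    by (intro borel_measurable_times borel_measurable_integrable[OF \<phi>] kernel_measurable z)
  have "cmod (\<phi> w) * cmod (1 - z * cnj w) powr (- b) \<le> cmod (\<phi> w) * (1 - cmod z) powr (- b)"
    if "w \<in> space disc" for w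
    using z assms(3) that
    by (intro mult_left_mono powr_mono2' norm_one_minus_ge) (auto simp: space_restrict_space)
  then show "AE w in disc. cmod (\<phi> w * (1 - z * cnj w) powr (- of_real b)) \<le> norm ((1 - cmod z) powr (- b) * cmod (\<phi> w))"
    by (intro AE_I2) (simp only: norm_mult norm_kernel real_norm_def abs_mult abs_norm_cancel abs_of_nonneg powr_ge_zero mult.commute)
qed

text \<open>Each derivative brings a factor \<open>cnj w\<close>, of modulus below 1, and raises the
  exponent of the kernel by 1. So the derivative of order \<open>n\<close> is dominated by the
  positive integral of \<open>Bergman_type_bound\<close>.\<close>

lemma Bergman_integral_higher_deriv_bound:
  fixes h F :: "complex \<Rightarrow> complex" and n :: nat and p \<alpha> :: real
  assumes h: "h \<in> borel_measurable disc" and p: "p \<ge> 1" "p * real n > 1" and \<alpha>: "\<alpha> > -1"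
    and fin: "(\<integral>\<^sup>+w. ennreal (cmod (h w) powr p * defect w powr (-2)) \<partial>disc) < \<infinity>"
    and F: "\<And>z. cmod z < 1 \<Longrightarrow> F z = (\<integral>w. h w * of_real ((\<alpha> + 1) / pi * defect w powr \<alpha>)
      * (1 - z * cnj w) powr (- of_real (2 + \<alpha>)) \<partial>disc)"
  shows "(\<integral>\<^sup>+w. ennreal ((defect w ^ n * cmod ((deriv ^^ n) F w)) powr p * defect w powr (-2)) \<partial>disc) < \<infinity>"
proof -
  define C0 where "C0 = (\<alpha> + 1) / pi"
  define C where "C = pochhammer (2 + \<alpha>) n * C0"
  have C: "0 \<le> C" using \<alpha> by (simp add: C_def C0_def pochhammer_nonneg)
  define \<phi> where "\<phi> w = h w * of_real (C0 * defect w powr \<alpha>)" for w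
  have wsp: "cmod w < 1" if "w \<in> space disc" for w using that by (simp add: space_restrict_space)
  have "integrable disc (\<lambda>w. of_real C0 * (h w * of_real (defect w powr \<alpha>)))"
    by (intro integrable_mult_right integrable_disc_of_Lp[OF h p(1) \<alpha> fin])
  then have \<phi>: "integrable disc \<phi>" by (simp add: \<phi>_def[abs_def] mult_ac)
  \<comment> \<open>Absorbs the normalization and the Pochhammer factor, so that the pointwise bound
    is \<open>J z\<close> itself.\<close>
  define h' where "h' w = of_real C * h w" for w
  define J where "J z = (\<integral>w. cmod (h' w) * defect w powr \<alpha> * cmod (1 - z * cnj w) powr (- (2 + \<alpha> + real n)) \<partial>disc)" for z
  have J_fin: "(\<integral>\<^sup>+z. ennreal ((defect z ^ n * J z) powr p * defect z powr (-2)) \<partial>disc) < \<infinity>"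
    unfolding J_def
  proof (rule Bergman_type_bound[OF _ p \<alpha>])
    show "h' \<in> borel_measurable disc"
      unfolding h'_def by (intro borel_measurable_times borel_measurable_const h)
    have m: "(\<lambda>w. cmod (h w) powr p * defect w powr (-2)) \<in> borel_measurable disc"
      by (intro borel_measurable_times norm_powr_measurable h borel_measurable_disc) measurable
    show "(\<integral>\<^sup>+w. ennreal (cmod (h' w) powr p * defect w powr (-2)) \<partial>disc) < \<infinity>"
      by (rule nn_integral_powr_finite[OF _ C _ _ _ _ _ m m _ fin fin, where B=0])
        (use p C in \<open>auto simp: h'_def norm_mult\<close>)
  qed
  have "cmod ((deriv ^^ n) F z) \<le> J z" if z: "cmod z < 1" for z
  proof -
    have "(deriv ^^ n) F z = of_real (pochhammer (2 + \<alpha>) n) *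
        (\<integral>w. cnj w ^ n * \<phi> w * (1 - z * cnj w) powr (- of_real (2 + \<alpha> + real n)) \<partial>disc)"
      by (rule higher_deriv_kernel_integral[OF \<phi> z]) (simp add: F \<phi>_def C0_def)
    also have "cmod \<dots> = pochhammer (2 + \<alpha>) n *
        cmod (\<integral>w. cnj w ^ n * \<phi> w * (1 - z * cnj w) powr (- of_real (2 + \<alpha> + real n)) \<partial>disc)"
      using \<alpha> by (simp only: norm_mult norm_of_real) (simp add: pochhammer_nonneg)
    also have "\<dots> \<le> pochhammer (2 + \<alpha>) n *
        (\<integral>w. cmod (\<phi> w * (1 - z * cnj w) powr (- of_real (2 + \<alpha> + real n))) \<partial>disc)"
    proof (rule mult_left_mono)
      have k: "integrable disc (\<lambda>w. \<phi> w * (1 - z * cnj w) powr (- of_real (2 + \<alpha> + real n)))"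
        using \<alpha> by (intro integrable_kernel_mult \<phi> z) simp
      show "cmod (\<integral>w. cnj w ^ n * \<phi> w * (1 - z * cnj w) powr (- of_real (2 + \<alpha> + real n)) \<partial>disc)
          \<le> (\<integral>w. cmod (\<phi> w * (1 - z * cnj w) powr (- of_real (2 + \<alpha> + real n))) \<partial>disc)"
      proof (rule order_trans[OF integral_norm_bound integral_mono])
        fix w assume "w \<in> space disc"
        then have "cmod w ^ n \<le> 1" by (intro power_le_one) (auto simp: space_restrict_space)
        then have "cmod w ^ n * cmod (\<phi> w * (1 - z * cnj w) powr (- of_real (2 + \<alpha> + real n)))
            \<le> 1 * cmod (\<phi> w * (1 - z * cnj w) powr (- of_real (2 + \<alpha> + real n)))"
          by (intro mult_right_mono) auto
        then show "cmod (cnj w ^ n * \<phi> w * (1 - z * cnj w) powr (- of_real (2 + \<alpha> + real n)))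
            \<le> cmod (\<phi> w * (1 - z * cnj w) powr (- of_real (2 + \<alpha> + real n)))"
          by (simp only: norm_mult norm_power complex_mod_cnj mult_1 mult.assoc)
      next
        show "integrable disc (\<lambda>w. cmod (cnj w ^ n * \<phi> w * (1 - z * cnj w) powr (- of_real (2 + \<alpha> + real n))))"
          unfolding mult.assoc by (intro integrable_norm integrable_cnj_power_mult k)
      qed (intro integrable_norm k)
    qed (use \<alpha> in \<open>simp add: pochhammer_nonneg\<close>)
    also have "\<dots> = J z"
      unfolding J_def Bochner_Integration.integral_mult_right_zero[symmetric]
    proof (rule Bochner_Integration.integral_cong)
      fix w
      have "0 \<le> C0" using \<alpha> by (simp add: C0_def)
      then show "pochhammer (2 + \<alpha>) n * cmod (\<phi> w * (1 - z * cnj w) powr (- of_real (2 + \<alpha> + real n)))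
          = cmod (h' w) * defect w powr \<alpha> * cmod (1 - z * cnj w) powr (- (2 + \<alpha> + real n))"
        using C \<alpha> unfolding \<phi>_def h'_def norm_mult norm_kernel norm_of_real
        by (simp add: C_def abs_mult pochhammer_nonneg)
    qed simp
    finally show ?thesis .
  qed
  then have "(\<integral>\<^sup>+w. ennreal ((defect w ^ n * cmod ((deriv ^^ n) F w)) powr p * defect w powr (-2)) \<partial>disc)
      \<le> (\<integral>\<^sup>+z. ennreal ((defect z ^ n * J z) powr p * defect z powr (-2)) \<partial>disc)"
    using p by (intro nn_integral_mono ennreal_leI mult_right_mono powr_mono2 mult_left_mono)
      (auto simp: space_restrict_space less_imp_le defect_pos)
  then show ?thesis using J_fin by (rule le_less_trans)
qed

section \<open>Slices and slice regular functions\<close>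

lemma slice_point_scaleR: "slice_point i z = Re z *\<^sub>R 1 + Im z *\<^sub>R i"
  by (simp add: slice_point_def of_real_def)

lemma imag_unit_square: "i \<in> imag_units \<Longrightarrow> i * i = -1"
  using imag_units_square_sum[of i]
  by (simp add: imag_units_def quat_eq_iff times_quat_def power2_eq_square)

lemma slice_point_add: "slice_point i (z + w) = slice_point i z + slice_point i w"
  by (simp add: slice_point_scaleR scaleR_add_left)

lemma slice_point_cmult: "slice_point i (r *\<^sub>R z) = r *\<^sub>R slice_point i z"
  by (simp add: slice_point_scaleR scaleR_add_right)

lemma slice_point_mult:
  assumes "i \<in> imag_units"
  shows "slice_point i (z * w) = slice_point i z * slice_point i w"
  by (simp add: slice_point_scaleR distrib_left distrib_right imag_unit_square[OF assms]
      algebra_simps)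

lemma slice_point_0 [simp]: "slice_point i 0 = 0"
  and slice_point_1 [simp]: "slice_point i 1 = 1"
  by (simp_all add: slice_point_scaleR)

lemma slice_point_of_real [simp]: "slice_point i (of_real r) = of_real r"
  by (simp add: slice_point_scaleR of_real_def)

lemma bounded_linear_slice_point: "i \<in> imag_units \<Longrightarrow> bounded_linear (slice_point i)"
  by (rule bounded_linear_intro[where K=1])
    (simp_all add: slice_point_add slice_point_cmult norm_slice_point)

lemma slice_point_inverse:
  assumes "i \<in> imag_units"
  shows "slice_point i (inverse z) = inverse (slice_point i z)"
proof (cases "z = 0")
  case False
  then have "slice_point i (inverse z) * slice_point i z = 1"
    by (simp flip: slice_point_mult[OF assms])
  then show ?thesis by (metis inverse_inverse_eq inverse_unique)
qed simp

lemma quat_cnj_slice_point: "i \<in> imag_units \<Longrightarrow> quat_cnj (slice_point i z) = slice_point i (cnj z)"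
  by (simp add: slice_point_eq quat_cnj_def)

lemma slice_coord_add: "slice_coord i (p + q) = slice_coord i p + slice_coord i q"
  by (simp add: slice_coord_def inner_add_right complex_eq_iff)

lemma slice_coord_scaleR: "slice_coord i (r *\<^sub>R q) = r *\<^sub>R slice_coord i q"
  by (simp add: slice_coord_def complex_eq_iff)

text \<open>Together with real linearity this makes \<open>slice_coord i\<close>, the orthogonal
  projection onto C(i) read in complex coordinates, left C(i)-linear.\<close>

lemma slice_coord_imag_unit_mult:
  assumes "i \<in> imag_units"
  shows "slice_coord i (i * q) = \<i> * slice_coord i q"
proof -
  have "i \<bullet> (i * q) = ((q1 i)\<^sup>2 + (q2 i)\<^sup>2 + (q3 i)\<^sup>2) * q0 q"
    using assms by (simp add: inner_quat_def times_quat_def imag_units_def power2_eq_square algebra_simps)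
  then show ?thesis
    using assms by (simp add: slice_coord_def complex_eq_iff imag_units_square_sum)
      (simp add: times_quat_def inner_quat_def imag_units_def)
qed

lemma slice_coord_slice_point_mult:
  assumes "i \<in> imag_units"
  shows "slice_coord i (slice_point i z * q) = z * slice_coord i q"
proof -
  have "slice_point i z * q = Re z *\<^sub>R q + Im z *\<^sub>R (i * q)"
    by (simp add: slice_point_scaleR distrib_right)
  then show ?thesis
    by (simp only: slice_coord_add slice_coord_scaleR slice_coord_imag_unit_mult[OF assms])
      (simp add: complex_eq_iff)
qed

lemma norm_slice_coord_le:
  assumes "i \<in> imag_units"
  shows "cmod (slice_coord i q) \<le> 2 * norm q"
proof -
  have "\<bar>q0 q\<bar> = \<bar>1 \<bullet> q\<bar>" by (simp add: inner_quat_def)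
  also have "\<dots> \<le> norm (1 :: quat) * norm q" by (rule Cauchy_Schwarz_ineq2)
  finally have "\<bar>q0 q\<bar> \<le> norm q" by simp
  moreover have "\<bar>i \<bullet> q\<bar> \<le> norm i * norm q" by (rule Cauchy_Schwarz_ineq2)
  ultimately show ?thesis
    using cmod_le[of "slice_coord i q"] assms by (simp add: slice_coord_def imag_units_def)
qed

lemma bounded_linear_slice_coord: "i \<in> imag_units \<Longrightarrow> bounded_linear (slice_coord i)"
  by (rule bounded_linear_intro[where K=2])
    (simp_all only: slice_coord_add slice_coord_scaleR norm_slice_coord_le mult.commute[of _ 2])

text \<open>The first two imaginary components of \<open>i\<close>, turned by a right angle and
  normalized by \<open>s\<close>; if both vanish, the first basis unit will do.\<close>

lemma imag_unit_orthogonal_exists: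
  assumes "i \<in> imag_units"
  obtains j where "j \<in> imag_units" "i \<bullet> j = 0"
proof (cases "q1 i = 0 \<and> q2 i = 0")
  case True
  then show ?thesis
    using assms that[of "Quat 0 1 0 0"] by (simp add: imag_units_def inner_quat_def norm_quat_def)
next
  case False
  define s where "s = sqrt ((q1 i)\<^sup>2 + (q2 i)\<^sup>2)"
  have s2: "s\<^sup>2 = (q1 i)\<^sup>2 + (q2 i)\<^sup>2" by (simp add: s_def)
  have "s\<^sup>2 \<noteq> 0" using False by (simp add: s2 sum_power2_eq_zero_iff)
  then have s: "s \<noteq> 0" by simp
  let ?j = "Quat 0 (- q2 i / s) (q1 i / s) 0"
  have "(q2 i)\<^sup>2 / s\<^sup>2 + (q1 i)\<^sup>2 / s\<^sup>2 = 1"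
    using \<open>s\<^sup>2 \<noteq> 0\<close> by (simp add: s2 add_divide_distrib[symmetric] add.commute)
  then have "?j \<in> imag_units" by (simp add: imag_units_def norm_quat_def power_divide)
  moreover have "i \<bullet> ?j = 0" by (simp add: inner_quat_def)
  ultimately show ?thesis by (rule that)
qed

lemma imag_anticommute:
  assumes "q0 p = 0" "q0 q = 0" "p \<bullet> q = 0"
  shows "p * q = - (q * p)"
  using assms by (simp add: quat_eq_iff times_quat_def inner_quat_def algebra_simps)

text \<open>A quaternion orthogonal to \<open>1\<close>, \<open>i\<close>, \<open>j\<close> commutes with \<open>i j\<close>, as it anticommutes with both
  factors; if it is orthogonal to \<open>i j\<close> as well, it also anticommutes with \<open>i j\<close>, so it is \<open>0\<close>.\<close>

lemma slice_splitting:
  assumes i: "i \<in> imag_units" and j: "j \<in> imag_units" and ij: "i \<bullet> j = 0"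
  shows "q = slice_point i (slice_coord i q) + slice_point i (slice_coord i (- (q * j))) * j"
proof -
  have L: "slice_coord i (- p) = - slice_coord i p" for p
    using slice_coord_scaleR[of i "-1" p] by simp
  have L_diff: "slice_coord i (p - q) = slice_coord i p - slice_coord i q" for p q
    using slice_coord_add[of i p "- q"] by (simp add: L)
  have L_j: "slice_coord i j = 0" using j ij by (simp add: slice_coord_def imag_units_def complex_eq_iff)
  have jj: "j * j = -1" by (rule imag_unit_square[OF j])
  \<comment> \<open>Since \<open>j * j = -1\<close>, right multiplication of a + b j by - j gives b
    - a j, whose projection onto C(i) is b.\<close>
  define A B where "A = slice_coord i q" and "B = slice_coord i (- (q * j))"
  define r where "r = q - (slice_point i A + slice_point i B * j)"
  have q: "q = r + (slice_point i A + slice_point i B * j)" by (simp add: r_def)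
  have 1: "slice_coord i r = 0"
    using arg_cong[OF q, of "slice_coord i"] slice_coord_slice_point[OF i, of A]
    by (simp add: slice_coord_add slice_coord_slice_point_mult[OF i] L_j A_def[symmetric])
  have B: "- slice_coord i (q * j) = B" by (simp add: B_def L)
  have "- (q * j) = - (r * j) + (- (slice_point i A * j) + slice_point i B)"
    by (subst q) (simp add: distrib_right mult.assoc jj)
  from arg_cong[OF this, of "slice_coord i"]
  have 2: "slice_coord i (r * j) = 0"
    by (simp add: slice_coord_add L L_diff slice_coord_slice_point_mult[OF i] L_j slice_coord_slice_point[OF i] B)
  have i0: "q0 i = 0" and j0: "q0 j = 0" using i j by (auto simp: imag_units_def)
  have r0: "q0 r = 0" and ri: "r \<bullet> i = 0"
    using 1 by (auto simp: slice_coord_def complex_eq_iff inner_commute)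
  have rj: "r \<bullet> j = 0"
    using 2 r0 j0 by (simp add: slice_coord_def complex_eq_iff) (simp add: times_quat_def inner_quat_def)
  have rij: "r \<bullet> (i * j) = 0"
    using 2 r0 j0 i0 by (simp add: slice_coord_def complex_eq_iff) (simp add: times_quat_def inner_quat_def algebra_simps)
  have ij0: "q0 (i * j) = 0"
    using ij i0 j0 by (simp add: times_quat_def inner_quat_def)
  have "r * (i * j) = (i * j) * r"
    using imag_anticommute[OF r0 i0 ri] imag_anticommute[OF r0 j0 rj] by (metis mult.assoc minus_mult_left minus_mult_right minus_minus)
  moreover have "r * (i * j) = - ((i * j) * r)" by (rule imag_anticommute[OF r0 ij0 rij])
  ultimately have "r * (i * j) + r * (i * j) = 0" by (metis add.right_inverse)
  then have "2 *\<^sub>R (r * (i * j)) = 0" by (simp add: scaleR_2)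
  then have "r * (i * j) = 0" by simp
  moreover have "i \<noteq> 0" "j \<noteq> 0" using i j by (auto simp: imag_units_def)
  ultimately have "r = 0" by simp
  with q show ?thesis by (simp add: A_def B_def)
qed

text \<open>\<open>L\<close> stands for either coordinate of the splitting. The slice equation says
  \<open>D \<i> = i * D 1\<close>, and \<open>L\<close> turns left multiplication by
  \<open>i\<close> into multiplication by \<i>, so the real derivative of the composite is complex
  linear.\<close>

lemma slice_regular_holomorphic:
  fixes L :: "quat \<Rightarrow> complex"
  assumes f: "f \<in> slice_regular" and i: "i \<in> imag_units"
    and L: "bounded_linear L" "\<And>q. L (i * q) = \<i> * L q"
  shows "(\<lambda>z. L (f (slice_point i z))) holomorphic_on ball 0 1"
proof -
  interpret L: bounded_linear L by (rule L(1))
  interpret S: bounded_linear "slice_point i" by (rule bounded_linear_slice_point[OF i])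
  have "((\<lambda>z. L (f (slice_point i z))) has_field_derivative
      L (vector_derivative (\<lambda>t. f (slice_point i (Complex t (Im z)))) (at (Re z)))) (at z)"
    if z: "cmod z < 1" for z
  proof -
    have b: "slice_point i z \<in> ball 0 1" using z by (simp add: norm_slice_point[OF i])
    with f have "f differentiable (at (slice_point i z) within ball 0 1)"
      unfolding slice_regular_def differentiable_on_def by blast
    then obtain f' where f': "(f has_derivative f') (at (slice_point i z))"
      unfolding at_within_open[OF b open_ball] differentiable_def by blast
    interpret f': bounded_linear f' by (rule has_derivative_bounded_linear[OF f'])
    define D where "D h = f' (slice_point i h)" for h
    have D: "((\<lambda>z. f (slice_point i z)) has_derivative D) (at z)"
      unfolding D_def by (rule has_derivative_compose[OF S.has_derivative[OF has_derivative_ident] f'])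
    have D_lin: "D (r *\<^sub>R u + s *\<^sub>R v) = r *\<^sub>R D u + s *\<^sub>R D v" for r s u v
      by (simp add: D_def S.add S.scaleR f'.add f'.scaleR)
    have x: "vector_derivative (\<lambda>t. f (slice_point i (Complex t (Im z)))) (at (Re z)) = D 1"
    proof (rule vector_derivative_at)
      have "((\<lambda>t. Complex t (Im z)) has_vector_derivative 1) (at (Re z))"
        unfolding Complex_eq by (auto intro!: derivative_eq_intros)
      from has_derivative_compose[OF this[unfolded has_vector_derivative_def], of "\<lambda>z. f (slice_point i z)" D] D
      have "((\<lambda>t. f (slice_point i (Complex t (Im z)))) has_derivative (\<lambda>h. D (h *\<^sub>R 1))) (at (Re z))"
        by simp
      then show "((\<lambda>t. f (slice_point i (Complex t (Im z)))) has_vector_derivative D 1) (at (Re z))"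
        using D_lin[of _ 1 0 0] by (simp add: has_vector_derivative_def)
    qed
    have y: "vector_derivative (\<lambda>t. f (slice_point i (Complex (Re z) t))) (at (Im z)) = D \<i>"
    proof (rule vector_derivative_at)
      have "((\<lambda>t. Complex (Re z) t) has_vector_derivative \<i>) (at (Im z))"
        unfolding Complex_eq by (auto intro!: derivative_eq_intros)
      from has_derivative_compose[OF this[unfolded has_vector_derivative_def], of "\<lambda>z. f (slice_point i z)" D] D
      have "((\<lambda>t. f (slice_point i (Complex (Re z) t))) has_derivative (\<lambda>h. D (h *\<^sub>R \<i>))) (at (Im z))"
        by simp
      then show "((\<lambda>t. f (slice_point i (Complex (Re z) t))) has_vector_derivative D \<i>) (at (Im z))"
        using D_lin[of _ \<i> 0 0] by (simp add: has_vector_derivative_def)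
    qed
    have "D 1 + i * D \<i> = 0"
      using f i b unfolding x[symmetric] y[symmetric] slice_regular_def by simp
    then have "i * D 1 + i * (i * D \<i>) = 0" by (simp flip: distrib_left)
    then have "D \<i> = i * D 1"
      by (simp add: mult.assoc[symmetric] imag_unit_square[OF i])
    have D_eq: "L (D h) = L (D 1) * h" for h
    proof -
      have "D h = D (Re h *\<^sub>R 1 + Im h *\<^sub>R \<i>)"
        by (rule arg_cong[where f=D]) (simp add: complex_eq_iff)
      also have "\<dots> = Re h *\<^sub>R D 1 + Im h *\<^sub>R (i * D 1)"
        by (simp only: D_lin \<open>D \<i> = i * D 1\<close>)
      finally show ?thesis
        by (simp only: L.add L.scaleR L(2)) (simp add: complex_eq_iff algebra_simps)
    qed
    have "((\<lambda>z. L (f (slice_point i z))) has_derivative (\<lambda>h. L (D h))) (at z)"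
      by (rule L.has_derivative[OF D])
    also have "(\<lambda>h. L (D h)) = (*) (L (D 1))" by (rule ext) (rule D_eq)
    finally show ?thesis unfolding x has_field_derivative_def .
  qed
  then show ?thesis
    unfolding holomorphic_on_open[OF open_ball] mem_ball_0[symmetric] by blast
qed

text \<open>Adding a real \<open>t\<close> stays inside the slice, so the derivative in x0 is the
  complex derivative of the two components.\<close>

lemma deriv_x0_slice_point:
  assumes i: "i \<in> imag_units"
    and F: "F holomorphic_on ball 0 1" and G: "G holomorphic_on ball 0 1"
    and g: "\<And>z. cmod z < 1 \<Longrightarrow> g (slice_point i z) = slice_point i (F z) + slice_point i (G z) * j"
    and z: "cmod z < 1"
  shows "deriv_x0 g (slice_point i z) = slice_point i (deriv F z) + slice_point i (deriv G z) * j"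
proof -
  interpret S: bounded_linear "slice_point i" by (rule bounded_linear_slice_point[OF i])
  have line: "((\<lambda>t. H (z + of_real t)) has_vector_derivative deriv H z) (at 0)"
    if "H holomorphic_on ball 0 1" for H
  proof -
    have "(H has_field_derivative deriv H z) (at (z + of_real 0))"
      using holomorphic_derivI[OF that, of z] z by simp
    moreover have "((\<lambda>t. z + of_real t) has_vector_derivative 1) (at 0)"
      by (auto intro!: derivative_eq_intros)
    ultimately show ?thesis
      using field_vector_diff_chain_at[of "\<lambda>t. z + of_real t" 1 0 H] by (simp add: o_def)
  qed
  have "((\<lambda>t. slice_point i (F (z + of_real t)) + slice_point i (G (z + of_real t)) * j)
      has_vector_derivative (slice_point i (deriv F z) + slice_point i (deriv G z) * j)) (at 0)"
    by (intro has_vector_derivative_add bounded_linear.has_vector_derivative[OF bounded_linear_mult_left]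
        S.has_vector_derivative line F G)
  then have "((\<lambda>t. g (slice_point i z + of_real t)) has_vector_derivative
      (slice_point i (deriv F z) + slice_point i (deriv G z) * j)) (at 0)"
  proof (rule has_vector_derivative_transform_within_open)
    show "open {t :: real. cmod (z + of_real t) < 1}"
      by (intro open_Collect_less continuous_intros)
    show "0 \<in> {t :: real. cmod (z + of_real t) < 1}" using z by simp
    fix t :: real assume "t \<in> {t. cmod (z + of_real t) < 1}"
    then show "slice_point i (F (z + of_real t)) + slice_point i (G (z + of_real t)) * j = g (slice_point i z + of_real t)"
      using g[of "z + of_real t"] by (simp add: slice_point_add)
  qed
  then show ?thesis unfolding deriv_x0_def by (rule vector_derivative_at)
qed

lemma deriv_x0_funpow_slice_point:
  assumes i: "i \<in> imag_units"
    and F: "F holomorphic_on ball 0 1" and G: "G holomorphic_on ball 0 1"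
    and g: "\<And>z. cmod z < 1 \<Longrightarrow> g (slice_point i z) = slice_point i (F z) + slice_point i (G z) * j"
    and z: "cmod z < 1"
  shows "(deriv_x0 ^^ n) g (slice_point i z)
    = slice_point i ((deriv ^^ n) F z) + slice_point i ((deriv ^^ n) G z) * j"
  using z
proof (induction n arbitrary: z)
  case (Suc n)
  have "deriv_x0 ((deriv_x0 ^^ n) g) (slice_point i z)
      = slice_point i (deriv ((deriv ^^ n) F) z) + slice_point i (deriv ((deriv ^^ n) G) z) * j"
    by (rule deriv_x0_slice_point[where F="(deriv ^^ n) F" and G="(deriv ^^ n) G", OF i _ _ Suc.IH Suc.prems])
      (intro holomorphic_higher_deriv F G open_ball)+
  then show ?case by simp
qed (simp add: g)

lemma slice_regular_components:
  assumes f: "f \<in> slice_regular" and i: "i \<in> imag_units" and j: "j \<in> imag_units" and ij: "i \<bullet> j = 0"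
  defines "F \<equiv> \<lambda>z. slice_coord i (f (slice_point i z))"
    and "G \<equiv> \<lambda>z. slice_coord i (- (f (slice_point i z) * j))"
  shows "F holomorphic_on ball 0 1" and "G holomorphic_on ball 0 1"
    and "f (slice_point i z) = slice_point i (F z) + slice_point i (G z) * j"
proof -
  show "F holomorphic_on ball 0 1"
    unfolding F_def by (intro slice_regular_holomorphic[OF f i] bounded_linear_slice_coord[OF i] slice_coord_imag_unit_mult[OF i])
  have "bounded_linear (\<lambda>q. slice_coord i (- (q * j)))"
    by (intro bounded_linear_compose[OF bounded_linear_slice_coord[OF i]] bounded_linear_minus bounded_linear_mult_left)
  moreover have "slice_coord i (- (i * q * j)) = \<i> * slice_coord i (- (q * j))" for q
    using slice_coord_imag_unit_mult[OF i, of "- (q * j)"] by (simp add: mult.assoc)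
  ultimately show "G holomorphic_on ball 0 1"
    unfolding G_def by (rule slice_regular_holomorphic[OF f i])
  show "f (slice_point i z) = slice_point i (F z) + slice_point i (G z) * j"
    unfolding F_def G_def by (rule slice_splitting[OF i j ij])
qed

text \<open>The coefficients on the right are derivatives at 0 and do not depend on the slice; this
  is what links the slices to one another.\<close>

lemma slice_regular_Taylor:
  assumes f: "f \<in> slice_regular" and i: "i \<in> imag_units" and z: "cmod z < 1"
  shows "(\<lambda>k. slice_point i (z ^ k / fact k) * (deriv_x0 ^^ (n + k)) f 0)
    sums (deriv_x0 ^^ n) f (slice_point i z)"
proof -
  interpret S: bounded_linear "slice_point i" by (rule bounded_linear_slice_point[OF i])
  obtain j where j: "j \<in> imag_units" "i \<bullet> j = 0" using imag_unit_orthogonal_exists[OF i] .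
  define F where "F z = slice_coord i (f (slice_point i z))" for z
  define G where "G z = slice_coord i (- (f (slice_point i z) * j))" for z
  note FG = slice_regular_components[OF f i j, folded F_def G_def]
  have D: "(deriv_x0 ^^ m) f (slice_point i z)
      = slice_point i ((deriv ^^ m) F z) + slice_point i ((deriv ^^ m) G z) * j" if "cmod z < 1" for m z
    by (rule deriv_x0_funpow_slice_point[OF i FG that])
  have H: "(\<lambda>k. (deriv ^^ (n + k)) H 0 / fact k * z ^ k) sums (deriv ^^ n) H z"
    if "H holomorphic_on ball 0 1" for H
  proof -
    have "(deriv ^^ n) H holomorphic_on ball 0 1" by (intro holomorphic_higher_deriv that open_ball)
    from holomorphic_power_series[OF this, of z] z show ?thesis
      by (simp add: add.commute[of n] funpow_add)
  qed
  have "(\<lambda>k. slice_point i ((deriv ^^ (n + k)) F 0 / fact k * z ^ k)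
        + slice_point i ((deriv ^^ (n + k)) G 0 / fact k * z ^ k) * j)
      sums (slice_point i ((deriv ^^ n) F z) + slice_point i ((deriv ^^ n) G z) * j)"
    by (intro sums_add bounded_linear.sums[OF bounded_linear_mult_left] S.sums H FG)
  moreover have "slice_point i (A / fact k * z ^ k) = slice_point i (z ^ k / fact k) * slice_point i A" for A k
    by (simp flip: slice_point_mult[OF i] add: mult.commute)
  ultimately show ?thesis
    using D[of 0] by (simp add: D[OF z] distrib_left mult.assoc)
qed

text \<open>The formula holds for a point of the slice by real linearity, hence for its powers;
  multiplying these on the right by the common Taylor coefficients and summing carries it over to
  \<open>f\<close> and its derivatives.\<close>

lemma slice_regular_representation:
  assumes f: "f \<in> slice_regular" and i: "i \<in> imag_units" and i': "i' \<in> imag_units" and z: "cmod z < 1"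
  shows "(deriv_x0 ^^ n) f (slice_point i' z)
    = (1/2) *\<^sub>R ((1 + i' * i) * (deriv_x0 ^^ n) f (slice_point i (cnj z))
        + (1 - i' * i) * (deriv_x0 ^^ n) f (slice_point i z))"
proof -
  have eq: "slice_point i' w = (1/2) *\<^sub>R ((1 + i' * i) * slice_point i (cnj w) + (1 - i' * i) * slice_point i w)" for w
  proof -
    have "(1 + i' * i) * slice_point i (cnj w) + (1 - i' * i) * slice_point i w
        = (2 * Re w) *\<^sub>R 1 - (2 * Im w) *\<^sub>R (i' * (i * i))"
      by (simp add: slice_point_scaleR algebra_simps scaleR_2[symmetric])
    then show ?thesis by (simp add: imag_unit_square[OF i] slice_point_scaleR scaleR_add_right)
  qed
  have "(\<lambda>k. (1/2) *\<^sub>R ((1 + i' * i) * (slice_point i (cnj z ^ k / fact k) * (deriv_x0 ^^ (n + k)) f 0)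
        + (1 - i' * i) * (slice_point i (z ^ k / fact k) * (deriv_x0 ^^ (n + k)) f 0)))
    sums ((1/2) *\<^sub>R ((1 + i' * i) * (deriv_x0 ^^ n) f (slice_point i (cnj z))
        + (1 - i' * i) * (deriv_x0 ^^ n) f (slice_point i z)))"
    using z by (intro sums_scaleR_right sums_add bounded_linear.sums[OF bounded_linear_mult_right] slice_regular_Taylor f i) auto
  moreover have "(1/2) *\<^sub>R ((1 + i' * i) * (slice_point i (cnj z ^ k / fact k) * (deriv_x0 ^^ (n + k)) f 0)
        + (1 - i' * i) * (slice_point i (z ^ k / fact k) * (deriv_x0 ^^ (n + k)) f 0))
      = slice_point i' (z ^ k / fact k) * (deriv_x0 ^^ (n + k)) f 0" for k
    by (subst eq[of "z ^ k / fact k"]) (simp add: distrib_right mult.assoc)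
  ultimately show ?thesis
    using slice_regular_Taylor[OF f i' z, of n] by (simp only: sums_unique2)
qed

text \<open>Here \<open>sgn (quat_Im q)\<close> is \<open>i\<close>, \<open>- i\<close> or 0
  according to the sign of \<open>Im z\<close>. Each of the first two values kills one summand; the
  third averages two equal values.\<close>

lemma slice_extension_slice_point:
  assumes i: "i \<in> imag_units"
  shows "slice_extension i g (slice_point i z) = g (slice_point i z)"
proof -
  have Im: "quat_Im (slice_point i z) = Im z *\<^sub>R i"
    using i by (simp add: slice_point_eq quat_Im_def quat_eq_iff imag_units_def)
  have Re: "q0 (slice_point i z) = Re z" using i by (simp add: slice_point_eq)
  have ni: "norm i = 1" using i by (simp add: imag_units_def)
  consider "Im z > 0" | "Im z < 0" | "Im z = 0" by linarith
  then show ?thesis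
  proof cases
    case 1
    then show ?thesis
      by (simp add: slice_extension_def Im Re ni sgn_div_norm imag_unit_square[OF i] Let_def)
  next
    case 2
    have "Complex (Re z) (Im z) = z" by simp
    with 2 show ?thesis
      by (simp add: slice_extension_def Im Re ni sgn_div_norm imag_unit_square[OF i] Let_def)
  next
    case 3
    then have "Complex (Re z) 0 = z" by (simp add: complex_eq_iff)
    with 3 show ?thesis
      by (simp add: slice_extension_def Im Re Let_def scaleR_2[symmetric] flip: scaleR_add_left)
  qed
qed

text \<open>The representation formula of order 0, on the slice through \<open>q\<close>.\<close>

lemma slice_extension_slice_regular:
  assumes f: "f \<in> slice_regular" and i: "i \<in> imag_units" and q: "q \<in> ball 0 1"
  shows "slice_extension i f q = f q"
proof (cases "quat_Im q = 0")
  case True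
  then have "q = slice_point i (of_real (q0 q))"
    by (simp add: quat_Im_def quat_eq_iff)
  then show ?thesis using slice_extension_slice_point[OF i] by metis
next
  case False
  define I where "I = sgn (quat_Im q)"
  define y where "y = norm (quat_Im q)"
  have I: "I \<in> imag_units"
    using False by (simp add: I_def imag_units_def norm_sgn sgn_div_norm) (simp add: quat_Im_def)
  have qI: "q = slice_point I (Complex (q0 q) y)"
    using False by (simp add: slice_point_scaleR I_def y_def sgn_div_norm) (simp add: quat_Im_def quat_eq_iff)
  have "cmod (Complex (q0 q) y) < 1"
    using q norm_slice_point[OF I] qI by (metis mem_ball_0)
  from slice_regular_representation[OF f i I this, of 0]
  have "f (slice_point I (Complex (q0 q) y)) = slice_extension i f q"
    by (simp add: slice_extension_def Let_def I_def y_def complex_cnj)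
  then show ?thesis using qI by simp
qed

section \<open>Transfer from the disc to a slice\<close>

lemma slice_coord_splitting:
  assumes i: "i \<in> imag_units" and j: "j \<in> imag_units" and ij: "i \<bullet> j = 0"
  shows "slice_coord i (slice_point i a + slice_point i b * j) = a"
    and "slice_coord i (- ((slice_point i a + slice_point i b * j) * j)) = b"
proof -
  have L_j: "slice_coord i j = 0" using j ij by (simp add: slice_coord_def imag_units_def complex_eq_iff)
  show "slice_coord i (slice_point i a + slice_point i b * j) = a"
    by (simp add: slice_coord_add slice_coord_slice_point_mult[OF i] L_j slice_coord_slice_point[OF i])
  have "- ((slice_point i a + slice_point i b * j) * j) = slice_point i (- a) * j + slice_point i b"
    using slice_point_cmult[of i "-1" a] by (simp add: distrib_right mult.assoc imag_unit_square[OF j])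
  then show "slice_coord i (- ((slice_point i a + slice_point i b * j) * j)) = b"
    by (simp add: slice_coord_add slice_coord_slice_point_mult[OF i] L_j slice_coord_slice_point[OF i])
qed

lemma measurable_slice_lebesgue_iff:
  assumes "i \<in> imag_units"
  shows "g \<in> slice_lebesgue i \<rightarrow>\<^sub>M N \<longleftrightarrow> (\<lambda>w. g (slice_point i w)) \<in> disc \<rightarrow>\<^sub>M N"
  unfolding slice_lebesgue_def
  using measurable_compose[OF measurable_embed_measure2[OF inj_slice_point[OF assms]]] measurable_embed_measure1
  by blast

lemma norm_slice_point_defect: "i \<in> imag_units \<Longrightarrow> 1 - (norm (slice_point i w))\<^sup>2 = defect w"
  by (simp add: norm_slice_point defect_def)

lemma nn_integral_slice_invariant_measure:
  fixes g :: "quat \<Rightarrow> real"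
  assumes i: "i \<in> imag_units" and g: "(\<lambda>w. g (slice_point i w)) \<in> borel_measurable disc"
    and nonneg: "\<And>q. 0 \<le> g q"
  shows "(\<integral>\<^sup>+z. ennreal (g z) \<partial>slice_invariant_measure i)
    = ennreal (1 / pi) * (\<integral>\<^sup>+w. ennreal (g (slice_point i w) * defect w powr (-2)) \<partial>disc)"
proof -
  have sets: "slice_area i \<rightarrow>\<^sub>M N = slice_lebesgue i \<rightarrow>\<^sub>M N" for N :: "'b measure"
    by (rule measurable_cong_sets) (simp_all add: slice_area_def)
  have gm: "(\<lambda>z. ennreal (g z)) \<in> borel_measurable (slice_lebesgue i)"
    unfolding measurable_slice_lebesgue_iff[OF i] by (rule measurable_compose[OF g measurable_ennreal])
  have dm: "(\<lambda>z. ennreal (1 / (1 - (norm z)\<^sup>2)\<^sup>2)) \<in> borel_measurable (slice_lebesgue i)"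
    unfolding measurable_slice_lebesgue_iff[OF i] norm_slice_point_defect[OF i]
    by (intro borel_measurable_disc) measurable
  have "(\<integral>\<^sup>+z. ennreal (g z) \<partial>slice_invariant_measure i)
      = (\<integral>\<^sup>+z. ennreal (1 / (1 - (norm z)\<^sup>2)\<^sup>2) * ennreal (g z) \<partial>slice_area i)"
    unfolding slice_invariant_measure_def by (intro nn_integral_density) (simp_all add: sets gm dm)
  also have "\<dots> = (\<integral>\<^sup>+z. ennreal (1 / pi) * (ennreal (1 / (1 - (norm z)\<^sup>2)\<^sup>2) * ennreal (g z)) \<partial>slice_lebesgue i)"
    unfolding slice_area_def
    by (intro nn_integral_density borel_measurable_times_ennreal gm dm) simp
  also have "\<dots> = ennreal (1 / pi) * (\<integral>\<^sup>+z. ennreal (1 / (1 - (norm z)\<^sup>2)\<^sup>2) * ennreal (g z) \<partial>slice_lebesgue i)"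
    by (intro nn_integral_cmult borel_measurable_times_ennreal gm dm)
  also have "(\<integral>\<^sup>+z. ennreal (1 / (1 - (norm z)\<^sup>2)\<^sup>2) * ennreal (g z) \<partial>slice_lebesgue i)
      = (\<integral>\<^sup>+w. ennreal (1 / (1 - (norm (slice_point i w))\<^sup>2)\<^sup>2) * ennreal (g (slice_point i w)) \<partial>disc)"
    unfolding slice_lebesgue_def
    by (intro nn_integral_embed_measure inj_slice_point i)
      (fold slice_lebesgue_def, intro borel_measurable_times_ennreal gm dm)
  also have "\<dots> = (\<integral>\<^sup>+w. ennreal (g (slice_point i w) * defect w powr (-2)) \<partial>disc)"
  proof (rule nn_integral_cong)
    fix w assume "w \<in> space disc"
    then have d: "0 < defect w" by (intro defect_pos) (simp add: space_restrict_space)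
    have "defect w powr (-2) = 1 / (defect w)\<^sup>2"
      using d powr_realpow[OF d, of 2] by (simp add: powr_minus divide_inverse)
    then show "ennreal (1 / (1 - (norm (slice_point i w))\<^sup>2)\<^sup>2) * ennreal (g (slice_point i w))
        = ennreal (g (slice_point i w) * defect w powr (-2))"
      unfolding norm_slice_point_defect[OF i] using nonneg by (simp add: mult.commute flip: ennreal_mult)
  qed
  finally show ?thesis .
qed

lemma slice_Lp_iff:
  assumes i: "i \<in> imag_units"
  shows "h \<in> slice_Lp p i \<longleftrightarrow> (\<lambda>w. h (slice_point i w)) \<in> borel_measurable disc \<and>
    (\<integral>\<^sup>+w. ennreal (norm (h (slice_point i w)) powr p * defect w powr (-2)) \<partial>disc) < \<infinity>"
proof -
  have "slice_invariant_measure i \<rightarrow>\<^sub>M N = slice_lebesgue i \<rightarrow>\<^sub>M N" for N :: "quat measure"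
    by (rule measurable_cong_sets) (simp_all add: slice_invariant_measure_def slice_area_def)
  then have m: "h \<in> borel_measurable (slice_invariant_measure i) \<longleftrightarrow> (\<lambda>w. h (slice_point i w)) \<in> borel_measurable disc"
    by (simp only: measurable_slice_lebesgue_iff[OF i])
  show ?thesis
  proof (cases "(\<lambda>w. h (slice_point i w)) \<in> borel_measurable disc")
    case True
    have "(\<integral>\<^sup>+z. ennreal (norm (h z) powr p) \<partial>slice_invariant_measure i)
        = ennreal (1 / pi) * (\<integral>\<^sup>+w. ennreal (norm (h (slice_point i w)) powr p * defect w powr (-2)) \<partial>disc)"
      by (intro nn_integral_slice_invariant_measure i norm_powr_measurable True) simp
    then show ?thesis
      using True m by (auto simp: slice_Lp_def ennreal_mult_less_top)
  next
    case False
    then show ?thesis using m by (simp add: slice_Lp_def)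
  qed
qed

text \<open>\<open>slice_point i\<close> is a field embedding, so the reciprocal of
  \<open>slice_powr\<close> becomes a complex power. Agreement on the slice suffices, as
  \<open>slice_extension\<close> evaluates its argument only there.\<close>

lemma slice_Bergman_kernel_slice_point:
  assumes i: "i \<in> imag_units"
  shows "slice_Bergman_kernel \<alpha> i q (slice_point i w)
    = slice_extension i (\<lambda>p. slice_point i ((1 - slice_coord i p * cnj w) powr (- of_real (2 + \<alpha>)))) q"
proof -
  have "1 / slice_powr i (1 - slice_point i z * quat_cnj (slice_point i w)) (2 + \<alpha>)
      = slice_point i ((1 - slice_coord i (slice_point i z) * cnj w) powr (- of_real (2 + \<alpha>)))" for z
  proof -
    have "slice_point i (1 - z * cnj w) = 1 - slice_point i z * quat_cnj (slice_point i w)"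
      using slice_point_add[of i 1 "(-1) *\<^sub>R (z * cnj w)"] slice_point_cmult[of i "-1" "z * cnj w"]
      by (simp add: quat_cnj_slice_point[OF i] slice_point_mult[OF i])
    then have "slice_coord i (1 - slice_point i z * quat_cnj (slice_point i w)) = 1 - z * cnj w"
      by (metis slice_coord_slice_point[OF i])
    then show ?thesis
      by (simp add: slice_powr_def slice_coord_slice_point[OF i] powr_minus slice_point_inverse[OF i] divide_quat_def
          del: of_real_add)
  qed
  then show ?thesis
    by (simp add: slice_Bergman_kernel_def slice_extension_def Let_def)
qed

lemma norm_slice_extension_coord:
  assumes "q \<in> ball 0 1"
  shows "cmod (Complex (q0 q) (norm (quat_Im q))) < 1"
    and "cmod (Complex (q0 q) (- norm (quat_Im q))) < 1"
proof -
  have "(norm (quat_Im q))\<^sup>2 = (q1 q)\<^sup>2 + (q2 q)\<^sup>2 + (q3 q)\<^sup>2"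
    by (simp add: quat_Im_def norm_quat_def)
  then have "cmod (Complex (q0 q) (norm (quat_Im q))) = norm q"
    by (simp add: cmod_def norm_quat_def add.assoc)
  then show "cmod (Complex (q0 q) (norm (quat_Im q))) < 1" using assms by simp
  then show "cmod (Complex (q0 q) (- norm (quat_Im q))) < 1" by (simp add: cmod_def)
qed

text \<open>Integration commutes with the extension: the coefficients \<open>c\<close> and
  \<open>c'\<close> depend on \<open>q\<close> alone and stand on the far left, \<open>j\<close> on
  the far right, and both can be pulled out of the integral. In between only elements of C(i) occur,
  so two complex Bergman integrals remain.\<close>

lemma Bergman_projection_slice_extension:
  fixes h1 h2 :: "complex \<Rightarrow> complex"
  assumes \<alpha>: "\<alpha> > -1" and i: "i \<in> imag_units" and q: "q \<in> ball 0 1"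
    and h: "\<And>w. cmod w < 1 \<Longrightarrow> h (slice_point i w) = slice_point i (h1 w) + slice_point i (h2 w) * j"
    and h1: "integrable disc (\<lambda>w. h1 w * of_real ((\<alpha> + 1) / pi * defect w powr \<alpha>))"
    and h2: "integrable disc (\<lambda>w. h2 w * of_real ((\<alpha> + 1) / pi * defect w powr \<alpha>))"
    and hm: "(\<lambda>w. h (slice_point i w)) \<in> borel_measurable disc"
  defines "P \<equiv> \<lambda>h z. \<integral>w. h w * of_real ((\<alpha> + 1) / pi * defect w powr \<alpha>) * (1 - z * cnj w) powr (- of_real (2 + \<alpha>)) \<partial>disc"
  shows "Bergman_projection \<alpha> i h q
    = slice_extension i (\<lambda>p. slice_point i (P h1 (slice_coord i p)) + slice_point i (P h2 (slice_coord i p)) * j) q"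
proof -
  interpret S: bounded_linear "slice_point i" by (rule bounded_linear_slice_point[OF i])
  define I where "I = sgn (quat_Im q)"
  define z where "z = Complex (q0 q) (norm (quat_Im q))"
  define z' where "z' = Complex (q0 q) (- norm (quat_Im q))"
  have z: "cmod z < 1" "cmod z' < 1" using norm_slice_extension_coord[OF q] by (simp_all add: z_def z'_def)
  define c c' where "c = (1/2) *\<^sub>R (1 - I * i)" and "c' = (1/2) *\<^sub>R (1 + I * i)"
  have ext: "slice_extension i g q = c' * g (slice_point i z') + c * g (slice_point i z)" for g
    unfolding slice_extension_def Let_def c_def c'_def I_def z_def z'_def mult_scaleR_left
    by (rule scaleR_add_right)
  define \<rho> where "\<rho> w = (\<alpha> + 1) / pi * defect w powr \<alpha>" for w
  define k where "k z w = (1 - z * cnj w) powr (- of_real (2 + \<alpha>))" for z w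
  have K: "slice_Bergman_kernel \<alpha> i q (slice_point i w) = c' * slice_point i (k z' w) + c * slice_point i (k z w)" for w
    by (simp only: slice_Bergman_kernel_slice_point[OF i] ext slice_coord_slice_point[OF i] k_def)
  have km: "k z \<in> borel_measurable disc" if "cmod z < 1" for z
    unfolding k_def[abs_def] by (rule kernel_measurable[OF that])
  have Sm: "slice_point i \<in> borel_measurable borel"
    by (intro borel_measurable_continuous_onI S.continuous_on continuous_on_id)
  have skm: "(\<lambda>w. slice_point i (k z w)) \<in> borel_measurable disc" if "cmod z < 1" for z
    by (rule measurable_compose[OF km[OF that] Sm])
  define X where "X w = slice_Bergman_kernel \<alpha> i q w * h w" for w
  have Xm: "X \<in> borel_measurable (slice_lebesgue i)"
    unfolding measurable_slice_lebesgue_iff[OF i] X_def K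
    by (intro borel_measurable_times borel_measurable_add borel_measurable_const skm z hm)
  have sets: "slice_area i \<rightarrow>\<^sub>M N = slice_lebesgue i \<rightarrow>\<^sub>M N" for N :: "'b measure"
    by (rule measurable_cong_sets) (simp_all add: slice_area_def)
  have dm: "(\<lambda>z. (\<alpha> + 1) * (1 - (norm z)\<^sup>2) powr \<alpha>) \<in> borel_measurable (slice_lebesgue i)"
    unfolding measurable_slice_lebesgue_iff[OF i] norm_slice_point_defect[OF i]
    by (intro borel_measurable_disc) measurable
  have "Bergman_projection \<alpha> i h q = (\<integral>w. X w \<partial>weighted_slice_area \<alpha> i)"
    by (simp add: Bergman_projection_def X_def)
  also have "\<dots> = (\<integral>w. ((\<alpha> + 1) * (1 - (norm w)\<^sup>2) powr \<alpha>) *\<^sub>R X w \<partial>slice_area i)"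
    unfolding weighted_slice_area_def using \<alpha> by (intro integral_density) (simp_all add: sets Xm dm)
  also have "\<dots> = (\<integral>w. (1 / pi) *\<^sub>R (((\<alpha> + 1) * (1 - (norm w)\<^sup>2) powr \<alpha>) *\<^sub>R X w) \<partial>slice_lebesgue i)"
    unfolding slice_area_def by (intro integral_density borel_measurable_scaleR Xm dm) simp_all
  also have "\<dots> = (\<integral>w. (1 / pi) *\<^sub>R (((\<alpha> + 1) * (1 - (norm (slice_point i w))\<^sup>2) powr \<alpha>) *\<^sub>R X (slice_point i w)) \<partial>disc)"
  proof -
    have d: "distr disc (slice_lebesgue i) (slice_point i) = slice_lebesgue i"
      unfolding slice_lebesgue_def by (rule embed_measure_eq_distr[OF inj_slice_point[OF i], symmetric])
    have "slice_point i \<in> disc \<rightarrow>\<^sub>M slice_lebesgue i"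
      unfolding slice_lebesgue_def by (rule measurable_embed_measure2[OF inj_slice_point[OF i]])
    moreover have "(\<lambda>w. (1 / pi) *\<^sub>R (((\<alpha> + 1) * (1 - (norm w)\<^sup>2) powr \<alpha>) *\<^sub>R X w)) \<in> borel_measurable (slice_lebesgue i)"
      by (intro borel_measurable_scaleR borel_measurable_const dm Xm)
    ultimately show ?thesis
      by (rule integral_distr[where M=disc and N="slice_lebesgue i" and g="slice_point i", unfolded d])
  qed
  also have "\<dots> = (\<integral>w. c' * (slice_point i (h1 w * of_real (\<rho> w) * k z' w) + slice_point i (h2 w * of_real (\<rho> w) * k z' w) * j)
      + c * (slice_point i (h1 w * of_real (\<rho> w) * k z w) + slice_point i (h2 w * of_real (\<rho> w) * k z w) * j) \<partial>disc)"
  proof (rule Bochner_Integration.integral_cong)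
    fix w assume "w \<in> space disc"
    then have w: "cmod w < 1" by (simp add: space_restrict_space)
    have A: "\<rho> w *\<^sub>R (slice_point i (k z w) * h (slice_point i w))
        = slice_point i (h1 w * of_real (\<rho> w) * k z w) + slice_point i (h2 w * of_real (\<rho> w) * k z w) * j" for z
    proof -
      have "slice_point i (g * of_real (\<rho> w) * k z w) = \<rho> w *\<^sub>R (slice_point i (k z w) * slice_point i g)" for g
      proof -
        have "g * of_real (\<rho> w) * k z w = \<rho> w *\<^sub>R (k z w * g)" by (simp add: scaleR_conv_of_real mult_ac)
        then show ?thesis by (simp only: slice_point_cmult slice_point_mult[OF i])
      qed
      then show ?thesis unfolding h[OF w] by (simp add: distrib_left scaleR_add_right mult.assoc)
    qed
    have "(1 / pi) *\<^sub>R (((\<alpha> + 1) * (1 - (norm (slice_point i w))\<^sup>2) powr \<alpha>) *\<^sub>R X (slice_point i w))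
        = \<rho> w *\<^sub>R X (slice_point i w)"
      unfolding norm_slice_point_defect[OF i] by (simp add: \<rho>_def)
    also have "\<dots> = c' * (\<rho> w *\<^sub>R (slice_point i (k z' w) * h (slice_point i w)))
        + c * (\<rho> w *\<^sub>R (slice_point i (k z w) * h (slice_point i w)))"
      unfolding X_def K by (simp add: distrib_right scaleR_add_right mult.assoc)
    finally show "(1 / pi) *\<^sub>R (((\<alpha> + 1) * (1 - (norm (slice_point i w))\<^sup>2) powr \<alpha>) *\<^sub>R X (slice_point i w))
        = c' * (slice_point i (h1 w * of_real (\<rho> w) * k z' w) + slice_point i (h2 w * of_real (\<rho> w) * k z' w) * j)
          + c * (slice_point i (h1 w * of_real (\<rho> w) * k z w) + slice_point i (h2 w * of_real (\<rho> w) * k z w) * j)"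
      unfolding A .
  qed simp
  also have "\<dots> = c' * (slice_point i (P h1 z') + slice_point i (P h2 z') * j)
      + c * (slice_point i (P h1 z) + slice_point i (P h2 z) * j)"
  proof -
    have int: "integrable disc (\<lambda>w. h w * of_real (\<rho> w) * k z w)"
      if "integrable disc (\<lambda>w. h w * of_real (\<rho> w))" "cmod z < 1" for h z
      unfolding k_def using \<alpha> by (intro integrable_kernel_mult that) simp
    have B: "has_bochner_integral disc (\<lambda>w. c * (slice_point i (h1 w * of_real (\<rho> w) * k z w) + slice_point i (h2 w * of_real (\<rho> w) * k z w) * j))
        (c * (slice_point i (P h1 z) + slice_point i (P h2 z) * j))" if "cmod z < 1" for c z
      unfolding P_def \<rho>_def[symmetric] k_def[symmetric]
      by (intro has_bochner_integral_bounded_linear[OF bounded_linear_mult_right] has_bochner_integral_add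
          has_bochner_integral_bounded_linear[OF bounded_linear_mult_left]
          has_bochner_integral_bounded_linear[OF bounded_linear_slice_point[OF i]]
          has_bochner_integral_integrable int that h1[folded \<rho>_def] h2[folded \<rho>_def])
    show ?thesis
      by (rule has_bochner_integral_integral_eq) (intro has_bochner_integral_add B z)
  qed
  finally show ?thesis by (simp only: ext slice_coord_slice_point[OF i])
qed

text \<open>For the conjugate point in the representation formula.\<close>

lemma nn_integral_disc_cnj:
  assumes f: "f \<in> borel_measurable borel"
  shows "(\<integral>\<^sup>+w. f (cnj w) \<partial>disc) = (\<integral>\<^sup>+w. f w \<partial>disc)"
proof -
  have cnjm: "cnj \<in> borel_measurable borel"
    by (intro borel_measurable_continuous_onI continuous_intros)
  have im: "(\<lambda>w. f w * indicator (ball 0 1) w) \<in> borel_measurable borel"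
    if "f \<in> borel_measurable borel" for f :: "complex \<Rightarrow> ennreal"
    by (intro borel_measurable_times_ennreal borel_measurable_indicator borel_open open_ball that)
  have eq: "(\<integral>\<^sup>+w. f w \<partial>disc) = (\<integral>\<^sup>+w. f w * indicator (ball 0 1) w \<partial>lborel)"
    if "f \<in> borel_measurable borel" for f
    using im[OF that] by (subst nn_integral_restrict_space) (auto simp: nn_integral_completion)
  have "(\<integral>\<^sup>+w. f w \<partial>disc) = (\<integral>\<^sup>+w. f w * indicator (ball 0 1) w \<partial>distr lborel borel cnj)"
    unfolding distr_lborel_cnj by (rule eq[OF f])
  also have "\<dots> = (\<integral>\<^sup>+w. f (cnj w) * indicator (ball 0 1) (cnj w) \<partial>lborel)"
    using im[OF f] cnjm by (subst nn_integral_distr) auto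
  also have "\<dots> = (\<integral>\<^sup>+w. f (cnj w) * indicator (ball 0 1) w \<partial>lborel)"
    by (intro nn_integral_cong) (simp add: indicator_def)
  also have "\<dots> = (\<integral>\<^sup>+w. f (cnj w) \<partial>disc)"
    by (rule eq[OF measurable_compose[OF cnjm f], symmetric])
  finally show ?thesis by simp
qed

lemma continuous_on_deriv_x0_slice:
  assumes f: "f \<in> slice_regular" and i: "i \<in> imag_units"
  shows "continuous_on (ball 0 1) (\<lambda>w. (deriv_x0 ^^ n) f (slice_point i w))"
proof -
  interpret S: bounded_linear "slice_point i" by (rule bounded_linear_slice_point[OF i])
  obtain j where j: "j \<in> imag_units" "i \<bullet> j = 0" using imag_unit_orthogonal_exists[OF i] .
  define F where "F z = slice_coord i (f (slice_point i z))" for z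
  define G where "G z = slice_coord i (- (f (slice_point i z) * j))" for z
  note FG = slice_regular_components[OF f i j, folded F_def G_def]
  have "continuous_on (ball 0 1) (\<lambda>w. slice_point i ((deriv ^^ n) F w) + slice_point i ((deriv ^^ n) G w) * j)"
    by (intro continuous_on_add continuous_on_mult continuous_on_const S.continuous_on
        holomorphic_on_imp_continuous_on holomorphic_higher_deriv FG open_ball)
  then show ?thesis
    by (rule continuous_on_cong[THEN iffD1, rotated 2])
      (use deriv_x0_funpow_slice_point[OF i FG] in auto)
qed

text \<open>By the representation formula, a single slice controls all of them.\<close>

lemma slice_Besov_iff:
  assumes f: "f \<in> slice_regular" and i: "i \<in> imag_units" and p: "p \<ge> 1"
  shows "f \<in> slice_Besov p n \<longleftrightarrow>
    (\<integral>\<^sup>+w. ennreal ((defect w ^ n * norm ((deriv_x0 ^^ n) f (slice_point i w))) powr p * defect w powr (-2)) \<partial>disc) < \<infinity>"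
proof -
  define X where "X i = (\<integral>\<^sup>+w. ennreal ((defect w ^ n * norm ((deriv_x0 ^^ n) f (slice_point i w))) powr p * defect w powr (-2)) \<partial>disc)" for i
  have eq: "(\<integral>\<^sup>+z. ennreal (norm ((1 - (norm z)\<^sup>2) ^ n *\<^sub>R (deriv_x0 ^^ n) f z) powr p) \<partial>slice_invariant_measure i)
      = ennreal (1 / pi) * X i" if i: "i \<in> imag_units" for i
  proof -
    have "(\<lambda>w. (deriv_x0 ^^ n) f (slice_point i w)) \<in> borel_measurable disc"
      by (rule continuous_imp_measurable_on_sets_lebesgue[OF continuous_on_deriv_x0_slice[OF f i]]) simp
    then have "(\<lambda>w. (1 - (norm (slice_point i w))\<^sup>2) ^ n *\<^sub>R (deriv_x0 ^^ n) f (slice_point i w)) \<in> borel_measurable disc"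
      unfolding norm_slice_point_defect[OF i]
      by (intro borel_measurable_scaleR) (intro borel_measurable_disc, measurable)
    then have "(\<integral>\<^sup>+z. ennreal (norm ((1 - (norm z)\<^sup>2) ^ n *\<^sub>R (deriv_x0 ^^ n) f z) powr p) \<partial>slice_invariant_measure i)
        = ennreal (1 / pi) * (\<integral>\<^sup>+w. ennreal (norm ((1 - (norm (slice_point i w))\<^sup>2) ^ n *\<^sub>R
            (deriv_x0 ^^ n) f (slice_point i w)) powr p * defect w powr (-2)) \<partial>disc)"
      by (intro nn_integral_slice_invariant_measure i norm_powr_measurable) simp_all
    also have "(\<integral>\<^sup>+w. ennreal (norm ((1 - (norm (slice_point i w))\<^sup>2) ^ n *\<^sub>R
            (deriv_x0 ^^ n) f (slice_point i w)) powr p * defect w powr (-2)) \<partial>disc) = X i"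
      unfolding X_def norm_slice_point_defect[OF i]
      by (intro nn_integral_cong) (simp add: space_restrict_space defect_pos abs_of_pos)
    finally show ?thesis .
  qed
  have SUP_eq: "(SUP i\<in>imag_units. \<integral>\<^sup>+z. ennreal (norm ((1 - (norm z)\<^sup>2) ^ n *\<^sub>R (deriv_x0 ^^ n) f z) powr p)
      \<partial>slice_invariant_measure i) = (SUP i\<in>imag_units. ennreal (1 / pi) * X i)"
    by (rule SUP_cong[OF refl eq])
  have fin_iff: "ennreal (1 / pi) * Y < \<infinity> \<longleftrightarrow> Y < \<infinity>" for Y
    by (auto simp: ennreal_mult_less_top)
  have "f \<in> slice_Besov p n \<longleftrightarrow> X i < \<infinity>"
  proof
    assume "f \<in> slice_Besov p n"
    then have "(SUP i\<in>imag_units. ennreal (1 / pi) * X i) < \<infinity>"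
      unfolding slice_Besov_def mem_Collect_eq SUP_eq by blast
    moreover have "ennreal (1 / pi) * X i \<le> (SUP i\<in>imag_units. ennreal (1 / pi) * X i)"
      by (rule SUP_upper[OF i])
    ultimately show "X i < \<infinity>" using fin_iff by (metis le_less_trans)
  next
    assume fin: "X i < \<infinity>"
    \<comment> \<open>Cut off outside the disc to obtain a Borel function on the plane, as
      \<open>nn_integral_disc_cnj\<close> requires.\<close>
    define N where "N w = indicator (ball 0 1) w *\<^sub>R norm ((deriv_x0 ^^ n) f (slice_point i w))" for w
    have Nm: "N \<in> borel_measurable borel"
      unfolding N_def[abs_def]
      by (intro borel_measurable_continuous_on_indicator continuous_on_norm continuous_on_deriv_x0_slice f i) simp
    have N: "N w = norm ((deriv_x0 ^^ n) f (slice_point i w))" if "cmod w < 1" for w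
      using that by (simp add: N_def)
    define u where "u w = (defect w ^ n * N w) powr p * defect w powr (-2)" for w
    have um: "u \<in> borel_measurable borel"
      using Nm unfolding u_def by measurable
    have ueu: "(\<lambda>w. ennreal (u w)) \<in> borel_measurable borel"
      by (rule measurable_compose[OF um measurable_ennreal])
    have X: "X i = (\<integral>\<^sup>+w. ennreal (u w) \<partial>disc)"
      unfolding X_def u_def by (intro nn_integral_cong) (simp add: N space_restrict_space)
    then have Xc: "X i = (\<integral>\<^sup>+w. ennreal (u (cnj w)) \<partial>disc)"
      using nn_integral_disc_cnj[OF ueu] by simp
    \<comment> \<open>The bound for all slices at once: no other slice than that of \<open>i\<close>
      occurs in it.\<close>
    define B where "B = (\<integral>\<^sup>+w. ennreal ((defect w ^ n * N w + defect (cnj w) ^ n * N (cnj w)) powr p * defect w powr (-2)) \<partial>disc)"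
    have "B \<le> (\<integral>\<^sup>+w. ennreal (2 powr p) * (ennreal (u w) + ennreal (u (cnj w))) \<partial>disc)"
      unfolding B_def
    proof (rule nn_integral_mono)
      fix w assume "w \<in> space disc"
      then have d: "0 < defect w" by (intro defect_pos) (simp add: space_restrict_space)
      have dc: "defect (cnj w) = defect w" by (simp add: defect_def)
      have "0 \<le> N w" "0 \<le> N (cnj w)" by (simp_all add: N_def)
      then have "(defect w ^ n * N w + defect (cnj w) ^ n * N (cnj w)) powr p
          \<le> 2 powr p * ((defect w ^ n * N w) powr p + (defect (cnj w) ^ n * N (cnj w)) powr p)"
        using p d dc by (intro powr_add_le) auto
      then have "(defect w ^ n * N w + defect (cnj w) ^ n * N (cnj w)) powr p * defect w powr (-2)
          \<le> 2 powr p * ((defect w ^ n * N w) powr p + (defect (cnj w) ^ n * N (cnj w)) powr p) * defect w powr (-2)"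
        by (intro mult_right_mono) auto
      also have "\<dots> = 2 powr p * (u w + u (cnj w))"
        unfolding u_def dc by (simp only: distrib_right mult.assoc)
      finally show "ennreal ((defect w ^ n * N w + defect (cnj w) ^ n * N (cnj w)) powr p * defect w powr (-2))
          \<le> ennreal (2 powr p) * (ennreal (u w) + ennreal (u (cnj w)))"
        by (simp add: u_def flip: ennreal_mult ennreal_plus)
    qed
    also have "\<dots> = ennreal (2 powr p) * (X i + X i)"
    proof -
      have m: "(\<lambda>w. ennreal (u w)) \<in> borel_measurable disc" "(\<lambda>w. ennreal (u (cnj w))) \<in> borel_measurable disc"
        by (intro borel_measurable_disc ueu)
          (intro borel_measurable_disc measurable_compose[OF _ ueu], measurable)
      have "X i + X i = (\<integral>\<^sup>+w. ennreal (u w) \<partial>disc) + (\<integral>\<^sup>+w. ennreal (u (cnj w)) \<partial>disc)"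
        by (simp only: X[symmetric] Xc[symmetric])
      also have "\<dots> = (\<integral>\<^sup>+w. ennreal (u w) + ennreal (u (cnj w)) \<partial>disc)"
        by (intro nn_integral_add[symmetric] m)
      finally show ?thesis by (simp only: nn_integral_cmult[OF borel_measurable_add[OF m]])
    qed
    also have "\<dots> < \<infinity>" using fin by (simp add: ennreal_mult_less_top)
    finally have B_fin: "B < \<infinity>" .
    have "X i' \<le> B" if i': "i' \<in> imag_units" for i'
      unfolding X_def B_def
    proof (intro nn_integral_mono ennreal_leI mult_right_mono powr_mono2)
      fix w assume "w \<in> space disc"
      then have w: "cmod w < 1" by (simp add: space_restrict_space)
      have "norm (i' * i) = 1" using i i' by (simp add: norm_mult imag_units_def)
      \<comment> \<open>These bounds are absorbed by the factor 1/2 of the representation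
        formula.\<close>
      then have n2: "norm (1 + i' * i) \<le> 2" "norm (1 - i' * i) \<le> 2"
        using norm_triangle_ineq[of 1 "i' * i"] norm_triangle_ineq4[of 1 "i' * i"] by simp_all
      let ?D = "\<lambda>w. (deriv_x0 ^^ n) f (slice_point i w)"
      have "norm ((1 + i' * i) * ?D (cnj w) + (1 - i' * i) * ?D w)
          \<le> norm (1 + i' * i) * norm (?D (cnj w)) + norm (1 - i' * i) * norm (?D w)"
        by (rule order_trans[OF norm_triangle_ineq]) (simp add: norm_mult)
      also have "\<dots> \<le> 2 * norm (?D (cnj w)) + 2 * norm (?D w)"
        by (intro add_mono mult_right_mono n2) auto
      finally have "norm ((deriv_x0 ^^ n) f (slice_point i' w)) \<le> norm (?D w) + norm (?D (cnj w))"
        unfolding slice_regular_representation[OF f i i' w, of n] by simp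
      also have "\<dots> = N w + N (cnj w)" using w by (simp add: N)
      finally have "defect w ^ n * norm ((deriv_x0 ^^ n) f (slice_point i' w)) \<le> defect w ^ n * (N w + N (cnj w))"
        using defect_pos[OF w] by (intro mult_left_mono) auto
      then show "defect w ^ n * norm ((deriv_x0 ^^ n) f (slice_point i' w)) \<le> defect w ^ n * N w + defect (cnj w) ^ n * N (cnj w)"
        by (simp add: distrib_left defect_def)
      show "0 \<le> defect w ^ n * norm ((deriv_x0 ^^ n) f (slice_point i' w))"
        using defect_pos[OF w] by simp
    qed (use p in auto)
    then have "(SUP i\<in>imag_units. ennreal (1 / pi) * X i) \<le> ennreal (1 / pi) * B"
      by (intro SUP_least mult_left_mono) auto
    also have "\<dots> < \<infinity>" using B_fin fin_iff by simp
    finally show "f \<in> slice_Besov p n"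
      using f unfolding slice_Besov_def mem_Collect_eq SUP_eq by blast
  qed
  then show ?thesis by (simp only: X_def)
qed

text \<open>The right-hand side does not mention \<open>n\<close>, so the equivalence also shows
  that \<open>slice_Besov p n\<close> is the same set for all orders with
  \<open>p * real n > 1\<close>. The equality is asserted on the ball only, since functions are
  total.\<close>

theorem proposition4p26:
  fixes \<alpha> p :: real and n :: nat and i :: quat and f :: "quat \<Rightarrow> quat"
  assumes "\<alpha> > -1" and "p \<ge> 1" and "p * real n > 1"
    and "i \<in> imag_units" and "f \<in> slice_regular"
  shows "f \<in> slice_Besov p n \<longleftrightarrow>
    (\<exists>h \<in> slice_Lp p i. \<forall>q \<in> ball 0 1. f q = Bergman_projection \<alpha> i h q)"
proof -
  note \<alpha> = assms(1) and p = assms(2,3) and i = assms(4) and f = assms(5)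
  obtain j where j: "j \<in> imag_units" "i \<bullet> j = 0" using imag_unit_orthogonal_exists[OF i] .
  have nj: "norm j = 1" using j by (simp add: imag_units_def)
  define F where "F z = slice_coord i (f (slice_point i z))" for z
  define G where "G z = slice_coord i (- (f (slice_point i z) * j))" for z
  note FG = slice_regular_components[OF f i j, folded F_def G_def]
  define D where "D w = (deriv_x0 ^^ n) f (slice_point i w)" for w
  have D: "D w = slice_point i ((deriv ^^ n) F w) + slice_point i ((deriv ^^ n) G w) * j" if "cmod w < 1" for w
    unfolding D_def by (rule deriv_x0_funpow_slice_point[OF i FG that])
  have wsp: "cmod w < 1" if "w \<in> space disc" for w using that by (simp add: space_restrict_space)
  have Dm: "(\<lambda>w. (\<bar>defect w\<bar> ^ n * norm (D w)) powr p * defect w powr (-2)) \<in> borel_measurable disc"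
  proof -
    have "D \<in> borel_measurable disc"
      unfolding D_def by (rule continuous_imp_measurable_on_sets_lebesgue[OF continuous_on_deriv_x0_slice[OF f i]]) simp
    then have "(\<lambda>w. \<bar>defect w\<bar> ^ n *\<^sub>R D w) \<in> borel_measurable disc"
      by (intro borel_measurable_scaleR) (intro borel_measurable_disc, measurable)
    from norm_powr_measurable[OF this, of p]
    have "(\<lambda>w. (\<bar>defect w\<bar> ^ n * norm (D w)) powr p) \<in> borel_measurable disc" by simp
    moreover have "(\<lambda>w. defect w powr (-2)) \<in> borel_measurable disc"
      by (intro borel_measurable_disc) measurable
    ultimately show ?thesis by (rule borel_measurable_times)
  qed
  define P where "P h z = (\<integral>w. h w * of_real ((\<alpha> + 1) / pi * defect w powr \<alpha>) * (1 - z * cnj w) powr (- of_real (2 + \<alpha>)) \<partial>disc)" for h z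
  have int: "integrable disc (\<lambda>w. h w * of_real ((\<alpha> + 1) / pi * defect w powr \<alpha>))"
    if h: "h \<in> borel_measurable disc" "(\<integral>\<^sup>+w. ennreal (cmod (h w) powr p * defect w powr (-2)) \<partial>disc) < \<infinity>" for h
  proof -
    have "integrable disc (\<lambda>w. of_real ((\<alpha> + 1) / pi) * (h w * of_real (defect w powr \<alpha>)))"
      by (intro integrable_mult_right integrable_disc_of_Lp[OF h(1) p(1) \<alpha> h(2)])
    then show ?thesis by (simp add: mult_ac)
  qed
  have cm: "slice_coord i \<in> borel_measurable borel"
    by (intro borel_measurable_continuous_onI linear_continuous_on bounded_linear_slice_coord i)
  have sm: "slice_point i \<in> borel_measurable borel"
    by (intro borel_measurable_continuous_onI linear_continuous_on bounded_linear_slice_point i)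
  \<comment> \<open>\<open>nn_integral_powr_finite\<close> wants functions that are nonnegative on
    the whole plane, but \<open>defect\<close> is negative outside the closed disc; inside, the
    absolute value changes nothing.\<close>
  have abs_eq: "(\<integral>\<^sup>+w. ennreal ((\<bar>defect w\<bar> ^ n * N w) powr p * defect w powr (-2)) \<partial>disc)
      = (\<integral>\<^sup>+w. ennreal ((defect w ^ n * N w) powr p * defect w powr (-2)) \<partial>disc)" for N :: "complex \<Rightarrow> real"
    by (intro nn_integral_cong) (simp add: abs_of_pos defect_pos wsp)
  show ?thesis
  proof
    assume "f \<in> slice_Besov p n"
    then have fin: "(\<integral>\<^sup>+w. ennreal ((\<bar>defect w\<bar> ^ n * norm (D w)) powr p * defect w powr (-2)) \<partial>disc) < \<infinity>"
      unfolding abs_eq by (simp only: slice_Besov_iff[OF f i p(1)] D_def)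
    have comp: "(\<integral>\<^sup>+w. ennreal ((defect w ^ n * cmod ((deriv ^^ n) H w)) powr p * defect w powr (-2)) \<partial>disc) < \<infinity>"
      if le: "\<And>w. cmod w < 1 \<Longrightarrow> cmod ((deriv ^^ n) H w) \<le> 2 * norm (D w)" for H
      unfolding abs_eq[symmetric]
    proof (rule nn_integral_powr_finite[OF _ _ _ _ _ _ _ Dm Dm _ fin fin, where A=2 and B=0])
      show "\<bar>defect w\<bar> ^ n * cmod ((deriv ^^ n) H w) \<le> 2 * (\<bar>defect w\<bar> ^ n * norm (D w)) + 0 * (\<bar>defect w\<bar> ^ n * norm (D w))"
        if "w \<in> space disc" for w
        using mult_left_mono[OF le[OF wsp[OF that]], of "\<bar>defect w\<bar> ^ n"] by simp
    qed (use p in auto)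
    have "cmod ((deriv ^^ n) F w) \<le> 2 * norm (D w)" "cmod ((deriv ^^ n) G w) \<le> 2 * norm (D w)" if "cmod w < 1" for w
      using norm_slice_coord_le[OF i, of "D w"] norm_slice_coord_le[OF i, of "- (D w * j)"]
        slice_coord_splitting[OF i j, of "(deriv ^^ n) F w" "(deriv ^^ n) G w"] nj
      by (simp_all add: norm_mult flip: D[OF that])
    note FG_fin = comp[OF this(1)] comp[OF this(2)]
    obtain h1 where h1: "h1 \<in> borel_measurable disc"
      "(\<integral>\<^sup>+w. ennreal (cmod (h1 w) powr p * defect w powr (-2)) \<partial>disc) < \<infinity>" "\<And>z. cmod z < 1 \<Longrightarrow> F z = P h1 z"
      using Bergman_representation[OF FG(1) p \<alpha> FG_fin(1), folded P_def] by blast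
    obtain h2 where h2: "h2 \<in> borel_measurable disc"
      "(\<integral>\<^sup>+w. ennreal (cmod (h2 w) powr p * defect w powr (-2)) \<partial>disc) < \<infinity>" "\<And>z. cmod z < 1 \<Longrightarrow> G z = P h2 z"
      using Bergman_representation[OF FG(2) p \<alpha> FG_fin(2), folded P_def] by blast
    \<comment> \<open>\<open>slice_coord i\<close> acts as a left inverse of
      \<open>slice_point i\<close> defined on all quaternions, so \<open>h\<close> is total and has
      the components \<open>h1\<close> and \<open>h2\<close> on the slice.\<close>
    define h where "h q = slice_point i (h1 (slice_coord i q)) + slice_point i (h2 (slice_coord i q)) * j" for q
    have h: "h (slice_point i w) = slice_point i (h1 w) + slice_point i (h2 w) * j" for w
      by (simp add: h_def slice_coord_slice_point[OF i])
    have hm: "(\<lambda>w. h (slice_point i w)) \<in> borel_measurable disc"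
      unfolding h by (intro borel_measurable_add borel_measurable_times borel_measurable_const
          measurable_compose[OF _ sm] h1 h2)
    have "h \<in> slice_Lp p i"
      unfolding slice_Lp_iff[OF i]
    proof
      show "(\<integral>\<^sup>+w. ennreal (norm (h (slice_point i w)) powr p * defect w powr (-2)) \<partial>disc) < \<infinity>"
      proof (rule nn_integral_powr_finite[OF _ _ _ _ _ _ _ _ _ _ h1(2) h2(2), where A=1 and B=1])
        show "(\<lambda>w. cmod (h1 w) powr p * defect w powr (-2)) \<in> borel_measurable disc"
          "(\<lambda>w. cmod (h2 w) powr p * defect w powr (-2)) \<in> borel_measurable disc"
          by (intro borel_measurable_times norm_powr_measurable h1 h2 borel_measurable_disc, measurable)+
        show "norm (h (slice_point i w)) \<le> 1 * cmod (h1 w) + 1 * cmod (h2 w)" for w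
          unfolding h by (rule order_trans[OF norm_triangle_ineq]) (simp add: norm_mult norm_slice_point[OF i] nj)
      qed (use p in auto)
    qed (rule hm)
    moreover have "f q = Bergman_projection \<alpha> i h q" if q: "q \<in> ball 0 1" for q
    proof -
      have "Bergman_projection \<alpha> i h q = slice_extension i
          (\<lambda>p. slice_point i (P h1 (slice_coord i p)) + slice_point i (P h2 (slice_coord i p)) * j) q"
        unfolding P_def by (rule Bergman_projection_slice_extension[OF \<alpha> i q h int[OF h1(1,2)] int[OF h2(1,2)] hm])
      \<comment> \<open>The extension evaluates only two conjugate points of the slice, both inside
        the ball, where \<open>f\<close> already equals the two integrals.\<close>
      also have "\<dots> = slice_extension i f q"
        using norm_slice_extension_coord[OF q]
        by (simp add: slice_extension_def Let_def slice_coord_slice_point[OF i] FG(3) flip: h1(3) h2(3))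
      also have "\<dots> = f q" by (rule slice_extension_slice_regular[OF f i q])
      finally show ?thesis by simp
    qed
    ultimately show "\<exists>h \<in> slice_Lp p i. \<forall>q \<in> ball 0 1. f q = Bergman_projection \<alpha> i h q" by blast
  next
    assume "\<exists>h \<in> slice_Lp p i. \<forall>q \<in> ball 0 1. f q = Bergman_projection \<alpha> i h q"
    then obtain h where h_Lp: "h \<in> slice_Lp p i" and fh: "\<And>q. q \<in> ball 0 1 \<Longrightarrow> f q = Bergman_projection \<alpha> i h q"
      by blast
    define h0 where "h0 w = h (slice_point i w)" for w
    have h0: "h0 \<in> borel_measurable disc"
      "(\<integral>\<^sup>+w. ennreal (norm (h0 w) powr p * defect w powr (-2)) \<partial>disc) < \<infinity>"
      using h_Lp unfolding slice_Lp_iff[OF i] h0_def by auto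
    define h1 where "h1 w = slice_coord i (h0 w)" for w
    define h2 where "h2 w = slice_coord i (- (h0 w * j))" for w
    have h: "h (slice_point i w) = slice_point i (h1 w) + slice_point i (h2 w) * j" for w
      unfolding h1_def h2_def h0_def by (rule slice_splitting[OF i j])
    have hm: "h1 \<in> borel_measurable disc" "h2 \<in> borel_measurable disc"
      unfolding h1_def h2_def
      by (intro measurable_compose[OF _ cm] borel_measurable_uminus borel_measurable_times borel_measurable_const h0)+
    have h0m: "(\<lambda>w. norm (h0 w) powr p * defect w powr (-2)) \<in> borel_measurable disc"
      by (intro borel_measurable_times norm_powr_measurable h0 borel_measurable_disc) measurable
    have comp: "(\<integral>\<^sup>+w. ennreal (cmod (H w) powr p * defect w powr (-2)) \<partial>disc) < \<infinity>"
      if "\<And>w. cmod (H w) \<le> 2 * norm (h0 w)" for H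
      by (rule nn_integral_powr_finite[OF _ _ _ _ _ _ _ h0m h0m _ h0(2) h0(2), where A=2 and B=0]) (use p that in auto)
    have "cmod (h1 w) \<le> 2 * norm (h0 w)" "cmod (h2 w) \<le> 2 * norm (h0 w)" for w
      using norm_slice_coord_le[OF i, of "h0 w"] norm_slice_coord_le[OF i, of "- (h0 w * j)"] nj
      by (simp_all add: h1_def h2_def norm_mult)
    note h_fin = comp[OF this(1)] comp[OF this(2)]
    \<comment> \<open>On the slice of \<open>i\<close> itself the extension changes nothing;
      uniqueness of the splitting then identifies \<open>F\<close> and \<open>G\<close> with the
      Bergman integrals of \<open>h1\<close> and \<open>h2\<close>.\<close>
    have f_eq: "f (slice_point i z) = slice_point i (P h1 z) + slice_point i (P h2 z) * j" if "cmod z < 1" for z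
    proof -
      have q: "slice_point i z \<in> ball 0 1" using that by (simp add: norm_slice_point[OF i])
      have "Bergman_projection \<alpha> i h (slice_point i z) = slice_extension i
          (\<lambda>p. slice_point i (P h1 (slice_coord i p)) + slice_point i (P h2 (slice_coord i p)) * j) (slice_point i z)"
        unfolding P_def
        by (rule Bergman_projection_slice_extension[OF \<alpha> i q h int[OF hm(1) h_fin(1)] int[OF hm(2) h_fin(2)] h0(1)[unfolded h0_def]])
      then show ?thesis
        by (simp add: fh[OF q] slice_extension_slice_point[OF i] slice_coord_slice_point[OF i])
    qed
    have "F z = P h1 z" "G z = P h2 z" if "cmod z < 1" for z
      unfolding F_def G_def f_eq[OF that] by (rule slice_coord_splitting[OF i j])+
    then have FG_fin:
      "(\<integral>\<^sup>+w. ennreal ((defect w ^ n * cmod ((deriv ^^ n) F w)) powr p * defect w powr (-2)) \<partial>disc) < \<infinity>"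
      "(\<integral>\<^sup>+w. ennreal ((defect w ^ n * cmod ((deriv ^^ n) G w)) powr p * defect w powr (-2)) \<partial>disc) < \<infinity>"
      unfolding P_def
      by (intro Bergman_integral_higher_deriv_bound[OF hm(1) p \<alpha> h_fin(1)]
          Bergman_integral_higher_deriv_bound[OF hm(2) p \<alpha> h_fin(2)]; simp)+
    have Hm: "(\<lambda>w. (\<bar>defect w\<bar> ^ n * cmod ((deriv ^^ n) H w)) powr p * defect w powr (-2)) \<in> borel_measurable disc"
      if "H holomorphic_on ball 0 1" for H
    proof -
      have "(deriv ^^ n) H \<in> borel_measurable disc"
        by (intro borel_measurable_disc_continuous holomorphic_on_imp_continuous_on holomorphic_higher_deriv that open_ball)
      then have "(\<lambda>w. of_real (\<bar>defect w\<bar> ^ n) * (deriv ^^ n) H w) \<in> borel_measurable disc"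
        by (intro borel_measurable_times) (intro borel_measurable_disc, measurable)
      from norm_powr_measurable[OF this, of p]
      have "(\<lambda>w. (\<bar>defect w\<bar> ^ n * cmod ((deriv ^^ n) H w)) powr p) \<in> borel_measurable disc"
        by (simp add: norm_mult norm_power)
      moreover have "(\<lambda>w. defect w powr (-2)) \<in> borel_measurable disc"
        by (intro borel_measurable_disc) measurable
      ultimately show ?thesis by (rule borel_measurable_times)
    qed
    have "(\<integral>\<^sup>+w. ennreal ((\<bar>defect w\<bar> ^ n * norm (D w)) powr p * defect w powr (-2)) \<partial>disc) < \<infinity>"
    proof (rule nn_integral_powr_finite[OF _ _ _ _ _ _ _ Hm[OF FG(1)] Hm[OF FG(2)] _
          FG_fin(1)[folded abs_eq] FG_fin(2)[folded abs_eq], where A=1 and B=1])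
      fix w assume w: "w \<in> space disc"
      have "norm (D w) \<le> cmod ((deriv ^^ n) F w) + cmod ((deriv ^^ n) G w)"
        unfolding D[OF wsp[OF w]] by (rule order_trans[OF norm_triangle_ineq]) (simp add: norm_mult norm_slice_point[OF i] nj)
      from mult_left_mono[OF this, of "\<bar>defect w\<bar> ^ n"]
      show "\<bar>defect w\<bar> ^ n * norm (D w) \<le> 1 * (\<bar>defect w\<bar> ^ n * cmod ((deriv ^^ n) F w))
          + 1 * (\<bar>defect w\<bar> ^ n * cmod ((deriv ^^ n) G w))"
        by (simp add: distrib_left)
    qed (use p in auto)
    then show "f \<in> slice_Besov p n"
      unfolding slice_Besov_iff[OF f i p(1)] abs_eq by (simp only: D_def)
  qed
qed

end
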